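(* Let $M^n$, $n\geq 4$, be a conformally flat Riemannian manifold and let $\kappa\geq 0$. Suppose there exist an isometric immersion $f:\widetilde M\to\mathbb H_\kappa^{n+1}$ of the universal covering and a group homomorphism $\rho:\pi_1(M)\to\mathrm{Iso}(\mathbb H_\kappa^{n+1})$ such that $$f(\gamma\cdot x)=\rho(\gamma)\cdot f(x),\qquad x\in\widetilde M,\ \gamma\in\pi_1(M).$$ Then $M$ is $1$-QC.
   Context: Let $K(\sigma)$ denote the sectional curvature of a tangent $2$-plane $\sigma$. A Riemannian metric on a manifold $M$ is globally $1$-QC with respect to a smooth line field $\xi$ (section of the projectivized tangent bundle) if there is a function $\theta:M\to(0,\frac{\pi}{2})$ such that for every $p\in M$ and all $2$-planes $\sigma_1,\sigma_2\subset T_pM$ with $\measuredangle(\sigma_1,\xi)=\measuredangle(\sigma_2,\xi)=\theta(p)$ one has $K(\sigma_1)=K(\sigma_2)$. It is locally $1$-QC if every point has an open neighborhood on which the metric is globally $1$-QC with respect to some line field. A point is isotropic if all its tangent $2$-planes have the same sectional curvature. The metric (or $M$) is $1$-QC if every non-isotropic point has an open neighborhood which is locally $1$-QC. Conformally flat means locally conformally flat. $\mathbb H_\kappa^m$ is the $m$-dimensional hyperbolic space of constant sectional curvature $-\kappa$ if $\kappa>0$, and the Euclidean space $\mathbb R^m$ if $\kappa=0$. $\pi_1(M)$ acts on $\widetilde M$ by deck transformations. *)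

theory Defs
  imports "HOL-Analysis.Analysis" "HOL-Algebra.Bij"
begin

section \<open>Smooth maps between Euclidean spaces\<close>

text \<open>The class \<open>C\<^sup>k\<close> by recursion on directional derivatives; the domain is meant to be open.\<close>

primrec Ck_on :: "nat \<Rightarrow> ('e::euclidean_space \<Rightarrow> 'f::real_normed_vector) \<Rightarrow> 'e set \<Rightarrow> bool" where
  "Ck_on 0 f S \<longleftrightarrow> continuous_on S f"
| "Ck_on (Suc k) f S \<longleftrightarrow>
     (\<forall>x\<in>S. f differentiable (at x)) \<and>
     (\<forall>v. Ck_on k (\<lambda>x. frechet_derivative f (at x) v) S)"

definition smooth_on :: "('e::euclidean_space \<Rightarrow> 'f::real_normed_vector) \<Rightarrow> 'e set \<Rightarrow> bool" where
  "smooth_on f S \<longleftrightarrow> (\<forall>k. Ck_on k f S)"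


section \<open>Curvature of a metric on an open subset of a Euclidean space\<close>

text \<open>Here \<open>G x u v\<close> is the metric at \<open>x\<close> applied to \<open>u\<close> and \<open>v\<close>. The inner product of the
  coordinate space plays no role.\<close>

type_synonym 'e local_metric = "'e \<Rightarrow> 'e \<Rightarrow> 'e \<Rightarrow> real"

text \<open>\<open>christoffel G x u v\<close> is the covariant derivative at \<open>x\<close>, in direction \<open>u\<close>, of the constant
  vector field \<open>v\<close> with respect to the Levi-Civita connection; it is given by the Koszul formula
  for the (commuting) constant fields \<open>u\<close>, \<open>v\<close>, \<open>z\<close>.\<close>

definition christoffel :: "'e::euclidean_space local_metric \<Rightarrow> 'e \<Rightarrow> 'e \<Rightarrow> 'e \<Rightarrow> 'e" where
  "christoffel G x u v =
     (THE w. \<forall>z. 2 * G x w z =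
          frechet_derivative (\<lambda>y. G y v z) (at x) u
        + frechet_derivative (\<lambda>y. G y u z) (at x) v
        - frechet_derivative (\<lambda>y. G y u v) (at x) z)"

text \<open>\<open>R(u,v)w = \<nabla>\<^sub>u \<nabla>\<^sub>v w - \<nabla>\<^sub>v \<nabla>\<^sub>u w\<close> for constant fields \<open>u\<close>, \<open>v\<close>, \<open>w\<close>.\<close>

definition riemann :: "'e::euclidean_space local_metric \<Rightarrow> 'e \<Rightarrow> 'e \<Rightarrow> 'e \<Rightarrow> 'e \<Rightarrow> 'e" where
  "riemann G x u v w =
       frechet_derivative (\<lambda>y. christoffel G y v w) (at x) u
     + christoffel G x u (christoffel G x v w)
     - frechet_derivative (\<lambda>y. christoffel G y u w) (at x) v
     - christoffel G x v (christoffel G x u w)"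

definition two_plane :: "'e::euclidean_space set \<Rightarrow> bool" where
  "two_plane \<sigma> \<longleftrightarrow> subspace \<sigma> \<and> dim \<sigma> = 2"

definition sec_curvature :: "'e::euclidean_space local_metric \<Rightarrow> 'e \<Rightarrow> 'e set \<Rightarrow> real" where
  "sec_curvature G x \<sigma> =
     (THE k. \<forall>u v. span {u, v} = \<sigma> \<longrightarrow>
        G x (riemann G x u v v) u = k * (G x u u * G x v v - (G x u v)\<^sup>2))"

text \<open>The angle in \<open>[0, \<pi>/2]\<close> between a plane and a line, i.e. the smallest angle between their
  nonzero vectors, which is the angle between the line and its orthogonal projection to the
  plane (\<open>\<pi>/2\<close> if they are orthogonal).\<close>

definition plane_line_angle :: "'e::euclidean_space local_metric \<Rightarrow> 'e \<Rightarrow> 'e set \<Rightarrow> 'e set \<Rightarrow> real" where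
  "plane_line_angle G x \<sigma> L =
     Inf {arccos (G x u w / (sqrt (G x u u) * sqrt (G x w w))) | u w.
            u \<in> \<sigma> \<and> u \<noteq> 0 \<and> w \<in> L \<and> w \<noteq> 0}"


section \<open>Riemannian manifolds\<close>

record ('a, 'e) chart =
  cdom :: "'a set"
  cmap :: "'a \<Rightarrow> 'e"

text \<open>A metric is given by its coordinate expressions: \<open>metric M c\<close> is a metric on the image of
  the chart \<open>c\<close>. Thus the tangent space at \<open>p\<close> is identified with the coordinate space \<open>'e\<close> by
  means of any chart \<open>c\<close> around \<open>p\<close>, and the identifications by \<open>c\<close> and \<open>d\<close> differ by the
  derivative of the transition map. The dimension is \<open>DIM('e)\<close>. The smooth structure is the one
  generated by \<open>atlas M\<close>, which need not be maximal.\<close>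

record ('a, 'e) riem =
  atlas :: "('a, 'e) chart set"
  metric :: "('a, 'e) chart \<Rightarrow> 'e \<Rightarrow> 'e \<Rightarrow> 'e \<Rightarrow> real"

definition points :: "('a, 'e) riem \<Rightarrow> 'a set" where
  "points M = (\<Union>c\<in>atlas M. cdom c)"

definition charts_at :: "('a, 'e) riem \<Rightarrow> 'a \<Rightarrow> ('a, 'e) chart set" where
  "charts_at M p = {c \<in> atlas M. p \<in> cdom c}"

definition coord_rep :: "('a, 'e) chart \<Rightarrow> ('b, 'f) chart \<Rightarrow> ('a \<Rightarrow> 'b) \<Rightarrow> 'e \<Rightarrow> 'f" where
  "coord_rep c d F = cmap d \<circ> F \<circ> inv_into (cdom c) (cmap c)"

abbreviation transition :: "('a, 'e) chart \<Rightarrow> ('a, 'f) chart \<Rightarrow> 'e \<Rightarrow> 'f" where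
  "transition c d \<equiv> coord_rep c d (\<lambda>p. p)"

definition is_chart :: "('a::topological_space, 'e::euclidean_space) chart \<Rightarrow> bool" where
  "is_chart c \<longleftrightarrow> open (cdom c) \<and> open (cmap c ` cdom c) \<and>
     homeomorphism (cdom c) (cmap c ` cdom c) (cmap c) (inv_into (cdom c) (cmap c))"

definition compatible ::
    "('a::topological_space, 'e::euclidean_space) chart \<Rightarrow> ('a, 'e) chart \<Rightarrow> bool" where
  "compatible c d \<longleftrightarrow>
     smooth_on (transition c d) (cmap c ` (cdom c \<inter> cdom d)) \<and>
     smooth_on (transition d c) (cmap d ` (cdom c \<inter> cdom d))"

definition riemannian_manifold ::
    "('a::{t2_space, second_countable_topology}, 'e::euclidean_space) riem \<Rightarrow> bool" where
  "riemannian_manifold M \<longleftrightarrow>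
     (\<forall>c\<in>atlas M. is_chart c) \<and>
     (\<forall>c\<in>atlas M. \<forall>d\<in>atlas M. compatible c d) \<and>
     (\<forall>c\<in>atlas M.
        (\<forall>u v. smooth_on (\<lambda>x. metric M c x u v) (cmap c ` cdom c)) \<and>
        (\<forall>x \<in> cmap c ` cdom c.
           bilinear (metric M c x) \<and>
           (\<forall>u v. metric M c x u v = metric M c x v u) \<and>
           (\<forall>u. u \<noteq> 0 \<longrightarrow> metric M c x u u > 0))) \<and>
     (\<forall>p. \<forall>c\<in>charts_at M p. \<forall>d\<in>charts_at M p. \<forall>u v.
        metric M d (cmap d p)
          (frechet_derivative (transition c d) (at (cmap c p)) u)
          (frechet_derivative (transition c d) (at (cmap c p)) v)
        = metric M c (cmap c p) u v)"

definition smooth_map ::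
    "('a::topological_space, 'e::euclidean_space) riem \<Rightarrow>
     ('b::topological_space, 'f::euclidean_space) riem \<Rightarrow> ('a \<Rightarrow> 'b) \<Rightarrow> bool" where
  "smooth_map M N F \<longleftrightarrow>
     continuous_on (points M) F \<and> F ` points M \<subseteq> points N \<and>
     (\<forall>c\<in>atlas M. \<forall>d\<in>atlas N.
        smooth_on (coord_rep c d F) (cmap c ` (cdom c \<inter> F -` cdom d)))"

text \<open>Injectivity of the differentials follows from the positivity of the metric of \<open>M\<close>.\<close>

definition isometric_immersion ::
    "('a::topological_space, 'e::euclidean_space) riem \<Rightarrow>
     ('b::topological_space, 'f::euclidean_space) riem \<Rightarrow> ('a \<Rightarrow> 'b) \<Rightarrow> bool" where
  "isometric_immersion M N F \<longleftrightarrow>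
     smooth_map M N F \<and>
     (\<forall>p\<in>points M. \<forall>c\<in>charts_at M p. \<forall>d\<in>charts_at N (F p). \<forall>u v.
        metric N d (cmap d (F p))
          (frechet_derivative (coord_rep c d F) (at (cmap c p)) u)
          (frechet_derivative (coord_rep c d F) (at (cmap c p)) v)
        = metric M c (cmap c p) u v)"

definition isometry_group ::
    "('a::topological_space, 'e::euclidean_space) riem \<Rightarrow> ('a \<Rightarrow> 'a) monoid" where
  "isometry_group M = (BijGroup (points M))
     \<lparr>carrier := {\<phi> \<in> Bij (points M).
        isometric_immersion M M \<phi> \<and> isometric_immersion M M (inv_into (points M) \<phi>)}\<rparr>"

text \<open>Local conformal flatness: around each point there is a chart \<open>e\<close> of the smooth structure
  in which the metric is a positive multiple of the Euclidean one.\<close>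

definition conformally_flat ::
    "('a::topological_space, 'e::euclidean_space) riem \<Rightarrow> bool" where
  "conformally_flat M \<longleftrightarrow>
     (\<forall>p\<in>points M. \<exists>e l.
        is_chart e \<and> p \<in> cdom e \<and> cdom e \<subseteq> points M \<and> (\<forall>c\<in>atlas M. compatible c e) \<and>
        smooth_on l (cmap e ` cdom e) \<and> (\<forall>y \<in> cmap e ` cdom e. l y > 0) \<and>
        (\<forall>q\<in>cdom e. \<forall>c\<in>charts_at M q. \<forall>u v.
           metric M c (cmap c q) u v =
             l (cmap e q) *
               (frechet_derivative (transition c e) (at (cmap c q)) u
                \<bullet> frechet_derivative (transition c e) (at (cmap c q)) v)))"


section \<open>1-QC metrics\<close>

text \<open>A line field on an open set \<open>U\<close> assigns to each chart \<open>c\<close> and each point \<open>x\<close> in coordinates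
  the line \<open>\<xi> c x\<close>, compatibly with coordinate changes; smoothness means that it is
  locally spanned by a smooth vector field.\<close>

definition line_field_on ::
    "('a::topological_space, 'e::euclidean_space) riem \<Rightarrow> 'a set \<Rightarrow>
     (('a, 'e) chart \<Rightarrow> 'e \<Rightarrow> 'e set) \<Rightarrow> bool" where
  "line_field_on M U \<xi> \<longleftrightarrow>
     (\<forall>p\<in>U. \<forall>c\<in>charts_at M p. \<exists>N X.
        open N \<and> cmap c p \<in> N \<and> N \<subseteq> cmap c ` (cdom c \<inter> U) \<and> smooth_on X N \<and>
        (\<forall>x\<in>N. X x \<noteq> 0 \<and> \<xi> c x = span {X x})) \<and>
     (\<forall>p\<in>U. \<forall>c\<in>charts_at M p. \<forall>d\<in>charts_at M p.
        \<xi> d (cmap d p) = frechet_derivative (transition c d) (at (cmap c p)) ` \<xi> c (cmap c p))"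

definition globally_1QC_on ::
    "('a::topological_space, 'e::euclidean_space) riem \<Rightarrow> 'a set \<Rightarrow> bool" where
  "globally_1QC_on M U \<longleftrightarrow>
     (\<exists>\<xi> \<theta>. line_field_on M U \<xi> \<and>
        (\<forall>p\<in>U. 0 < \<theta> p \<and> \<theta> p < pi / 2 \<and>
           (\<forall>c\<in>charts_at M p. \<forall>\<sigma>1 \<sigma>2.
              two_plane \<sigma>1 \<and> two_plane \<sigma>2 \<and>
              plane_line_angle (metric M c) (cmap c p) \<sigma>1 (\<xi> c (cmap c p)) = \<theta> p \<and>
              plane_line_angle (metric M c) (cmap c p) \<sigma>2 (\<xi> c (cmap c p)) = \<theta> p \<longrightarrow>
              sec_curvature (metric M c) (cmap c p) \<sigma>1 =
              sec_curvature (metric M c) (cmap c p) \<sigma>2)))"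

definition locally_1QC_on ::
    "('a::topological_space, 'e::euclidean_space) riem \<Rightarrow> 'a set \<Rightarrow> bool" where
  "locally_1QC_on M U \<longleftrightarrow> (\<forall>p\<in>U. \<exists>V. open V \<and> p \<in> V \<and> V \<subseteq> U \<and> globally_1QC_on M V)"

definition isotropic_point ::
    "('a::topological_space, 'e::euclidean_space) riem \<Rightarrow> 'a \<Rightarrow> bool" where
  "isotropic_point M p \<longleftrightarrow>
     (\<forall>c\<in>charts_at M p. \<forall>\<sigma>1 \<sigma>2. two_plane \<sigma>1 \<and> two_plane \<sigma>2 \<longrightarrow>
        sec_curvature (metric M c) (cmap c p) \<sigma>1 = sec_curvature (metric M c) (cmap c p) \<sigma>2)"

definition one_QC ::
    "('a::topological_space, 'e::euclidean_space) riem \<Rightarrow> bool" where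
  "one_QC M \<longleftrightarrow>
     (\<forall>p\<in>points M. \<not> isotropic_point M p \<longrightarrow>
        (\<exists>U. open U \<and> p \<in> U \<and> U \<subseteq> points M \<and> locally_1QC_on M U))"


section \<open>Hyperbolic and Euclidean space\<close>

text \<open>The ball model in Riemann's normal form: on the ball \<open>\<kappa> |x|\<^sup>2 < 4\<close> the metric
  \<open>|dx|\<^sup>2 / (1 - \<kappa> |x|\<^sup>2 / 4)\<^sup>2\<close> is complete of constant curvature \<open>-\<kappa>\<close> if \<open>\<kappa> > 0\<close>; for
  \<open>\<kappa> = 0\<close> it is literally the Euclidean metric on the whole space.\<close>

definition hyperbolic_space :: "real \<Rightarrow> ('h::euclidean_space, 'h) riem" where
  "hyperbolic_space \<kappa> =
     \<lparr>atlas = {\<lparr>cdom = {x. \<kappa> * (norm x)\<^sup>2 < 4}, cmap = (\<lambda>x. x)\<rparr>},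
      metric = (\<lambda>_ x u v. (u \<bullet> v) / (1 - \<kappa> * (norm x)\<^sup>2 / 4)\<^sup>2)\<rparr>"


section \<open>Universal covering and deck action of the fundamental group\<close>

definition riemannian_universal_covering ::
    "('b::{t2_space, second_countable_topology}, 'e::euclidean_space) riem \<Rightarrow> ('b \<Rightarrow> 'a) \<Rightarrow>
     ('a::{t2_space, second_countable_topology}, 'e) riem \<Rightarrow> bool" where
  "riemannian_universal_covering M' \<pi> M \<longleftrightarrow>
     riemannian_manifold M' \<and> simply_connected (points M') \<and>
     covering_space (points M') \<pi> (points M) \<and> isometric_immersion M' M \<pi>"

definition fundamental_group ::
    "'a::topological_space set \<Rightarrow> 'a \<Rightarrow> (real \<Rightarrow> 'a) set monoid" where
  "fundamental_group S x0 =
     \<lparr>carrier = {{q. homotopic_paths S p q} | p.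
        path p \<and> path_image p \<subseteq> S \<and> pathstart p = x0 \<and> pathfinish p = x0},
      mult = (\<lambda>\<Gamma> \<Delta>. {q. \<exists>a\<in>\<Gamma>. \<exists>b\<in>\<Delta>. homotopic_paths S (a +++ b) q}),
      one = {q. homotopic_paths S (\<lambda>_. x0) q}\<rparr>"

definition deck_transformation ::
    "'b::topological_space set \<Rightarrow> ('b \<Rightarrow> 'a) \<Rightarrow> ('b \<Rightarrow> 'b) \<Rightarrow> bool" where
  "deck_transformation S \<pi> \<phi> \<longleftrightarrow>
     \<phi> \<in> extensional S \<and> homeomorphism S S \<phi> (inv_into S \<phi>) \<and> (\<forall>x\<in>S. \<pi> (\<phi> x) = \<pi> x)"

text \<open>The deck transformation given by a class \<open>\<Gamma>\<close> of loops at \<open>\<pi> y0\<close>: it maps \<open>y0\<close> to the end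
  point of the lifts to \<open>S\<close>, starting at \<open>y0\<close>, of the loops in \<open>\<Gamma>\<close>. With concatenation
  \<open>a +++ b\<close> (first \<open>a\<close>) this is a left action of the fundamental group.\<close>

definition deck_action ::
    "'b::topological_space set \<Rightarrow> ('b \<Rightarrow> 'a::topological_space) \<Rightarrow> 'b \<Rightarrow>
     (real \<Rightarrow> 'a) set \<Rightarrow> 'b \<Rightarrow> 'b" where
  "deck_action S \<pi> y0 \<Gamma> =
     (THE \<phi>. deck_transformation S \<pi> \<phi> \<and>
        (\<forall>\<gamma>\<in>\<Gamma>. \<forall>\<gamma>'. path \<gamma>' \<and> path_image \<gamma>' \<subseteq> S \<and> pathstart \<gamma>' = y0 \<and>
             (\<forall>t\<in>{0..1}. \<pi> (\<gamma>' t) = \<gamma> t) \<longrightarrow> \<phi> y0 = pathfinish \<gamma>'))"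

end

theory Submission
  imports Defs
begin

text \<open>The claim is local: near a point, \<open>f\<close> composed with a local section of the covering is an
  isometric immersion of an open subset of \<open>M\<close> into hyperbolic space. By the Gauss equation the
  curvature is \<open>R = - \<kappa> g \<wedge> g + h \<wedge> h\<close> with the second fundamental form \<open>h\<close>, while conformal
  flatness gives \<open>K(u, v) + K(w, z) = K(u, w) + K(v, z)\<close> for orthonormal \<open>u, v, w, z\<close>. As
  \<open>n \<ge> 4\<close>, this forces \<open>h = l g + r Y \<otimes> Y\<close> (Cartan), so that the curvature of a plane depends only
  on its angle with \<open>Y\<close>. Where \<open>r \<noteq> 0\<close>, in particular near a non-isotropic point, the line of \<open>Y\<close>
  is unique and smooth.

  Both curvature facts come from one Gauss equation, for maps into a flat pseudo-Euclidean space: a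
  metric conformal to \<open>|d\<Phi>|\<^sup>2\<close> is induced by a lift of \<open>\<Phi>\<close> to a light cone.\<close>

section \<open>Calculus of \<open>C\<^sup>k\<close> maps\<close>

text \<open>A unit normal is determined only up to sign at each point. The second fundamental form
  is therefore kept vector-valued, and a smooth scalar form is recovered near a non-isotropic point
  by pairing with one nonzero value of it. This multiplies \<open>l\<close> and \<open>r\<close> by
  a common factor and leaves the line of \<open>Y\<close> alone. The ball model is itself conformal
  to the Euclidean metric, so a hypersurface of it and a conformally flat chart are two instances of
  the same light cone lift, in codimension one and zero. The curvature identity of conformal
  flatness then needs no formula for the curvature under a conformal change. The indefinite ambient
  form does no harm, as only the induced metric must be positive. \<open>riemann\<close> and
  \<open>sec_curvature\<close> are coordinate expressions, while 1-QC is demanded in every chart.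
  What is transported between charts is the second fundamental form: second derivatives of a
  transition map contribute only tangential terms to it. The curvature is then computed anew in each
  chart.\<close>

abbreviation dird :: "'e::euclidean_space \<Rightarrow> ('e \<Rightarrow> 'f::real_normed_vector) \<Rightarrow> 'e \<Rightarrow> 'f" where
  "dird v f \<equiv> (\<lambda>x. frechet_derivative f (at x) v)"

lemma dird_eq: "(f has_derivative f') (at x) \<Longrightarrow> frechet_derivative f (at x) v = f' v"
  using frechet_derivative_at by metis

lemma Ck_on_subset: "Ck_on k f S \<Longrightarrow> T \<subseteq> S \<Longrightarrow> Ck_on k f T"
  by (induction k arbitrary: f) (auto intro: continuous_on_subset)

text \<open>Openness makes the derivative at a point of \<open>S\<close> insensitive to values
  outside \<open>S\<close>. This matters because coordinate representatives go through
  \<open>inv_into\<close> and are arbitrary off the chart image.\<close>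

lemma Ck_on_cong:
  assumes "open S" "\<And>x. x \<in> S \<Longrightarrow> f x = g x" "Ck_on k f S"
  shows "Ck_on k g S"
  using assms(2,3)
proof (induction k arbitrary: f g)
  case 0
  then show ?case using continuous_on_cong by force
next
  case (Suc k)
  have d: "g differentiable (at x)" "frechet_derivative f (at x) = frechet_derivative g (at x)"
    if "x \<in> S" for x
  proof -
    have "f differentiable (at x)" using Suc.prems that by simp
    then obtain f' where f': "(f has_derivative f') (at x)" by (auto simp: differentiable_def)
    then have "(g has_derivative f') (at x)"
      using has_derivative_transform_within_open[OF f' assms(1) that] Suc.prems(1) by auto
    then show "g differentiable (at x)" "frechet_derivative f (at x) = frechet_derivative g (at x)"
      using frechet_derivative_at[OF f'] frechet_derivative_at[of g f' x] f'
      by (auto simp: differentiable_def)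
  qed
  show ?case
    using Suc.prems d by (auto intro!: Suc.IH[of "dird v f" "dird v g" for v])
qed

lemma Ck_on_SucI:
  assumes "open S" "\<And>x. x \<in> S \<Longrightarrow> (f has_derivative f' x) (at x)"
    and "\<And>v. Ck_on k (\<lambda>x. f' x v) S"
  shows "Ck_on (Suc k) f S"
proof -
  have "Ck_on k (dird v f) S" for v
    by (rule Ck_on_cong[OF assms(1) _ assms(3)[of v]]) (simp add: dird_eq[OF assms(2)])
  then show ?thesis using assms(2) by (auto simp: differentiable_def)
qed

lemma Ck_on_SucD:
  assumes "Ck_on (Suc k) f S"
  shows "\<And>x. x \<in> S \<Longrightarrow> (f has_derivative frechet_derivative f (at x)) (at x)"
    and "\<And>v. Ck_on k (dird v f) S"
  using assms by (auto simp: frechet_derivative_works)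

lemma Ck_on_Suc_imp: "Ck_on (Suc k) f S \<Longrightarrow> Ck_on k f S"
proof (induction k arbitrary: f)
  case 0
  then have "f differentiable_on S"
    unfolding differentiable_on_def by (auto intro: differentiable_at_withinI)
  then show ?case by (simp add: differentiable_imp_continuous_on)
next
  case (Suc k)
  then show ?case by (metis Ck_on.simps(2))
qed

lemma Ck_on_le: "Ck_on m f S \<Longrightarrow> k \<le> m \<Longrightarrow> Ck_on k f S"
  by (induction m) (auto simp: le_Suc_eq simp del: Ck_on.simps dest: Ck_on_Suc_imp)

lemma Ck_on_continuous: "Ck_on k f S \<Longrightarrow> continuous_on S f"
  using Ck_on_le[of k f S 0] by simp

lemma Ck_on_const: "Ck_on k (\<lambda>x. c) S"
proof (induction k arbitrary: c)
  case (Suc k)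
  then show ?case by simp
qed simp

lemma Ck_on_bounded_linear:
  assumes "bounded_linear L" "open S" "Ck_on k f S"
  shows "Ck_on k (\<lambda>x. L (f x)) S"
  using assms(3)
proof (induction k arbitrary: f)
  case 0
  then show ?case
    using bounded_linear.continuous_on[OF assms(1)] by simp
next
  case (Suc k)
  note d = Ck_on_SucD[OF Suc.prems]
  show ?case
    by (rule Ck_on_SucI[OF assms(2) bounded_linear.has_derivative[OF assms(1) d(1)] Suc.IH[OF d(2)]])
qed

lemma Ck_on_add:
  assumes "open S" "Ck_on k f S" "Ck_on k g S"
  shows "Ck_on k (\<lambda>x. f x + g x) S"
  using assms(2,3)
proof (induction k arbitrary: f g)
  case 0
  then show ?case by (simp add: continuous_on_add)
next
  case (Suc k)
  note d = Ck_on_SucD[OF Suc.prems(1)] and e = Ck_on_SucD[OF Suc.prems(2)]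
  show ?case
    by (rule Ck_on_SucI[OF assms(1) has_derivative_add[OF d(1) e(1)] Suc.IH[OF d(2) e(2)]])
qed

lemma Ck_on_bilinear:
  assumes "bounded_bilinear B" "open S" "Ck_on k f S" "Ck_on k g S"
  shows "Ck_on k (\<lambda>x. B (f x) (g x)) S"
  using assms(3,4)
proof (induction k arbitrary: f g)
  case 0
  then show ?case using bounded_bilinear.continuous_on[OF assms(1)] by simp
next
  case (Suc k)
  note d = Ck_on_SucD[OF Suc.prems(1)] and e = Ck_on_SucD[OF Suc.prems(2)]
  show ?case
    by (rule Ck_on_SucI[OF assms(2) bounded_bilinear.FDERIV[OF assms(1) d(1) e(1)]
          Ck_on_add[OF assms(2) Suc.IH[OF Ck_on_Suc_imp[OF Suc.prems(1)] e(2)]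
            Suc.IH[OF d(2) Ck_on_Suc_imp[OF Suc.prems(2)]]]])
qed

lemmas Ck_on_scaleR = Ck_on_bilinear[OF bounded_bilinear_scaleR]
lemmas Ck_on_mult = Ck_on_bilinear[OF bounded_bilinear_mult]
lemmas Ck_on_inner = Ck_on_bilinear[OF bounded_bilinear_inner]
lemmas Ck_on_minus = Ck_on_bounded_linear[OF bounded_linear_minus[OF bounded_linear_ident]]

lemma Ck_on_diff:
  assumes "open S" "Ck_on k f S" "Ck_on k g S"
  shows "Ck_on k (\<lambda>x. f x - g x) S"
  using Ck_on_add[OF assms(1,2) Ck_on_minus[OF assms(1,3)]] by simp

lemma Ck_on_sum:
  assumes "open S" "\<And>i. i \<in> I \<Longrightarrow> Ck_on k (f i) S"
  shows "Ck_on k (\<lambda>x. \<Sum>i\<in>I. f i x) S"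
  using assms(2)
  by (induction I rule: infinite_finite_induct) (simp_all add: Ck_on_const Ck_on_add[OF assms(1)])

lemma Ck_on_ident: "open S \<Longrightarrow> Ck_on k (\<lambda>x. x) S"
  by (cases k) (auto simp: Ck_on_const)

lemma Ck_on_compose:
  fixes f :: "'m::euclidean_space \<Rightarrow> 'f::real_normed_vector" and g :: "'e::euclidean_space \<Rightarrow> 'm"
  assumes "open S" "open T" "g ` S \<subseteq> T" "Ck_on k f T" "Ck_on k g S"
  shows "Ck_on k (\<lambda>x. f (g x)) S"
  using assms(4,5)
proof (induction k arbitrary: f)
  case 0
  then show ?case using assms(3) continuous_on_compose2 by auto
next
  case (Suc k)
  note d = Ck_on_SucD[OF Suc.prems(1)] and e = Ck_on_SucD[OF Suc.prems(2)]
  have D: "((\<lambda>x. f (g x)) has_derivative (\<lambda>v. frechet_derivative f (at (g x)) (frechet_derivative g (at x) v))) (at x)"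
    if "x \<in> S" for x
    using has_derivative_compose[OF e(1)[OF that] d(1)[of "g x"]] assms(3) that by auto
  \<comment> \<open>In the chain rule both the base point and the direction vary with
    \<open>x\<close>. Expanding the direction in the basis leaves a finite sum of products, to which
    the induction hypothesis for \<open>dird b f\<close> applies.\<close>
  have E: "frechet_derivative f (at (g x)) w = (\<Sum>b\<in>Basis. (w \<bullet> b) *\<^sub>R dird b f (g x))"
    if "x \<in> S" for x w
  proof -
    have "linear (frechet_derivative f (at (g x)))"
      using d(1) assms(3) that has_derivative_linear by blast
    then have "frechet_derivative f (at (g x)) (\<Sum>b\<in>Basis. (w \<bullet> b) *\<^sub>R b) = (\<Sum>b\<in>Basis. (w \<bullet> b) *\<^sub>R dird b f (g x))"
      by (simp add: linear_sum linear_scale)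
    then show ?thesis by (simp add: euclidean_representation)
  qed
  show ?case
  proof (rule Ck_on_SucI[OF assms(1) D])
    fix v
    have "Ck_on k (\<lambda>x. \<Sum>b\<in>Basis. (frechet_derivative g (at x) v \<bullet> b) *\<^sub>R dird b f (g x)) S"
      by (intro Ck_on_sum Ck_on_scaleR Ck_on_inner Ck_on_const Suc.IH assms(1) d(2) e(2)
          Ck_on_Suc_imp[OF Suc.prems(2)])
    then show "Ck_on k (\<lambda>x. frechet_derivative f (at (g x)) (frechet_derivative g (at x) v)) S"
      by (rule Ck_on_cong[OF assms(1), rotated]) (simp add: E)
  qed
qed

lemma Ck_on_inverse:
  fixes f :: "'e::euclidean_space \<Rightarrow> real"
  assumes "open S" "\<And>x. x \<in> S \<Longrightarrow> f x \<noteq> 0" "Ck_on k f S"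
  shows "Ck_on k (\<lambda>x. inverse (f x)) S"
  using assms(3)
proof (induction k)
  case 0
  then show ?case using assms(2) by (simp add: continuous_on_inverse)
next
  case (Suc k)
  note d = Ck_on_SucD[OF Suc.prems]
  note IH = Suc.IH[OF Ck_on_Suc_imp[OF Suc.prems]]
  have D: "((\<lambda>x. inverse (f x)) has_derivative
      (\<lambda>v. - (inverse (f x) * frechet_derivative f (at x) v * inverse (f x)))) (at x)"
    if "x \<in> S" for x
    using Deriv.has_derivative_inverse[OF assms(2)[OF that] d(1)[OF that]] .
  show ?case
    by (rule Ck_on_SucI[OF assms(1) D]) (assumption, intro Ck_on_minus Ck_on_mult assms(1) IH d(2))
qed

lemma Ck_on_divide:
  fixes f :: "'e::euclidean_space \<Rightarrow> real"
  assumes "open S" "\<And>x. x \<in> S \<Longrightarrow> g x \<noteq> 0" "Ck_on k f S" "Ck_on k g S"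
  shows "Ck_on k (\<lambda>x. f x / g x) S"
  using Ck_on_mult[OF assms(1,3) Ck_on_inverse[OF assms(1,2,4)]] by (simp add: divide_inverse)

lemma Ck_on_sqrt:
  fixes f :: "'e::euclidean_space \<Rightarrow> real"
  assumes "open S" "\<And>x. x \<in> S \<Longrightarrow> f x > 0" "Ck_on k f S"
  shows "Ck_on k (\<lambda>x. sqrt (f x)) S"
  using assms(3)
proof (induction k)
  case 0
  then show ?case by (simp add: continuous_on_real_sqrt)
next
  case (Suc k)
  note d = Ck_on_SucD[OF Suc.prems]
  note IH = Suc.IH[OF Ck_on_Suc_imp[OF Suc.prems]]
  have D: "((\<lambda>x. sqrt (f x)) has_derivative
      (\<lambda>v. (inverse (sqrt (f x)) / 2) * frechet_derivative f (at x) v)) (at x)"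
    if "x \<in> S" for x
    using DERIV_real_sqrt[OF assms(2)[OF that]] d(1)[OF that]
      has_derivative_compose[of f _ x UNIV sqrt "(*) (inverse (sqrt (f x)) / 2)"]
    by (simp add: has_field_derivative_def)
  show ?case
  proof (rule Ck_on_SucI[OF assms(1) D])
    fix v
    have nz: "sqrt (f x) \<noteq> 0" if "x \<in> S" for x
      using assms(2)[OF that] by simp
    have inv: "Ck_on k (\<lambda>x. inverse (sqrt (f x))) S"
      by (rule Ck_on_inverse[OF assms(1) nz IH])
    have "Ck_on k (\<lambda>x. inverse (sqrt (f x)) * (1/2) * dird v f x) S"
      by (rule Ck_on_mult[OF assms(1) Ck_on_mult[OF assms(1) inv Ck_on_const] d(2)])
    then show "Ck_on k (\<lambda>x. inverse (sqrt (f x)) / 2 * frechet_derivative f (at x) v) S"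
      by simp
  qed
qed

section \<open>Gluing and inverse maps\<close>

lemma Ck_on_local:
  assumes "\<And>x. x \<in> S \<Longrightarrow> \<exists>N. open N \<and> x \<in> N \<and> Ck_on k f N"
  shows "Ck_on k f S"
  using assms
proof (induction k arbitrary: f)
  case 0
  have "continuous (at x within S) f" if "x \<in> S" for x
  proof -
    have "\<exists>N. open N \<and> x \<in> N \<and> continuous_on N f"
      using 0(1)[of x] that by simp
    then obtain N where "open N" "x \<in> N" "continuous_on N f"
      by blast
    then have "continuous (at x) f" by (simp add: continuous_on_eq_continuous_at)
    then show ?thesis using continuous_at_imp_continuous_at_within by blast
  qed
  then show ?case by (simp add: continuous_on_eq_continuous_within)
next
  case (Suc k)
  have "f differentiable (at x)" if "x \<in> S" for x
    using Suc.prems[OF that] by auto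
  moreover have "Ck_on k (dird v f) S" for v
    by (rule Suc.IH) (metis Ck_on.simps(2) Suc.prems)
  ultimately show ?case by simp
qed

lemma bounded_bilinear_of_bilinear:
  fixes B :: "'w::euclidean_space \<Rightarrow> 'v::euclidean_space \<Rightarrow> 'f::real_normed_vector"
  assumes "bilinear B"
  shows "bounded_bilinear B"
  using assms bilinear_conv_bounded_bilinear by blast

text \<open>Bootstrap: the derivative of \<open>Q\<close> at \<open>y\<close> in direction
  \<open>v\<close> is \<open>V v (Q y)\<close>, so each degree of smoothness of \<open>Q\<close>
  yields the next one. The start is the continuity of \<open>Q\<close>, which together with the left
  inverse \<open>V\<close> gives differentiability.\<close>

lemma Ck_on_inverse_function:
  fixes P :: "'e::euclidean_space \<Rightarrow> 'm::euclidean_space"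
  assumes "open S" "open T" "smooth_on P S" "continuous_on T Q" "Q ` T \<subseteq> S"
    and PQ: "\<And>y. y \<in> T \<Longrightarrow> P (Q y) = y"
    and V: "\<And>v. smooth_on (V v) S" "\<And>x. x \<in> S \<Longrightarrow> linear (\<lambda>v. V v x)"
    and inv: "\<And>x u. x \<in> S \<Longrightarrow> V (frechet_derivative P (at x) u) x = u"
  shows "smooth_on Q T"
proof -
  have D: "(Q has_derivative (\<lambda>v. V v (Q y))) (at y)" if "y \<in> T" for y
  proof (rule has_derivative_inverse_basic[where T = T, OF _ _ _ _ assms(2) that])
    have "Ck_on (Suc 0) P S" using assms(3) smooth_on_def by blast
    then show "(P has_derivative frechet_derivative P (at (Q y))) (at (Q y))"
      using Ck_on_SucD(1) assms(5) that by blast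
    show "bounded_linear (\<lambda>v. V v (Q y))"
      using V(2) assms(5) that linear_conv_bounded_linear by blast
    show "(\<lambda>v. V v (Q y)) \<circ> frechet_derivative P (at (Q y)) = id"
      using inv assms(5) that by (auto simp: fun_eq_iff)
    show "continuous (at y) Q"
      using assms(2,4) that continuous_on_eq_continuous_at by blast
  qed (rule PQ)
  have "Ck_on k Q T" for k
  proof (induction k)
    case 0
    then show ?case using assms(4) by simp
  next
    case (Suc k)
    show ?case
      by (rule Ck_on_SucI[OF assms(2) D Ck_on_compose[OF assms(2,1,5) _ Suc.IH]])
        (use V(1) smooth_on_def in auto)
  qed
  then show ?thesis by (simp add: smooth_on_def)
qed

subsection \<open>Smooth maps\<close>

lemma smooth_on_dird: "smooth_on f S \<Longrightarrow> smooth_on (dird v f) S"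
  using Ck_on_SucD(2) unfolding smooth_on_def by blast

lemma smooth_on_has_derivative:
  "smooth_on f S \<Longrightarrow> x \<in> S \<Longrightarrow> (f has_derivative frechet_derivative f (at x)) (at x)"
  using Ck_on_SucD(1) unfolding smooth_on_def by blast

lemma smooth_on_linear: "smooth_on f S \<Longrightarrow> x \<in> S \<Longrightarrow> linear (frechet_derivative f (at x))"
  using smooth_on_has_derivative has_derivative_linear by blast

lemma smooth_on_continuous: "smooth_on f S \<Longrightarrow> continuous_on S f"
  using Ck_on_continuous unfolding smooth_on_def by blast

lemma smooth_on_subset: "smooth_on f S \<Longrightarrow> T \<subseteq> S \<Longrightarrow> smooth_on f T"
  using Ck_on_subset unfolding smooth_on_def by blast

lemma smooth_on_cong:
  "smooth_on f S \<Longrightarrow> open S \<Longrightarrow> (\<And>x. x \<in> S \<Longrightarrow> f x = g x) \<Longrightarrow> smooth_on g S"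
  using Ck_on_cong unfolding smooth_on_def by blast

lemma smooth_on_local:
  "(\<And>x. x \<in> S \<Longrightarrow> \<exists>N. open N \<and> x \<in> N \<and> smooth_on f N) \<Longrightarrow> smooth_on f S"
  unfolding smooth_on_def using Ck_on_local by metis

lemma smooth_on_const: "smooth_on (\<lambda>x. c) S"
  by (simp add: smooth_on_def Ck_on_const)

lemma smooth_on_ident: "open S \<Longrightarrow> smooth_on (\<lambda>x. x) S"
  by (simp add: smooth_on_def Ck_on_ident)

lemma smooth_on_compose:
  "open S \<Longrightarrow> open T \<Longrightarrow> g ` S \<subseteq> T \<Longrightarrow> smooth_on f T \<Longrightarrow> smooth_on g S \<Longrightarrow> smooth_on (\<lambda>x. f (g x)) S"
  by (simp add: smooth_on_def Ck_on_compose)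

lemma smooth_on_bounded_linear:
  "bounded_linear L \<Longrightarrow> open S \<Longrightarrow> smooth_on f S \<Longrightarrow> smooth_on (\<lambda>x. L (f x)) S"
  by (simp add: smooth_on_def Ck_on_bounded_linear)

lemma smooth_on_bilinear:
  "bounded_bilinear B \<Longrightarrow> open S \<Longrightarrow> smooth_on f S \<Longrightarrow> smooth_on g S \<Longrightarrow> smooth_on (\<lambda>x. B (f x) (g x)) S"
  by (simp add: smooth_on_def Ck_on_bilinear)

lemma smooth_on_add:
  "open S \<Longrightarrow> smooth_on f S \<Longrightarrow> smooth_on g S \<Longrightarrow> smooth_on (\<lambda>x. f x + g x) S"
  by (simp add: smooth_on_def Ck_on_add)

lemma smooth_on_diff:
  "open S \<Longrightarrow> smooth_on f S \<Longrightarrow> smooth_on g S \<Longrightarrow> smooth_on (\<lambda>x. f x - g x) S"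
  by (simp add: smooth_on_def Ck_on_diff)

lemma smooth_on_sum:
  "open S \<Longrightarrow> (\<And>i. i \<in> I \<Longrightarrow> smooth_on (f i) S) \<Longrightarrow> smooth_on (\<lambda>x. \<Sum>i\<in>I. f i x) S"
  by (simp add: smooth_on_def Ck_on_sum)

lemma smooth_on_divide:
  fixes f :: "'e::euclidean_space \<Rightarrow> real"
  shows "open S \<Longrightarrow> (\<And>x. x \<in> S \<Longrightarrow> g x \<noteq> 0) \<Longrightarrow> smooth_on f S \<Longrightarrow> smooth_on g S \<Longrightarrow>
    smooth_on (\<lambda>x. f x / g x) S"
  by (simp add: smooth_on_def Ck_on_divide)

lemma smooth_on_sqrt:
  fixes f :: "'e::euclidean_space \<Rightarrow> real"
  shows "open S \<Longrightarrow> (\<And>x. x \<in> S \<Longrightarrow> f x > 0) \<Longrightarrow> smooth_on f S \<Longrightarrow> smooth_on (\<lambda>x. sqrt (f x)) S"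
  by (simp add: smooth_on_def Ck_on_sqrt)

lemmas smooth_on_scaleR = smooth_on_bilinear[OF bounded_bilinear_scaleR]
lemmas smooth_on_mult = smooth_on_bilinear[OF bounded_bilinear_mult]
lemmas smooth_on_inner = smooth_on_bilinear[OF bounded_bilinear_inner]

lemma linear_eq_sum_Basis:
  fixes L :: "'e::euclidean_space \<Rightarrow> 'f::real_vector"
  assumes "linear L"
  shows "L w = (\<Sum>b\<in>Basis. (w \<bullet> b) *\<^sub>R L b)"
proof -
  have "L (\<Sum>b\<in>Basis. (w \<bullet> b) *\<^sub>R b) = (\<Sum>b\<in>Basis. (w \<bullet> b) *\<^sub>R L b)"
    by (simp add: linear_sum[OF assms] linear_scale[OF assms])
  then show ?thesis by (simp add: euclidean_representation)
qed

lemma smooth_on_linear_apply: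
  fixes L :: "'d::euclidean_space \<Rightarrow> 'e::euclidean_space \<Rightarrow> 'f::real_normed_vector"
  assumes "open S" "\<And>v. smooth_on (\<lambda>x. L x v) S" "\<And>x. x \<in> S \<Longrightarrow> linear (L x)" "smooth_on X S"
  shows "smooth_on (\<lambda>x. L x (X x)) S"
proof (rule smooth_on_cong[OF _ assms(1)])
  show "smooth_on (\<lambda>x. \<Sum>b\<in>Basis. (X x \<bullet> b) *\<^sub>R L x b) S"
    by (intro smooth_on_sum smooth_on_scaleR smooth_on_inner smooth_on_const assms)
qed (simp add: linear_eq_sum_Basis[OF assms(3), symmetric])

lemma smooth_on_bilinear_apply:
  fixes L :: "'d::euclidean_space \<Rightarrow> 'e::euclidean_space \<Rightarrow> 'e \<Rightarrow> 'f::real_normed_vector"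
  assumes "open S" "\<And>u v. smooth_on (\<lambda>x. L x u v) S" "\<And>x. x \<in> S \<Longrightarrow> bilinear (L x)"
    and "smooth_on X S" "smooth_on Y S"
  shows "smooth_on (\<lambda>x. L x (X x) (Y x)) S"
proof (rule smooth_on_linear_apply[OF assms(1) _ _ assms(5)])
  show "smooth_on (\<lambda>x. L x (X x) v) S" for v
    by (rule smooth_on_linear_apply[OF assms(1,2) _ assms(4)]) (use assms(3) bilinear_def in auto)
  show "linear (L x (X x))" if "x \<in> S" for x
    using assms(3)[OF that] bilinear_def by auto
qed

lemma smooth_on_dird_apply:
  assumes "open S" "open T" "smooth_on f T" "smooth_on g S" "g ` S \<subseteq> T" "smooth_on X S"
  shows "smooth_on (\<lambda>x. frechet_derivative f (at (g x)) (X x)) S"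
  by (rule smooth_on_linear_apply[OF assms(1) smooth_on_compose[OF assms(1,2,5) smooth_on_dird[OF assms(3)] assms(4)] _ assms(6)])
    (use assms(5) in \<open>auto intro!: smooth_on_linear[OF assms(3)]\<close>)

subsection \<open>Symmetry of second derivatives\<close>

text \<open>The mean value theorem is applied along \<open>u\<close> to the increment over the step
  \<open>s *\<^sub>R v\<close>, then along \<open>v\<close> to the resulting difference of
  \<open>dird u f\<close>. The left side is symmetric in \<open>u\<close> and \<open>v\<close>, the
  right side a priori is not.\<close>

lemma second_difference:
  fixes f :: "'e::euclidean_space \<Rightarrow> real"
  assumes "Ck_on 2 f S" "s > 0"
    and S: "\<And>a b. 0 \<le> a \<Longrightarrow> a \<le> s \<Longrightarrow> 0 \<le> b \<Longrightarrow> b \<le> s \<Longrightarrow> x + a *\<^sub>R u + b *\<^sub>R v \<in> S"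
  obtains a b where "0 < a" "a < s" "0 < b" "b < s"
    "f (x + s *\<^sub>R u + s *\<^sub>R v) - f (x + s *\<^sub>R u) - f (x + s *\<^sub>R v) + f x
       = s * s * dird v (dird u f) (x + a *\<^sub>R u + b *\<^sub>R v)"
proof -
  have C: "Ck_on (Suc (Suc 0)) f S" using assms(1) by (simp add: numeral_2_eq_2)
  note d = Ck_on_SucD(1)[OF C] and dd = Ck_on_SucD(1)[OF Ck_on_SucD(2)[OF C]]
  have lin: "x \<in> S \<Longrightarrow> frechet_derivative f (at x) (h *\<^sub>R w) = h * frechet_derivative f (at x) w" for x h w
    using has_derivative_linear[OF d] linear_scale by fastforce
  have lin2: "x \<in> S \<Longrightarrow> frechet_derivative (dird u f) (at x) (h *\<^sub>R w) = h * frechet_derivative (dird u f) (at x) w" for x h w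
    using has_derivative_linear[OF dd] linear_scale by fastforce
  define \<phi> where "\<phi> a = f (x + a *\<^sub>R u + s *\<^sub>R v) - f (x + a *\<^sub>R u)" for a
  have "\<exists>a. 0 < a \<and> a < s \<and> \<phi> s - \<phi> 0 = (s - 0) * (dird u f (x + a *\<^sub>R u + s *\<^sub>R v) - dird u f (x + a *\<^sub>R u))"
  proof (rule MVT2[OF assms(2)])
    fix a :: real assume a: "0 \<le> a" "a \<le> s"
    have *: "x + a *\<^sub>R u + s *\<^sub>R v \<in> S" "x + a *\<^sub>R u \<in> S"
      using S[of a s] S[of a 0] a assms(2) by auto
    have 1: "((\<lambda>a. f (x + a *\<^sub>R u + s *\<^sub>R v)) has_derivative (\<lambda>h. frechet_derivative f (at (x + a *\<^sub>R u + s *\<^sub>R v)) (h *\<^sub>R u))) (at a)"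
      by (rule has_derivative_compose[of "\<lambda>a. x + a *\<^sub>R u + s *\<^sub>R v" "\<lambda>h. h *\<^sub>R u" a UNIV f, OF _ d[OF *(1)]]) (auto intro!: derivative_eq_intros)
    have 2: "((\<lambda>a. f (x + a *\<^sub>R u)) has_derivative (\<lambda>h. frechet_derivative f (at (x + a *\<^sub>R u)) (h *\<^sub>R u))) (at a)"
      by (rule has_derivative_compose[of "\<lambda>a. x + a *\<^sub>R u" "\<lambda>h. h *\<^sub>R u" a UNIV f, OF _ d[OF *(2)]]) (auto intro!: derivative_eq_intros)
    show "(\<phi> has_real_derivative dird u f (x + a *\<^sub>R u + s *\<^sub>R v) - dird u f (x + a *\<^sub>R u)) (at a)"
      using has_derivative_diff[OF 1 2] unfolding has_field_derivative_def \<phi>_def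
      by (rule has_derivative_eq_rhs) (simp add: lin[OF *(1)] lin[OF *(2)] fun_eq_iff right_diff_distrib mult.commute)
  qed
  then obtain a where a: "0 < a" "a < s"
    "\<phi> s - \<phi> 0 = s * (dird u f (x + a *\<^sub>R u + s *\<^sub>R v) - dird u f (x + a *\<^sub>R u))" by auto
  have "\<exists>b. 0 < b \<and> b < s \<and> dird u f (x + a *\<^sub>R u + s *\<^sub>R v) - dird u f (x + a *\<^sub>R u + 0 *\<^sub>R v)
     = (s - 0) * dird v (dird u f) (x + a *\<^sub>R u + b *\<^sub>R v)"
  proof (rule MVT2[OF assms(2)])
    fix b :: real assume b: "0 \<le> b" "b \<le> s"
    have *: "x + a *\<^sub>R u + b *\<^sub>R v \<in> S" using S[of a b] a b by auto
    have 1: "((\<lambda>b. dird u f (x + a *\<^sub>R u + b *\<^sub>R v)) has_derivative (\<lambda>h. frechet_derivative (dird u f) (at (x + a *\<^sub>R u + b *\<^sub>R v)) (h *\<^sub>R v))) (at b)"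
      by (rule has_derivative_compose[of "\<lambda>b. x + a *\<^sub>R u + b *\<^sub>R v" "\<lambda>h. h *\<^sub>R v" b UNIV "dird u f", OF _ dd[OF *]]) (auto intro!: derivative_eq_intros)
    show "((\<lambda>b. dird u f (x + a *\<^sub>R u + b *\<^sub>R v)) has_real_derivative dird v (dird u f) (x + a *\<^sub>R u + b *\<^sub>R v)) (at b)"
      using 1 unfolding has_field_derivative_def
      by (rule has_derivative_eq_rhs) (auto simp: lin2 * fun_eq_iff)
  qed
  then obtain b where b: "0 < b" "b < s" "dird u f (x + a *\<^sub>R u + s *\<^sub>R v) - dird u f (x + a *\<^sub>R u)
     = s * dird v (dird u f) (x + a *\<^sub>R u + b *\<^sub>R v)" by auto
  show ?thesis
    using that[OF a(1,2) b(1,2)] a(3) b(3) by (simp add: \<phi>_def algebra_simps)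
qed

lemma second_derivative_symmetric_real:
  fixes f :: "'e::euclidean_space \<Rightarrow> real"
  assumes "open S" "Ck_on 2 f S" "x \<in> S"
  shows "dird v (dird u f) x = dird u (dird v f) x"
proof (rule ccontr)
  assume ne: "\<not> ?thesis"
  define A where "A = dird v (dird u f)"
  define B where "B = dird u (dird v f)"
  \<comment> \<open>Half the gap: a common value of \<open>A\<close> and \<open>B\<close> at nearby
    points would be closer than \<open>e\<close> to both \<open>A x\<close> and
    \<open>B x\<close>.\<close>
  define e where "e = \<bar>A x - B x\<bar> / 2"
  have e: "e > 0" using ne by (simp add: e_def A_def B_def)
  have C: "Ck_on (Suc (Suc 0)) f S" using assms(2) by (simp add: numeral_2_eq_2)
  have "continuous_on S A" "continuous_on S B" using C by (auto simp: A_def B_def)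
  then have "isCont A x" "isCont B x" using assms continuous_on_eq_continuous_at by auto
  then obtain d1 d2 where d: "d1 > 0" "\<And>y. dist y x < d1 \<Longrightarrow> dist (A y) (A x) < e"
    "d2 > 0" "\<And>y. dist y x < d2 \<Longrightarrow> dist (B y) (B x) < e"
    unfolding continuous_at_eps_delta using e by metis
  obtain d3 where d3: "d3 > 0" "\<And>y. dist y x < d3 \<Longrightarrow> y \<in> S"
    using assms(1,3) open_dist by metis
  define d where "d = min d1 (min d2 d3)"
  have dp: "d > 0" using d d3 by (simp add: d_def)
  \<comment> \<open>Keeps the whole parallelogram spanned by \<open>s *\<^sub>R u\<close> and
    \<open>s *\<^sub>R v\<close> in the ball of radius \<open>d\<close>; the summand 1 covers
    \<open>u = v = 0\<close>.\<close>
  define s where "s = d / (norm u + norm v + 1)"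
  have nz: "norm u + norm v + 1 > 0" by (smt (verit) norm_ge_zero)
  then have s: "s > 0" using dp by (simp add: s_def)
  have near: "dist (x + a *\<^sub>R u + b *\<^sub>R v) x < d" if "0 \<le> a" "a \<le> s" "0 \<le> b" "b \<le> s" for a b
  proof -
    have "dist (x + a *\<^sub>R u + b *\<^sub>R v) x \<le> a * norm u + b * norm v"
      using norm_triangle_ineq[of "a *\<^sub>R u" "b *\<^sub>R v"] that by (simp add: dist_norm add.assoc)
    also have "\<dots> \<le> s * norm u + s * norm v"
      using that by (intro add_mono mult_right_mono) auto
    also have "\<dots> < s * (norm u + norm v + 1)" using s by (simp add: algebra_simps)
    also have "\<dots> = d" using nz by (simp add: s_def)
    finally show ?thesis .
  qed
  have near': "dist (x + b *\<^sub>R v + a *\<^sub>R u) x < d" if "0 \<le> a" "a \<le> s" "0 \<le> b" "b \<le> s" for a b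
    using near[OF that] by (simp add: algebra_simps)
  have S1: "x + a *\<^sub>R u + b *\<^sub>R v \<in> S" if "0 \<le> a" "a \<le> s" "0 \<le> b" "b \<le> s" for a b
    using near[OF that] d3(2) by (simp add: d_def)
  have S2: "x + b *\<^sub>R v + a *\<^sub>R u \<in> S" if "0 \<le> b" "b \<le> s" "0 \<le> a" "a \<le> s" for a b
    using near' that d3(2) by (simp add: d_def)
  obtain a b where ab: "0 < a" "a < s" "0 < b" "b < s"
    "f (x + s *\<^sub>R u + s *\<^sub>R v) - f (x + s *\<^sub>R u) - f (x + s *\<^sub>R v) + f x = s * s * A (x + a *\<^sub>R u + b *\<^sub>R v)"
    unfolding A_def by (rule second_difference[OF assms(2) s S1])
  obtain a' b' where ab': "0 < a'" "a' < s" "0 < b'" "b' < s"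
    "f (x + s *\<^sub>R v + s *\<^sub>R u) - f (x + s *\<^sub>R v) - f (x + s *\<^sub>R u) + f x = s * s * B (x + a' *\<^sub>R v + b' *\<^sub>R u)"
    unfolding B_def by (rule second_difference[OF assms(2) s S2])
  have swap: "x + s *\<^sub>R v + s *\<^sub>R u = x + s *\<^sub>R u + s *\<^sub>R v" by (simp add: algebra_simps)
  have "s * s * A (x + a *\<^sub>R u + b *\<^sub>R v) = s * s * B (x + a' *\<^sub>R v + b' *\<^sub>R u)"
    using ab(5) ab'(5) unfolding swap by linarith
  then have eq: "A (x + a *\<^sub>R u + b *\<^sub>R v) = B (x + a' *\<^sub>R v + b' *\<^sub>R u)" using s by simp
  have "dist (A (x + a *\<^sub>R u + b *\<^sub>R v)) (A x) < e"
    using d(2) near[of a b] ab by (simp add: d_def)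
  moreover have "dist (B (x + a' *\<^sub>R v + b' *\<^sub>R u)) (B x) < e"
    using d(4) near'[of b' a'] ab' by (simp add: d_def)
  ultimately show False using eq unfolding e_def dist_real_def by (auto simp: abs_if split: if_splits)
qed

lemma second_derivative_symmetric:
  fixes F :: "'e::euclidean_space \<Rightarrow> 'w::euclidean_space"
  assumes "open S" "smooth_on F S" "x \<in> S"
  shows "dird v (dird u F) x = dird u (dird v F) x"
proof (rule euclidean_eqI)
  fix b :: 'w assume "b \<in> Basis"
  have in1: "dird w (\<lambda>y. H y \<bullet> b) y = dird w H y \<bullet> b" if "smooth_on H S" "y \<in> S" for w y and H :: "'e \<Rightarrow> 'w"
    using dird_eq[OF has_derivative_inner_left[OF smooth_on_has_derivative[OF that]]] by simp
  have in2: "dird u (dird v (\<lambda>y. F y \<bullet> b)) x = dird u (dird v F) x \<bullet> b" for u v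
  proof -
    have "frechet_derivative (\<lambda>y. dird v F y \<bullet> b) (at x) = frechet_derivative (dird v (\<lambda>y. F y \<bullet> b)) (at x)"
      using smooth_on_has_derivative[OF smooth_on_inner[OF assms(1) smooth_on_dird[OF assms(2)] smooth_on_const] assms(3)]
      by (intro frechet_derivative_transform_within_open[OF _ assms(1,3)])
        (auto simp: in1[OF assms(2)] differentiable_def)
    then show ?thesis using in1[OF smooth_on_dird[OF assms(2)] assms(3)] by metis
  qed
  have "Ck_on 2 (\<lambda>y. F y \<bullet> b) S"
    using smooth_on_inner[OF assms(1,2) smooth_on_const] smooth_on_def by blast
  then show "dird v (dird u F) x \<bullet> b = dird u (dird v F) x \<bullet> b"
    using second_derivative_symmetric_real[OF assms(1) _ assms(3)] in2 by metis
qed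

section \<open>Immersions into flat pseudo-Euclidean spaces\<close>

text \<open>Product rule with a frozen argument: in the first summand \<open>X x\<close> is the
  value at the base point, and only the map \<open>L y\<close> varies.\<close>

lemma has_derivative_linear_apply:
  fixes L :: "'d::euclidean_space \<Rightarrow> 'e::euclidean_space \<Rightarrow> 'f::real_normed_vector"
  assumes "open S" "\<And>v. smooth_on (\<lambda>x. L x v) S" "\<And>x. x \<in> S \<Longrightarrow> linear (L x)" "smooth_on X S" "x \<in> S"
  shows "((\<lambda>x. L x (X x)) has_derivative
      (\<lambda>u. dird u (\<lambda>y. L y (X x)) x + L x (dird u X x))) (at x)"
proof -
  have d: "((\<lambda>y. L y (Y y)) has_derivative (\<lambda>u. (\<Sum>b\<in>Basis. (Y x \<bullet> b) *\<^sub>R dird u (\<lambda>y. L y b) x) + L x (dird u Y x))) (at x)"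
    if Y: "smooth_on Y S" for Y :: "'d \<Rightarrow> 'e"
  proof -
    have "((\<lambda>y. \<Sum>b\<in>Basis. (Y y \<bullet> b) *\<^sub>R L y b) has_derivative
        (\<lambda>u. \<Sum>b\<in>Basis. (Y x \<bullet> b) *\<^sub>R dird u (\<lambda>y. L y b) x + (dird u Y x \<bullet> b) *\<^sub>R L x b)) (at x)"
      by (intro has_derivative_sum has_derivative_scaleR has_derivative_inner_left
          smooth_on_has_derivative[OF Y assms(5)] smooth_on_has_derivative[OF assms(2,5)])
    then have "((\<lambda>y. L y (Y y)) has_derivative
        (\<lambda>u. \<Sum>b\<in>Basis. (Y x \<bullet> b) *\<^sub>R dird u (\<lambda>y. L y b) x + (dird u Y x \<bullet> b) *\<^sub>R L x b)) (at x)"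
      by (rule has_derivative_transform_within_open[OF _ assms(1,5)])
        (simp add: linear_eq_sum_Basis[OF assms(3), symmetric])
    then show ?thesis
      by (simp add: sum.distrib linear_eq_sum_Basis[OF assms(3)[OF assms(5)], symmetric])
  qed
  have "dird u (\<lambda>y. L y (X x)) x = (\<Sum>b\<in>Basis. (X x \<bullet> b) *\<^sub>R dird u (\<lambda>y. L y b) x)" for u
    using dird_eq[OF d[of "\<lambda>_. X x", OF smooth_on_const], of u] linear_0[OF assms(3)[OF assms(5)]] by simp
  then show ?thesis using d[OF assms(4)] by simp
qed

lemma dird_cong:
  assumes "open S" "x \<in> S" "smooth_on f S" "\<And>y. y \<in> S \<Longrightarrow> f y = g y"
  shows "dird u f x = dird u g x"
  using dird_eq[OF has_derivative_transform_within_open[OF smooth_on_has_derivative[OF assms(3,2)] assms(1,2,4)]]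
  by simp

lemma has_derivative_smooth_compose:
  assumes "open S" "smooth_on F S" "smooth_on T N" "T ` N \<subseteq> S" "x \<in> N"
  shows "((\<lambda>y. F (T y)) has_derivative (\<lambda>v. frechet_derivative F (at (T x)) (dird v T x))) (at x)"
  by (rule has_derivative_compose[OF smooth_on_has_derivative[OF assms(3,5)]
        smooth_on_has_derivative[OF assms(2)]]) (use assms(4,5) in auto)

text \<open>The Hessian of a composition. The last term lies in the range of the differential of
  \<open>F\<close>; it therefore has no normal component, which is why the second fundamental form
  is a tensor.\<close>

lemma second_derivative_compose:
  fixes F :: "'e::euclidean_space \<Rightarrow> 'w::euclidean_space" and T :: "'d::euclidean_space \<Rightarrow> 'e"
  assumes "open S" "open N" "smooth_on F S" "smooth_on T N" "T ` N \<subseteq> S" "x \<in> N"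
  shows "dird u (dird v (\<lambda>y. F (T y))) x =
    dird (dird u T x) (dird (dird v T x) F) (T x) + frechet_derivative F (at (T x)) (dird u (dird v T) x)"
proof -
  have Tx: "T y \<in> S" if "y \<in> N" for y using assms(5) that by auto
  define L where "L = (\<lambda>y w. dird w F (T y))"
  have sL: "smooth_on (\<lambda>y. L y w) N" for w
    unfolding L_def by (rule smooth_on_compose[OF assms(2,1,5) smooth_on_dird[OF assms(3)] assms(4)])
  have lL: "linear (L y)" if "y \<in> N" for y
    using smooth_on_linear[OF assms(3) Tx[OF that]] by (simp add: L_def)
  have "dird v (\<lambda>y. F (T y)) y = L y (dird v T y)" if "y \<in> N" for y
    using dird_eq[OF has_derivative_smooth_compose[OF assms(1,3,4,5) that]] by (simp add: L_def)
  then have "dird u (dird v (\<lambda>y. F (T y))) x = dird u (\<lambda>y. L y (dird v T y)) x"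
    by (rule dird_cong[OF assms(2,6) smooth_on_dird[OF smooth_on_compose[OF assms(2,1,5,3,4)]]])
  also have "\<dots> = dird u (\<lambda>y. L y (dird v T x)) x + L x (dird u (dird v T) x)"
    by (rule dird_eq[OF has_derivative_linear_apply[OF assms(2) sL lL smooth_on_dird[OF assms(4)] assms(6)]])
  also have "dird u (\<lambda>y. L y (dird v T x)) x = dird (dird u T x) (dird (dird v T x) F) (T x)"
    unfolding L_def
    by (rule dird_eq[OF has_derivative_smooth_compose[OF assms(1) smooth_on_dird[OF assms(3)] assms(4,5,6)]])
  finally show ?thesis by (simp add: L_def)
qed

lemma dird_bilinear:
  assumes "bounded_bilinear B" "smooth_on f S" "smooth_on g S" "x \<in> S"
  shows "dird u (\<lambda>x. B (f x) (g x)) x = B (f x) (dird u g x) + B (dird u f x) (g x)"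
  by (rule dird_eq[OF bounded_bilinear.FDERIV[OF assms(1) smooth_on_has_derivative[OF assms(2,4)]
          smooth_on_has_derivative[OF assms(3,4)]]])

section \<open>Positive definite forms and smooth duals of one-forms\<close>

definition inner_form :: "('e::real_vector \<Rightarrow> 'e \<Rightarrow> real) \<Rightarrow> bool" where
  "inner_form g \<longleftrightarrow> bilinear g \<and> (\<forall>u v. g u v = g v u) \<and> (\<forall>u. u \<noteq> 0 \<longrightarrow> g u u > 0)"

lemma inner_form_eqI:
  assumes "inner_form g" "\<And>z. g u z = g v z"
  shows "u = v"
proof (rule ccontr)
  assume "u \<noteq> v"
  then have "g (u - v) (u - v) > 0" using assms(1) by (simp add: inner_form_def)
  moreover have "g (u - v) (u - v) = 0"
    using assms bilinear_lsub unfolding inner_form_def by fastforce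
  ultimately show False by simp
qed

text \<open>\<open>X\<close> is the metric dual of the one-form \<open>\<alpha>\<close>. The linear
  system is solved as in Gram-Schmidt, one coordinate vector at a time, so that the only divisions
  are by the positive numbers \<open>G x (n x) a = G x (n x) (n x)\<close>. Christoffel symbols,
  inverse differentials and the direction field are all obtained this way.\<close>

lemma smooth_raise:
  fixes G :: "'e::euclidean_space \<Rightarrow> 'e \<Rightarrow> 'e \<Rightarrow> real"
  assumes "open S" and G: "\<And>u v. smooth_on (\<lambda>x. G x u v) S" "\<And>x. x \<in> S \<Longrightarrow> inner_form (G x)"
    and \<alpha>: "\<And>v. smooth_on (\<lambda>x. \<alpha> x v) S" "\<And>x. x \<in> S \<Longrightarrow> linear (\<alpha> x)"
  obtains X where "smooth_on X S" "\<And>x z. x \<in> S \<Longrightarrow> G x (X x) z = \<alpha> x z"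
proof -
  have bil: "bilinear (G x)" and sym: "G x u v = G x v u" and pos: "u \<noteq> 0 \<Longrightarrow> G x u u > 0"
    if "x \<in> S" for x u v using G(2)[OF that] by (auto simp: inner_form_def)
  have "finite A \<Longrightarrow> A \<subseteq> Basis \<Longrightarrow> (\<And>v. smooth_on (\<lambda>x. \<beta> x v) S) \<Longrightarrow>
    \<exists>X. smooth_on X S \<and> (\<forall>x\<in>S. X x \<in> span A \<and> (\<forall>z\<in>A. G x (X x) z = \<beta> x z))" for A \<beta>
  proof (induction A arbitrary: \<beta> rule: finite_induct)
    case empty
    then show ?case by (intro exI[of _ "\<lambda>x. 0"]) (simp add: smooth_on_const)
  next
    case (insert a A)
    have A: "A \<subseteq> Basis" and a: "a \<in> Basis" using insert.prems by auto
    obtain X where X: "smooth_on X S" "\<And>x. x \<in> S \<Longrightarrow> X x \<in> span A"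
      "\<And>x z. x \<in> S \<Longrightarrow> z \<in> A \<Longrightarrow> G x (X x) z = \<beta> x z"
      using insert.IH[of \<beta>, OF A insert.prems(2)] by blast
    \<comment> \<open>A second use of the induction hypothesis, for the one-form dual to
      \<open>a\<close>: \<open>Y\<close> is the projection of \<open>a\<close> to
      \<open>span A\<close>, and \<open>n\<close> below is the orthogonal remainder.\<close>
    obtain Y where Y: "smooth_on Y S" "\<And>x. x \<in> S \<Longrightarrow> Y x \<in> span A"
      "\<And>x z. x \<in> S \<Longrightarrow> z \<in> A \<Longrightarrow> G x (Y x) z = G x a z"
      using insert.IH[of "\<lambda>x. G x a", OF A G(1)] by blast
    define n where "n x = a - Y x" for x
    have n: "smooth_on n S" unfolding n_def by (intro smooth_on_diff assms(1) smooth_on_const Y(1))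
    have nA: "G x (n x) z = 0" if "x \<in> S" "z \<in> span A" for x z
    proof (rule linear_eq_0_on_span[OF _ _ that(2)])
      show "linear (G x (n x))" using bil[OF that(1)] by (simp add: bilinear_def)
      show "G x (n x) z = 0" if "z \<in> A" for z
        using Y(3)[OF \<open>x \<in> S\<close> that] bilinear_lsub[OF bil[OF \<open>x \<in> S\<close>]] by (simp add: n_def)
    qed
    have n0: "n x \<noteq> 0" if "x \<in> S" for x
    proof
      assume "n x = 0"
      then have "a \<in> span A" using Y(2)[OF that] by (simp add: n_def)
      moreover have "span A \<subseteq> span (Basis - {a})" using A insert.hyps by (intro span_mono) auto
      ultimately show False using a independent_Basis unfolding dependent_def by blast
    qed
    have na: "G x (n x) a = G x (n x) (n x)" if "x \<in> S" for x
      using nA[OF that Y(2)[OF that]] bilinear_rsub[OF bil[OF that]] by (simp add: n_def)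
    have na0: "G x (n x) a \<noteq> 0" if "x \<in> S" for x
      using na[OF that] pos[OF that n0[OF that]] by simp
    have GU: "smooth_on (\<lambda>x. G x (U x) v) S" if "smooth_on U S" for U v
      by (rule smooth_on_bilinear_apply[OF assms(1) G(1) bil that smooth_on_const])
    define t where "t x = (\<beta> x a - G x (X x) a) / G x (n x) a" for x
    have t: "smooth_on t S"
      unfolding t_def
      by (rule smooth_on_divide[OF assms(1) na0 smooth_on_diff[OF assms(1) insert.prems(2) GU[OF X(1)]] GU[OF n]])
    show ?case
    proof (intro exI[of _ "\<lambda>x. X x + t x *\<^sub>R n x"] conjI ballI)
      show "smooth_on (\<lambda>x. X x + t x *\<^sub>R n x) S"
        by (rule smooth_on_add[OF assms(1) X(1) smooth_on_scaleR[OF assms(1) t n]])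
    next
      fix x assume x: "x \<in> S"
      have "X x \<in> span (insert a A)" "Y x \<in> span (insert a A)"
        using X(2)[OF x] Y(2)[OF x] span_mono[of A "insert a A"] by auto
      then show "X x + t x *\<^sub>R n x \<in> span (insert a A)"
        unfolding n_def by (intro span_add span_scale span_diff) (auto intro: span_base)
      fix z assume z: "z \<in> insert a A"
      have "G x (X x + t x *\<^sub>R n x) z = G x (X x) z + t x * G x (n x) z"
        using bilinear_ladd[OF bil[OF x]] bilinear_lmul[OF bil[OF x]] by simp
      also have "\<dots> = \<beta> x z"
        using z X(3)[OF x] nA[OF x] na0[OF x] span_base[of _ A] by (auto simp: t_def)
      finally show "G x (X x + t x *\<^sub>R n x) z = \<beta> x z" .
    qed
  qed
  from this[of Basis \<alpha>, OF finite_Basis order_refl \<alpha>(1)] obtain X where X: "smooth_on X S"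
    "\<And>x z. x \<in> S \<Longrightarrow> z \<in> Basis \<Longrightarrow> G x (X x) z = \<alpha> x z" by blast
  have "G x (X x) z = \<alpha> x z" if "x \<in> S" for x z
  proof -
    have "linear (G x (X x))" using bil[OF that] by (simp add: bilinear_def)
    then show ?thesis
      using linear_eq_stdbasis[OF _ \<alpha>(2)[OF that]] X(2)[OF that] by metis
  qed
  then show ?thesis using that X(1) by blast
qed

text \<open>\<open>B\<close> may be indefinite; positivity of \<open>G\<close> makes
  \<open>F\<close> an immersion and the Levi-Civita connection unique. \<open>G\<close> is tied to
  \<open>F\<close> on \<open>S\<close> only, so that the metric of a chart can be inserted
  directly.\<close>

locale flat_immersion =
  fixes S :: "'e::euclidean_space set" and F :: "'e \<Rightarrow> 'w::euclidean_space"
    and B :: "'w \<Rightarrow> 'w \<Rightarrow> real" and G :: "'e local_metric"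
  assumes S: "open S" and F: "smooth_on F S"
    and bilB: "bilinear B" and symB: "\<And>x y. B x y = B y x"
    and metric: "\<And>x u v. x \<in> S \<Longrightarrow> G x u v = B (dird u F x) (dird v F x)"
    and pos: "\<And>x u. x \<in> S \<Longrightarrow> u \<noteq> 0 \<Longrightarrow> G x u u > 0"
begin

lemma bbB: "bounded_bilinear B"
  using bilB bounded_bilinear_of_bilinear by blast

lemmas linB = bilinear_ladd[OF bilB] bilinear_radd[OF bilB] bilinear_lsub[OF bilB] bilinear_rsub[OF bilB]
  bilinear_lmul[OF bilB] bilinear_rmul[OF bilB] bilinear_lzero[OF bilB] bilinear_rzero[OF bilB]

lemmas linF = smooth_on_linear[OF F]

lemma inner_form_G: "x \<in> S \<Longrightarrow> inner_form (G x)"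
proof -
  assume x: "x \<in> S"
  have "bilinear (G x)" unfolding bilinear_def
    by (auto intro!: linearI simp: metric x linear_add[OF linF[OF x]] linear_scale[OF linF[OF x]] linB)
  then show ?thesis using metric[OF x] pos[OF x] symB by (simp add: inner_form_def)
qed

lemma bilinear_G: "x \<in> S \<Longrightarrow> bilinear (G x)"
  using inner_form_G by (simp add: inner_form_def)

lemma smooth_F2: "smooth_on (dird u (dird v F)) S"
  by (intro smooth_on_dird F)

lemma smooth_B: "smooth_on f S \<Longrightarrow> smooth_on g S \<Longrightarrow> smooth_on (\<lambda>x. B (f x) (g x)) S"
  using smooth_on_bilinear[OF bbB S] by blast

lemma smooth_G: "smooth_on (\<lambda>x. G x u v) S"
  by (rule smooth_on_cong[OF smooth_B[OF smooth_on_dird[OF F] smooth_on_dird[OF F]] S])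
    (simp add: metric)

lemma F2_sym: "x \<in> S \<Longrightarrow> dird u (dird v F) x = dird v (dird u F) x"
  using second_derivative_symmetric[OF S F] by blast

lemma bilinear_F2: "x \<in> S \<Longrightarrow> bilinear (\<lambda>u v. dird u (dird v F) x)"
  unfolding bilinear_def
  using smooth_on_linear[OF smooth_on_dird[OF F]] F2_sym by auto

lemma dird_G:
  assumes "x \<in> S"
  shows "dird u (\<lambda>y. G y v w) x =
    B (dird v F x) (dird u (dird w F) x) + B (dird u (dird v F) x) (dird w F x)"
proof -
  have "dird u (\<lambda>y. B (dird v F y) (dird w F y)) x = dird u (\<lambda>y. G y v w) x"
    by (rule dird_cong[OF S assms smooth_B[OF smooth_on_dird[OF F] smooth_on_dird[OF F]]]) (simp add: metric)
  then show ?thesis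
    using dird_bilinear[OF bbB smooth_on_dird[OF F] smooth_on_dird[OF F] assms] by metis
qed

text \<open>Each derivative of \<open>G\<close> splits into two terms. By the symmetry of second
  derivatives four of the six cancel and the other two coincide.\<close>

lemma koszul_rhs:
  assumes "x \<in> S"
  shows "dird u (\<lambda>y. G y v z) x + dird v (\<lambda>y. G y u z) x - dird z (\<lambda>y. G y u v) x
     = 2 * B (dird u (dird v F) x) (dird z F x)"
  by (simp add: dird_G[OF assms] F2_sym[OF assms, of v u] F2_sym[OF assms, of z u] F2_sym[OF assms, of z v]
      symB[of "dird u F x"] symB[of "dird v F x"])

lemma christoffel_eqI:
  assumes "x \<in> S" "\<And>z. G x w z = B (dird u (dird v F) x) (dird z F x)"
  shows "christoffel G x u v = w"
  unfolding christoffel_def koszul_rhs[OF assms(1)]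
proof (rule the_equality)
  show "w' = w" if "\<forall>z. 2 * G x w' z = 2 * B (dird u (dird v F) x) (dird z F x)" for w'
    by (rule inner_form_eqI[OF inner_form_G[OF assms(1)]]) (use that assms(2) in auto)
qed (simp add: assms)

lemma christoffel_smooth_koszul:
  "smooth_on (\<lambda>x. christoffel G x u v) S"
  "x \<in> S \<Longrightarrow> G x (christoffel G x u v) z = B (dird u (dird v F) x) (dird z F x)"
proof -
  have lin: "linear (\<lambda>z. B (dird u (dird v F) x) (dird z F x))" if "x \<in> S" for x
    by (auto intro!: linearI simp: linear_add[OF linF[OF that]] linear_scale[OF linF[OF that]] linB)
  obtain X where X: "smooth_on X S"
    "\<And>x z. x \<in> S \<Longrightarrow> G x (X x) z = B (dird u (dird v F) x) (dird z F x)"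
    using smooth_raise[OF S smooth_G inner_form_G smooth_B[OF smooth_F2 smooth_on_dird[OF F]] lin]
    by blast
  have eq: "christoffel G x u v = X x" if "x \<in> S" for x
    by (rule christoffel_eqI[OF that X(2)[OF that]])
  show "smooth_on (\<lambda>x. christoffel G x u v) S"
    by (rule smooth_on_cong[OF X(1) S]) (simp add: eq)
  show "x \<in> S \<Longrightarrow> G x (christoffel G x u v) z = B (dird u (dird v F) x) (dird z F x)"
    using eq X(2) by simp
qed

lemmas christoffel_smooth = christoffel_smooth_koszul(1) and koszul = christoffel_smooth_koszul(2)

text \<open>The vector-valued second fundamental form: the normal part of the second derivative,
  whose tangential part is the Christoffel vector.\<close>

definition II :: "'e \<Rightarrow> 'e \<Rightarrow> 'e \<Rightarrow> 'w" where
  "II x u v = dird u (dird v F) x - frechet_derivative F (at x) (christoffel G x u v)"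

lemma II_normal: "x \<in> S \<Longrightarrow> B (II x u v) (dird z F x) = 0"
  using koszul[of x u v z] by (simp add: II_def linB metric)

lemma II_smooth: "smooth_on (\<lambda>x. II x u v) S"
  unfolding II_def
  by (rule smooth_on_diff[OF S smooth_F2 smooth_on_linear_apply[OF S smooth_on_dird[OF F] linF christoffel_smooth]])

text \<open>Any tangential correction that makes the remainder normal must be the Christoffel one.
  This permits a comparison between coordinates without a transformation law for Christoffel
  symbols.\<close>

lemma II_unique:
  assumes "x \<in> S" "\<And>z. B (dird u (dird v F) x - dird w F x) (dird z F x) = 0"
  shows "II x u v = dird u (dird v F) x - dird w F x"
proof -
  have "christoffel G x u v = w"
    by (rule christoffel_eqI[OF assms(1)]) (use assms in \<open>simp add: linB metric\<close>)
  then show ?thesis by (simp add: II_def)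
qed

lemma christoffel_bilinear: "x \<in> S \<Longrightarrow> bilinear (christoffel G x)"
  unfolding bilinear_def
  by (auto intro!: linearI christoffel_eqI
      simp: koszul linB bilinear_ladd[OF bilinear_G] bilinear_lmul[OF bilinear_G]
        bilinear_ladd[OF bilinear_F2] bilinear_lmul[OF bilinear_F2]
        bilinear_radd[OF bilinear_F2] bilinear_rmul[OF bilinear_F2])

lemma II_bilinear: "x \<in> S \<Longrightarrow> bilinear (II x)"
  unfolding bilinear_def II_def
  by (auto intro!: linearI simp: linear_add[OF linF] linear_scale[OF linF]
      bilinear_ladd[OF christoffel_bilinear] bilinear_lmul[OF christoffel_bilinear]
      bilinear_radd[OF christoffel_bilinear] bilinear_rmul[OF christoffel_bilinear]
      bilinear_ladd[OF bilinear_F2] bilinear_lmul[OF bilinear_F2]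
      bilinear_radd[OF bilinear_F2] bilinear_rmul[OF bilinear_F2] algebra_simps)

lemma II_sym: "x \<in> S \<Longrightarrow> II x u v = II x v u"
proof -
  assume x: "x \<in> S"
  have "christoffel G x u v = christoffel G x v u"
    by (rule christoffel_eqI[OF x]) (simp add: koszul[OF x] F2_sym[OF x, of u v])
  then show ?thesis by (simp add: II_def F2_sym[OF x, of u v])
qed

lemma gauss_aux:
  assumes x: "x \<in> S"
  shows "G x (dird u (\<lambda>y. christoffel G y v w) x + christoffel G x u (christoffel G x v w)) z =
    B (dird u (dird v (dird w F)) x) (dird z F x) + B (II x v w) (II x u z)"
proof -
  define \<gamma> where "\<gamma> = (\<lambda>y. christoffel G y v w)"
  have \<gamma>: "smooth_on \<gamma> S" unfolding \<gamma>_def by (rule christoffel_smooth)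
  define H where "H = (\<lambda>y. frechet_derivative F (at y) (\<gamma> y))"
  have sH: "smooth_on H S" unfolding H_def
    by (rule smooth_on_linear_apply[OF S smooth_on_dird[OF F] linF \<gamma>])
  have dH: "dird u H x = dird u (dird (\<gamma> x) F) x + dird (dird u \<gamma> x) F x"
    unfolding H_def
    by (rule dird_eq[OF has_derivative_linear_apply[OF S smooth_on_dird[OF F] linF \<gamma> x]])
  have Hx: "H x = dird (\<gamma> x) F x" by (simp add: H_def)
  have IIx: "II x v w = dird v (dird w F) x - dird (\<gamma> x) F x" by (simp add: II_def \<gamma>_def)
  \<comment> \<open>\<open>H\<close> is the tangential part of \<open>dird v (dird w F)\<close>, so
    both have the same product with \<open>dird z F\<close>. Differentiating this identity along
    \<open>u\<close> trades the derivative of the Christoffel vector for a third derivative of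
    \<open>F\<close> and a product of values of \<open>II\<close>.\<close>
  have "dird u (\<lambda>y. B (H y) (dird z F y)) x = dird u (\<lambda>y. B (dird v (dird w F) y) (dird z F y)) x"
  proof (rule dird_cong[OF S x smooth_B[OF sH smooth_on_dird[OF F]]])
    show "B (H y) (dird z F y) = B (dird v (dird w F) y) (dird z F y)" if "y \<in> S" for y
      using koszul[OF that, of v w z] unfolding metric[OF that] H_def \<gamma>_def .
  qed
  then have "B (H x) (dird u (dird z F) x) + B (dird u H x) (dird z F x)
     = B (dird v (dird w F) x) (dird u (dird z F) x) + B (dird u (dird v (dird w F)) x) (dird z F x)"
    using dird_bilinear[OF bbB sH smooth_on_dird[OF F] x] dird_bilinear[OF bbB smooth_F2 smooth_on_dird[OF F] x]
    by metis
  then have "B (dird u (dird (\<gamma> x) F) x) (dird z F x) + B (dird (dird u \<gamma> x) F x) (dird z F x)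
     = B (II x v w) (dird u (dird z F) x) + B (dird u (dird v (dird w F)) x) (dird z F x)"
    unfolding dH IIx Hx linB by linarith
  moreover have "B (II x v w) (dird u (dird z F) x) = B (II x v w) (II x u z)"
    using II_normal[OF x, of v w] by (simp add: II_def[of x u z] linB)
  ultimately show ?thesis
    by (simp add: bilinear_ladd[OF bilinear_G[OF x]] koszul[OF x] metric[OF x, of "dird u \<gamma> x"] \<gamma>_def[symmetric])
      (simp add: \<gamma>_def)
qed

text \<open>Antisymmetrising \<open>gauss_aux\<close> in \<open>u\<close> and \<open>v\<close>
  removes the third derivatives of \<open>F\<close>, which are symmetric.\<close>

theorem gauss_equation:
  assumes x: "x \<in> S"
  shows "G x (riemann G x u v w) z = B (II x v w) (II x u z) - B (II x u w) (II x v z)"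
proof -
  have "riemann G x u v w =
      (dird u (\<lambda>y. christoffel G y v w) x + christoffel G x u (christoffel G x v w)) -
      (dird v (\<lambda>y. christoffel G y u w) x + christoffel G x v (christoffel G x u w))"
    by (simp add: riemann_def)
  moreover have "dird u (dird v (dird w F)) x = dird v (dird u (dird w F)) x"
    using second_derivative_symmetric[OF S smooth_on_dird[OF F] x] by blast
  ultimately show ?thesis
    by (simp only: bilinear_lsub[OF bilinear_G[OF x]] gauss_aux[OF x])
qed

end

text \<open>The Hessian of \<open>T\<close> enters only through the tangential vector
  \<open>c\<close>. By surjectivity \<open>c\<close> is the image of some \<open>w\<close>, which
  \<open>II_unique\<close> then absorbs.\<close>

lemma II_coordinate_change:
  fixes T :: "'d::euclidean_space \<Rightarrow> 'e::euclidean_space" and F :: "'e \<Rightarrow> 'w::euclidean_space"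
  assumes "flat_immersion S F B G" "flat_immersion N (\<lambda>y. F (T y)) B G'"
    and T: "smooth_on T N" "T ` N \<subseteq> S" and x: "x \<in> N"
    and surj: "surj (\<lambda>v. dird v T x)"
  shows "flat_immersion.II (\<lambda>y. F (T y)) G' x u v = flat_immersion.II F G (T x) (dird u T x) (dird v T x)"
proof -
  interpret A: flat_immersion S F B G by fact
  interpret C: flat_immersion N "\<lambda>y. F (T y)" B G' by fact
  have Tx: "T x \<in> S" using T(2) x by auto
  define Q where "Q = A.II (T x) (dird u T x) (dird v T x)"
  define c where "c = christoffel G (T x) (dird u T x) (dird v T x) + dird u (dird v T) x"
  have d: "dird z (\<lambda>y. F (T y)) x = dird (dird z T x) F (T x)" for z
    using dird_eq[OF has_derivative_smooth_compose[OF A.S A.F T x]] .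
  obtain w where w: "dird w T x = c" using surj by (metis surjD)
  have *: "dird u (dird v (\<lambda>y. F (T y))) x - dird w (\<lambda>y. F (T y)) x = Q"
    unfolding second_derivative_compose[OF A.S C.S A.F T x] d w Q_def A.II_def
    by (simp add: c_def linear_add[OF A.linF[OF Tx]])
  have "C.II x u v = dird u (dird v (\<lambda>y. F (T y))) x - dird w (\<lambda>y. F (T y)) x"
    by (rule C.II_unique[OF x]) (simp only: * , simp only: d Q_def A.II_normal[OF Tx])
  then show ?thesis using * Q_def by simp
qed

section \<open>Quasi-umbilical forms\<close>

lemma bilinear_simps:
  assumes "bilinear g"
  shows "g (x + y) z = g x z + g y z" "g z (x + y) = g z x + g z y"
    "g (x - y) z = g x z - g y z" "g z (x - y) = g z x - g z y"
    "g (c *\<^sub>R x) z = c *\<^sub>R g x z" "g z (c *\<^sub>R x) = c *\<^sub>R g z x"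
    "g 0 z = 0" "g z 0 = 0"
  by (rule bilinear_ladd[OF assms] bilinear_radd[OF assms] bilinear_lsub[OF assms] bilinear_rsub[OF assms]
      bilinear_lmul[OF assms] bilinear_rmul[OF assms] bilinear_lzero[OF assms] bilinear_rzero[OF assms])+

lemma inner_formD:
  assumes "inner_form g"
  shows "bilinear g" "g u v = g v u" "u \<noteq> 0 \<Longrightarrow> g u u > 0" "g u u \<ge> 0"
proof -
  show "bilinear g" "g u v = g v u" "u \<noteq> 0 \<Longrightarrow> g u u > 0"
    using assms by (auto simp: inner_form_def)
  then show "g u u \<ge> 0"
    using assms bilinear_simps(7)[of g 0] by (cases "u = 0") (auto simp: inner_form_def less_imp_le)
qed

lemma symmetric_bilinear_eqI:
  fixes g h :: "'e::real_vector \<Rightarrow> 'e \<Rightarrow> real"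
  assumes "bilinear g" "\<And>u v. g u v = g v u" "bilinear h" "\<And>u v. h u v = h v u" "\<And>u. g u u = h u u"
  shows "g u v = h u v"
  using assms(5)[of "u + v"] assms(5)[of u] assms(5)[of v] assms(2)[of u v] assms(4)[of u v]
  by (simp add: bilinear_simps[OF assms(1)] bilinear_simps[OF assms(3)])

section \<open>Orthogonal vectors and extremal eigenvectors\<close>

lemma inner_form_Cauchy_Schwarz:
  assumes "inner_form g"
  shows "(g u v)\<^sup>2 \<le> g u u * g v v"
proof (cases "v = 0")
  case True
  then show ?thesis by (simp add: bilinear_simps[OF inner_formD(1)[OF assms]])
next
  case False
  note b = bilinear_simps[OF inner_formD(1)[OF assms]]
  have v: "g v v > 0" using inner_formD(3)[OF assms False] .
  have "0 \<le> g (g v v *\<^sub>R u - g u v *\<^sub>R v) (g v v *\<^sub>R u - g u v *\<^sub>R v)"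
    by (rule inner_formD(4)[OF assms])
  also have "\<dots> = g v v * (g u u * g v v - (g u v)\<^sup>2)"
    using inner_formD(2)[OF assms, of v u] by (simp add: b power2_eq_square algebra_simps)
  finally show ?thesis using v by (simp add: zero_le_mult_iff)
qed

lemma inner_form_normalize:
  assumes "inner_form g" "u \<noteq> 0"
  shows "g ((1 / sqrt (g u u)) *\<^sub>R u) ((1 / sqrt (g u u)) *\<^sub>R u) = 1"
  using inner_formD(3)[OF assms]
  by (simp add: bilinear_simps[OF inner_formD(1)[OF assms(1)]] real_sqrt_mult_self flip: mult.assoc)

lemma ex_orthogonal_unit:
  fixes g :: "'e::euclidean_space \<Rightarrow> 'e \<Rightarrow> real"
  assumes g: "inner_form g" and A: "finite A" "card A < DIM('e)"
  obtains z where "g z z = 1" "\<And>a. a \<in> A \<Longrightarrow> g a z = 0"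
proof -
  \<comment> \<open>\<open>R a\<close> represents \<open>g a\<close> in the inner product of the
    coordinate space, so that \<open>g\<close>-orthogonality to \<open>A\<close> becomes Euclidean
    orthogonality to fewer vectors than the dimension.\<close>
  define R where "R a = (\<Sum>b\<in>Basis. g a b *\<^sub>R b)" for a
  have R: "g a z = R a \<bullet> z" for a z
  proof -
    have "linear (g a)" using inner_formD(1)[OF g] by (simp add: bilinear_def)
    then show ?thesis
      using linear_eq_sum_Basis[of "g a" z] by (simp add: R_def inner_sum_left inner_commute[of z] mult.commute)
  qed
  have "dim (R ` A) < DIM('e)"
    using dim_le_card[of "R ` A" "R ` A"] card_image_le[OF A(1), of R] A by (simp add: span_superset)
  then obtain z where z: "z \<noteq> 0" "\<And>y. y \<in> span (R ` A) \<Longrightarrow> orthogonal z y"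
    using orthogonal_to_subspace_exists by blast
  have "g a ((1 / sqrt (g z z)) *\<^sub>R z) = 0" if "a \<in> A" for a
    using z(2)[of "R a"] that by (simp add: R orthogonal_def inner_commute span_base)
  then show ?thesis using that inner_form_normalize[OF g z(1)] by blast
qed

text \<open>The Rayleigh quotient \<open>h u u / g u u\<close> is homogeneous of degree zero, so its
  maximum on the compact Euclidean unit sphere is a global one. Its first variation there is the
  eigenvector equation.\<close>

lemma ex_max_eigenvector:
  fixes g h :: "'e::euclidean_space \<Rightarrow> 'e \<Rightarrow> real"
  assumes g: "inner_form g" and h: "bilinear h" "\<And>u v. h u v = h v u"
  obtains X m where "g X X = 1" "\<And>u. h u u \<le> m * g u u" "\<And>v. h X v = m * g X v"
proof -
  note bg = bilinear_simps[OF inner_formD(1)[OF g]] and bh = bilinear_simps[OF h(1)]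
  have pos: "u \<noteq> 0 \<Longrightarrow> g u u > 0" for u using inner_formD(3)[OF g] .
  have "continuous_on (sphere 0 1) (\<lambda>u. h u u / g u u)"
    using pos
    by (intro continuous_on_divide bounded_bilinear.continuous_on[OF bounded_bilinear_of_bilinear[OF h(1)]]
        bounded_bilinear.continuous_on[OF bounded_bilinear_of_bilinear[OF inner_formD(1)[OF g]]] continuous_on_id)
      (metis less_irrefl norm_zero mem_sphere_0 zero_neq_one)
  moreover have "sphere (0::'e) 1 \<noteq> {}" by simp
  ultimately have "\<exists>Y\<in>sphere 0 1. \<forall>u\<in>sphere 0 1. h u u / g u u \<le> h Y Y / g Y Y"
    by (intro continuous_attains_sup compact_sphere)
  then obtain Y where Y: "Y \<in> sphere 0 1" "\<And>u. u \<in> sphere 0 1 \<Longrightarrow> h u u / g u u \<le> h Y Y / g Y Y"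
    by blast
  define m where "m = h Y Y / g Y Y"
  have Y0: "Y \<noteq> 0" using Y(1) by auto
  define X where "X = (1 / sqrt (g Y Y)) *\<^sub>R Y"
  have X1: "g X X = 1" unfolding X_def by (rule inner_form_normalize[OF g Y0])
  have max: "h u u \<le> m * g u u" for u
  proof (cases "u = 0")
    case True
    then show ?thesis by (simp add: bg bh)
  next
    case False
    define w where "w = (1 / norm u) *\<^sub>R u"
    have w: "u = norm u *\<^sub>R w" "w \<in> sphere 0 1" "w \<noteq> 0" using False by (auto simp: w_def)
    have "h w w \<le> m * g w w"
      using Y(2)[OF w(2)] pos[OF w(3)] by (simp add: m_def divide_le_eq)
    then have "(norm u * norm u) * h w w \<le> (norm u * norm u) * (m * g w w)"
      by (intro mult_left_mono) auto
    then show ?thesis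
      by (subst (1 2) w(1), subst (3) w(1), subst (4) w(1)) (simp add: bg bh mult_ac)
  qed
  have hX: "h X X = m"
    using pos[OF Y0] by (simp add: X_def bh m_def flip: mult.assoc)
  have "h X v = m * g X v" for v
  proof (rule ccontr)
    define b where "b = m * g X v - h X v"
    define c where "c = m * g v v - h v v"
    assume "h X v \<noteq> m * g X v"
    then have b: "b \<noteq> 0" by (simp add: b_def)
    have c: "c \<ge> 0" using max[of v] by (simp add: c_def)
    have q: "0 \<le> 2 * t * b + t * t * c" for t
      using max[of "X + t *\<^sub>R v"] X1 hX h(2)[of v X] inner_formD(2)[OF g, of v X]
      by (simp add: bg bh b_def c_def algebra_simps)
    \<comment> \<open>A short step against the sign of \<open>b\<close> makes the quadratic in
      \<open>q\<close> negative. The denominator \<open>c + 1\<close> is positive even if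
      \<open>c = 0\<close>.\<close>
    have "2 * (- b / (c + 1)) * b + (- b / (c + 1)) * (- b / (c + 1)) * c = - (b * b) * (c + 2) / ((c + 1) * (c + 1))"
      using c by (simp add: divide_simps) (simp add: algebra_simps)
    moreover have "- (b * b) * (c + 2) / ((c + 1) * (c + 1)) < 0"
      using b c by (intro divide_neg_pos mult_neg_pos mult_pos_pos) (auto simp: zero_less_mult_iff)
    ultimately show False using q[of "- b / (c + 1)"] by linarith
  qed
  then show ?thesis using that X1 max by blast
qed

text \<open>A Gram determinant: for the metric the squared area of the parallelogram, for a second
  fundamental form the extrinsic term of the Gauss equation.\<close>

definition disc :: "('e \<Rightarrow> 'e \<Rightarrow> real) \<Rightarrow> 'e \<Rightarrow> 'e \<Rightarrow> real" where
  "disc h u v = h u u * h v v - (h u v)\<^sup>2"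

text \<open>The eigenvalues are \<open>l + r\<close> on the unit vector \<open>X\<close> and
  \<open>l\<close> on its orthogonal complement. The umbilical case \<open>r = 0\<close>, in which
  \<open>X\<close> carries no information, is included.\<close>

definition quasi_umbilical :: "('e \<Rightarrow> 'e \<Rightarrow> real) \<Rightarrow> ('e \<Rightarrow> 'e \<Rightarrow> real) \<Rightarrow> real \<Rightarrow> real \<Rightarrow> 'e \<Rightarrow> bool" where
  "quasi_umbilical g h l r X \<longleftrightarrow> g X X = 1 \<and> (\<forall>u v. h u v = l * g u v + r * (g X u * g X v))"

lemma quasi_umbilicalI:
  assumes g: "inner_form g" and h: "bilinear h" "\<And>u v. h u v = h v u"
    and "g X X = 1" "\<And>u. h u u = l * g u u + r * (g X u)\<^sup>2"
  shows "quasi_umbilical g h l r X"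
proof -
  have "h u v = l * g u v + r * (g X u * g X v)" for u v
  proof (rule symmetric_bilinear_eqI[OF h])
    show "bilinear (\<lambda>u v. l * g u v + r * (g X u * g X v))"
      unfolding bilinear_def
      by (auto intro!: linearI simp: bilinear_simps[OF inner_formD(1)[OF g]] algebra_simps)
  qed (use inner_formD(2)[OF g] assms(5) in \<open>auto simp: power2_eq_square\<close>)
  then show ?thesis using assms(4) by (simp add: quasi_umbilical_def)
qed

text \<open>Cartan's argument. In the complement of two eigenvectors for the extreme eigenvalues
  \<open>a \<noteq> b\<close> all further eigenvalues agree, and their value \<open>t\<close> satisfies \<open>(t - a) * (t - b) = 0\<close>.\<close>

lemma ex_quasi_umbilical:
  fixes g h :: "'e::euclidean_space \<Rightarrow> 'e \<Rightarrow> real"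
  assumes g: "inner_form g" and h: "bilinear h" "\<And>u v. h u v = h v u" and dim: "DIM('e) \<ge> 4"
    and hyp: "\<And>u v w z. g u u = 1 \<Longrightarrow> g v v = 1 \<Longrightarrow> g w w = 1 \<Longrightarrow> g z z = 1 \<Longrightarrow>
      g u v = 0 \<Longrightarrow> g u w = 0 \<Longrightarrow> g u z = 0 \<Longrightarrow> g v w = 0 \<Longrightarrow> g v z = 0 \<Longrightarrow> g w z = 0 \<Longrightarrow>
      disc h u v + disc h w z = disc h u w + disc h v z"
  obtains l r X where "quasi_umbilical g h l r X"
proof -
  note bg = bilinear_simps[OF inner_formD(1)[OF g]] and bh = bilinear_simps[OF h(1)]
  note symg = inner_formD(2)[OF g]
  have pos: "u \<noteq> 0 \<Longrightarrow> g u u > 0" for u using inner_formD(3)[OF g] .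
  obtain X a where X: "g X X = 1" "\<And>u. h u u \<le> a * g u u" "\<And>v. h X v = a * g X v"
    using ex_max_eigenvector[OF g h] by blast
  have "bilinear (\<lambda>u v. - h u v)"
    using h(1) unfolding bilinear_def by (auto intro: linear_compose_neg)
  then obtain Y b' where Y': "g Y Y = 1" "\<And>u. - h u u \<le> b' * g u u" "\<And>v. - h Y v = b' * g Y v"
    using ex_max_eigenvector[OF g, of "\<lambda>u v. - h u v"] h(2) by metis
  define b where "b = - b'"
  have Y: "g Y Y = 1" "\<And>u. h u u \<ge> b * g u u" "\<And>v. h Y v = b * g Y v"
    using Y' unfolding b_def by (auto simp: minus_equation_iff minus_le_iff)
      (metis minus_minus mult_minus_left)
  show ?thesis
  proof (cases "a = b")
    case True
    then have "quasi_umbilical g h a 0 X"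
      using X(1,2) Y(2) by (intro quasi_umbilicalI[OF g h X(1)]) (simp add: order_antisym)
    then show ?thesis using that by blast
  next
    case False
    have XY: "g X Y = 0" using X(3)[of Y] Y(3)[of X] h(2)[of X Y] symg[of X Y] False by simp
    have D1: "disc h X Y = a * b" "disc h X w = a * h w w" "disc h Y w = b * h w w"
      if "g X w = 0" "g Y w = 0" for w
      using X Y XY that by (simp_all add: disc_def)
    have E: "a * b + disc h w z = a * h w w + b * h z z"
      if "g w w = 1" "g z z = 1" "g w z = 0" "g X w = 0" "g X z = 0" "g Y w = 0" "g Y z = 0" for w z
      using hyp[of X Y w z] X(1) Y(1) XY that D1[of w] D1[of z] by simp
    \<comment> \<open>\<open>disc h w z\<close> is symmetric: interchanging \<open>w\<close> and
      \<open>z\<close> in \<open>E\<close> and subtracting leaves \<open>a - b\<close> times the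
      difference of the two values.\<close>
    have eq: "h w w = h z z"
      if "g w w = 1" "g z z = 1" "g w z = 0" "g X w = 0" "g X z = 0" "g Y w = 0" "g Y z = 0" for w z
    proof -
      have "disc h w z = disc h z w" by (simp add: disc_def h(2)[of w z])
      then have "(a - b) * (h w w - h z z) = 0"
        using E[of w z] E[of z w] symg[of w z] that by (simp add: algebra_simps)
      then show ?thesis using False by simp
    qed
    \<comment> \<open>Rotation by 45 degrees gives another orthonormal pair in the same complement;
      equality of its two diagonal values says that the off-diagonal value of the old pair
      vanishes.\<close>
    have hwz: "h w z = 0"
      if "g w w = 1" "g z z = 1" "g w z = 0" "g X w = 0" "g X z = 0" "g Y w = 0" "g Y z = 0" for w z
    proof -
      define s where "s = 1 / sqrt (2::real)"
      have s: "s * s = 1 / 2" by (simp add: s_def)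
      have "h (s *\<^sub>R (w + z)) (s *\<^sub>R (w + z)) = h (s *\<^sub>R (w - z)) (s *\<^sub>R (w - z))"
        by (rule eq) (use that symg[of w z] s in \<open>auto simp: bg algebra_simps\<close>)
      then have "(s * s) * (4 * h w z) = 0" using h(2)[of w z] by (simp add: bh algebra_simps)
      then show ?thesis using s by simp
    qed
    have "card {X, Y} < DIM('e)" using dim card_insert_le_m1[of 2 "{Y}" X] by (simp add: card_insert_if split: if_splits)
    then obtain w where w0: "g w w = 1" "\<And>c. c \<in> {X, Y} \<Longrightarrow> g c w = 0"
      using ex_orthogonal_unit[OF g, of "{X, Y}"] by (metis finite.emptyI finite.insertI)
    then have w: "g w w = 1" "g X w = 0" "g Y w = 0" by auto
    have "card {X, Y, w} < DIM('e)" using dim by (auto simp: card_insert_if)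
    then obtain z where z0: "g z z = 1" "\<And>c. c \<in> {X, Y, w} \<Longrightarrow> g c z = 0"
      using ex_orthogonal_unit[OF g, of "{X, Y, w}"] by (metis finite.emptyI finite.insertI)
    then have z: "g z z = 1" "g X z = 0" "g Y z = 0" "g w z = 0" by auto
    define t where "t = h w w"
    have "a * b + t * t = a * t + b * t"
      using E[OF w(1) z(1,4) w(2) z(2) w(3) z(3)] eq[OF w(1) z(1,4) w(2) z(2) w(3) z(3)]
        hwz[OF w(1) z(1,4) w(2) z(2) w(3) z(3)] by (simp add: t_def disc_def)
    then have "(t - a) * (t - b) = 0" by (simp add: algebra_simps)
    then have t: "t = a \<or> t = b" by simp
    have comp1: "h y y = t * g y y \<and> h w y = 0" if "g X y = 0" "g Y y = 0" "g w y = 0" for y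
    proof (cases "y = 0")
      case True
      then show ?thesis by (simp add: bg bh)
    next
      case False
      define n where "n = sqrt (g y y)"
      have n: "n > 0" "n * n = g y y" using pos[OF False] by (auto simp: n_def)
      define v where "v = (1 / n) *\<^sub>R y"
      have v: "g v v = 1" "g X v = 0" "g Y v = 0" "g w v = 0"
        using that n inner_form_normalize[OF g False] by (auto simp: v_def bg n_def)
      have y: "y = n *\<^sub>R v" using n by (simp add: v_def)
      have "h v v = t" "h w v = 0"
        using eq[OF w(1) v(1,4) w(2) v(2) w(3) v(3)] hwz[OF w(1) v(1,4) w(2) v(2) w(3) v(3)]
        by (auto simp: t_def)
      then have "h (n *\<^sub>R v) (n *\<^sub>R v) = t * (n * n)" "h w (n *\<^sub>R v) = 0"
        by (simp_all add: bh)
      then show ?thesis using y n(2) by simp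
    qed
    have comp2: "h u u = t * g u u" if "g X u = 0" "g Y u = 0" for u
    proof -
      define y where "y = u - g w u *\<^sub>R w"
      have y: "h y y = t * g y y" "h w y = 0" "g w y = 0"
        using comp1[of y] that w by (auto simp: y_def bg)
      have u: "u = g w u *\<^sub>R w + y" by (simp add: y_def)
      define c where "c = g w u"
      have "h (c *\<^sub>R w + y) (c *\<^sub>R w + y) = t * g (c *\<^sub>R w + y) (c *\<^sub>R w + y)"
        using y w(1) h(2)[of y w] symg[of y w] t_def by (simp add: bg bh algebra_simps)
      then show ?thesis using u by (simp add: c_def)
    qed
    have all: "h u u = t * g u u + (a - t) * (g X u)\<^sup>2 + (b - t) * (g Y u)\<^sup>2" for u
    proof -
      define \<alpha> \<beta> where "\<alpha> = g X u" and "\<beta> = g Y u"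
      define y where "y = u - \<alpha> *\<^sub>R X - \<beta> *\<^sub>R Y"
      have gy: "g X y = 0" "g Y y = 0"
        using X(1) Y(1) XY symg[of X Y] by (auto simp: y_def \<alpha>_def \<beta>_def bg)
      then have hy: "h X y = 0" "h Y y = 0" "h y y = t * g y y"
        using X(3) Y(3) comp2 by auto
      have hXY: "h X X = a" "h Y Y = b" "h X Y = 0" using X(1,3) Y(1,3) XY by auto
      have u: "u = \<alpha> *\<^sub>R X + \<beta> *\<^sub>R Y + y" by (simp add: y_def)
      have "h u u = \<alpha>\<^sup>2 * a + \<beta>\<^sup>2 * b + t * g y y"
        unfolding u using hXY hy h(2)[of y X] h(2)[of y Y] h(2)[of Y X]
        by (simp add: bh power2_eq_square algebra_simps)
      moreover have "g u u = \<alpha>\<^sup>2 + \<beta>\<^sup>2 + g y y"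
        unfolding u using gy X(1) Y(1) XY symg[of y X] symg[of y Y] symg[of Y X]
        by (simp add: bg power2_eq_square algebra_simps)
      ultimately show ?thesis by (simp add: \<alpha>_def \<beta>_def algebra_simps)
    qed
    \<comment> \<open>Whichever extreme eigenvalue \<open>t\<close> equals, one of the two squares
      in \<open>all\<close> drops out.\<close>
    from t show ?thesis
    proof
      assume "t = a"
      then have "quasi_umbilical g h a (b - a) Y" using all by (intro quasi_umbilicalI[OF g h Y(1)]) simp
      then show ?thesis using that by blast
    next
      assume "t = b"
      then have "quasi_umbilical g h b (a - b) X" using all by (intro quasi_umbilicalI[OF g h X(1)]) simp
      then show ?thesis using that by blast
    qed
  qed
qed

section \<open>Curvature and angles of planes\<close>

lemma ex_orthonormal_pair:
  fixes g :: "'e::euclidean_space \<Rightarrow> 'e \<Rightarrow> real"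
  assumes g: "inner_form g" and "two_plane \<sigma>"
  obtains e1 e2 where "span {e1, e2} = \<sigma>" "g e1 e1 = 1" "g e2 e2 = 1" "g e1 e2 = 0"
proof -
  note bg = bilinear_simps[OF inner_formD(1)[OF g]]
  have sub: "subspace \<sigma>" and "dim \<sigma> = 2" using assms(2) by (auto simp: two_plane_def)
  obtain Bs where Bs: "Bs \<subseteq> \<sigma>" "independent Bs" "\<sigma> \<subseteq> span Bs" "card Bs = 2"
    using basis_exists[of \<sigma>] \<open>dim \<sigma> = 2\<close> by metis
  then obtain b1 b2 where b: "Bs = {b1, b2}" "b1 \<noteq> b2" by (auto simp: card_2_iff)
  have \<sigma>: "\<sigma> = span {b1, b2}" using Bs b sub span_minimal by blast
  have b1: "b1 \<noteq> 0" using Bs(2) b dependent_zero by blast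
  define e1 where "e1 = (1 / sqrt (g b1 b1)) *\<^sub>R b1"
  have e1: "g e1 e1 = 1" unfolding e1_def by (rule inner_form_normalize[OF g b1])
  have b1e: "b1 = sqrt (g b1 b1) *\<^sub>R e1" using inner_formD(3)[OF g b1] by (simp add: e1_def)
  define n where "n = b2 - g e1 b2 *\<^sub>R e1"
  have n0: "n \<noteq> 0"
  proof
    assume "n = 0"
    then have "b2 = (g e1 b2 / sqrt (g b1 b1)) *\<^sub>R b1" by (simp add: n_def e1_def)
    then have "b2 \<in> span {b1}" by (metis span_base span_scale insertI1)
    moreover have "{b1, b2} - {b2} = {b1}" using b by auto
    ultimately show False using Bs(2) b unfolding dependent_def by auto
  qed
  define e2 where "e2 = (1 / sqrt (g n n)) *\<^sub>R n"
  have e2: "g e2 e2 = 1" unfolding e2_def by (rule inner_form_normalize[OF g n0])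
  have e12: "g e1 e2 = 0" using e1 by (simp add: e2_def n_def bg)
  have b2e: "b2 = sqrt (g n n) *\<^sub>R e2 + g e1 b2 *\<^sub>R e1"
    using inner_formD(3)[OF g n0] by (simp add: e2_def) (simp add: n_def)
  have in\<sigma>: "b1 \<in> \<sigma>" "b2 \<in> \<sigma>" unfolding \<sigma> by (auto intro: span_base)
  have "e1 \<in> \<sigma>" unfolding e1_def by (intro subspace_scale sub in\<sigma>)
  moreover from this have "e2 \<in> \<sigma>" unfolding e2_def n_def by (intro subspace_scale subspace_diff sub in\<sigma>)
  ultimately have "span {e1, e2} \<subseteq> \<sigma>" by (intro span_minimal sub) auto
  moreover have "b1 \<in> span {e1, e2}" by (subst b1e) (intro span_scale span_base, simp)
  moreover have "b2 \<in> span {e1, e2}" by (subst b2e) (intro span_add span_scale span_base; simp)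
  ultimately have "span {e1, e2} = \<sigma>" unfolding \<sigma>
    by (metis \<sigma> span_minimal subspace_span insert_subset empty_subsetI subset_antisym)
  then show ?thesis using that e1 e2 e12 by blast
qed

lemma span_pair_obtain:
  assumes "x \<in> span {e1, e2}"
  obtains a b where "x = a *\<^sub>R e1 + b *\<^sub>R e2"
  using assms by (force simp: span_insert algebra_simps)

text \<open>If \<open>s\<close> and \<open>t\<close> are the products of \<open>X\<close> with
  \<open>e1\<close> and \<open>e2\<close>, the minor of \<open>h\<close> is
  \<open>(l + r s^2) (l + r t^2) - (r s t)^2\<close>. The terms in \<open>r^2\<close> cancel, and
  what remains is affine in the squared length of the projection of \<open>X\<close> to the plane.
  Another spanning pair multiplies both sides by the same squared determinant.\<close>

lemma sec_curvature_orthonormal: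
  fixes G :: "'e::euclidean_space local_metric"
  assumes g: "inner_form (G x)"
    and R: "\<And>u v. G x (riemann G x u v v) u = c * disc (G x) u v + disc h u v"
    and q: "quasi_umbilical (G x) h l r X"
    and e: "span {e1, e2} = \<sigma>" "G x e1 e1 = 1" "G x e2 e2 = 1" "G x e1 e2 = 0"
  shows "sec_curvature G x \<sigma> = c + l\<^sup>2 + l * r * ((G x X e1)\<^sup>2 + (G x X e2)\<^sup>2)"
proof -
  note bg = bilinear_simps[OF inner_formD(1)[OF g]]
  have sym: "G x e2 e1 = 0" using inner_formD(2)[OF g] e(4) by metis
  have h: "h u v = l * G x u v + r * (G x X u * G x X v)" for u v
    using q by (simp add: quasi_umbilical_def)
  define k where "k = c + l\<^sup>2 + l * r * ((G x X e1)\<^sup>2 + (G x X e2)\<^sup>2)"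
  have area: "G x u u * G x v v - (G x u v)\<^sup>2 = disc (G x) u v" for u v by (simp add: disc_def)
  have k: "G x (riemann G x u v v) u = k * disc (G x) u v" if uv: "span {u, v} = \<sigma>" for u v
  proof -
    have "u \<in> span {e1, e2}" "v \<in> span {e1, e2}" using uv e(1) by (auto intro: span_base)
    then obtain a b a' b' where u: "u = a *\<^sub>R e1 + b *\<^sub>R e2" and v: "v = a' *\<^sub>R e1 + b' *\<^sub>R e2"
      using span_pair_obtain by metis
    have g1: "G x u u = a\<^sup>2 + b\<^sup>2" "G x v v = a'\<^sup>2 + b'\<^sup>2" "G x u v = a * a' + b * b'"
      "G x X u = a * G x X e1 + b * G x X e2" "G x X v = a' * G x X e1 + b' * G x X e2"
      by (simp_all add: u v bg e sym power2_eq_square algebra_simps)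
    show ?thesis unfolding R disc_def h g1 k_def by algebra
  qed
  have d: "disc (G x) e1 e2 = 1" by (simp add: disc_def e)
  show ?thesis
    unfolding sec_curvature_def area k_def[symmetric]
  proof (rule the_equality)
    show "k' = k" if "\<forall>u v. span {u, v} = \<sigma> \<longrightarrow> G x (riemann G x u v v) u = k' * disc (G x) u v" for k'
      using that k[OF e(1)] e(1) d by auto
  qed (use k in blast)
qed

text \<open>\<open>P\<close> is the squared length of the projection of the unit vector
  \<open>X\<close> to the plane, so \<open>sqrt P\<close> is the largest cosine that occurs, and
  \<open>arccos\<close> is decreasing.\<close>

lemma plane_line_angle_orthonormal:
  fixes G :: "'e::euclidean_space local_metric"
  assumes g: "inner_form (G x)" and X: "G x X X = 1"
    and e: "span {e1, e2} = \<sigma>" "G x e1 e1 = 1" "G x e2 e2 = 1" "G x e1 e2 = 0"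
  defines "P \<equiv> (G x X e1)\<^sup>2 + (G x X e2)\<^sup>2"
  shows "plane_line_angle G x \<sigma> (span {X}) = arccos (sqrt P)" "P \<le> 1"
proof -
  note bg = bilinear_simps[OF inner_formD(1)[OF g]]
  note pos = inner_formD(3)[OF g] and symg = inner_formD(2)[OF g]
  have sym: "G x e2 e1 = 0" using symg e(4) by metis
  define f where "f u w = G x u w / (sqrt (G x u u) * sqrt (G x w w))" for u w
  have X0: "X \<noteq> 0" using X by (auto simp: bg)
  have e10: "e1 \<noteq> 0" "e1 \<in> \<sigma>" "e2 \<in> \<sigma>" using e by (auto simp: bg intro: span_base)
  have sub: "subspace \<sigma>" using e(1) subspace_span by blast
  have P0: "P \<ge> 0" by (simp add: P_def)
  have f1: "\<bar>f u w\<bar> \<le> 1" if "u \<noteq> 0" "w \<noteq> 0" for u w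
  proof -
    have "\<bar>G x u w\<bar> \<le> sqrt (G x u u * G x w w)"
      using inner_form_Cauchy_Schwarz[OF g, of u w] real_le_rsqrt by (simp add: real_le_rsqrt)
    then show ?thesis using pos[OF that(1)] pos[OF that(2)]
      by (simp add: f_def abs_divide real_sqrt_mult)
  qed
  have le: "f u w \<le> sqrt P" if uw: "u \<in> \<sigma>" "u \<noteq> 0" "w \<in> span {X}" "w \<noteq> 0" for u w
  proof -
    have "u \<in> span {e1, e2}" using uw(1) e(1) by simp
    then obtain a b where u: "u = a *\<^sub>R e1 + b *\<^sub>R e2" by (rule span_pair_obtain)
    obtain s where w: "w = s *\<^sub>R X" using uw(3) by (auto simp: span_singleton)
    have s: "s \<noteq> 0" using uw(4) w by auto
    have uu: "G x u u = a\<^sup>2 + b\<^sup>2" by (simp add: u bg e sym power2_eq_square)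
    have uX: "G x u X = a * G x X e1 + b * G x X e2"
      by (simp add: u bg symg[of e1 X] symg[of e2 X])
    have "(G x u X)\<^sup>2 \<le> (a\<^sup>2 + b\<^sup>2) * P"
    proof -
      have "(a\<^sup>2 + b\<^sup>2) * P - (G x u X)\<^sup>2 = (a * G x X e2 - b * G x X e1)\<^sup>2"
        unfolding uX P_def by algebra
      then show ?thesis by (metis diff_ge_0_iff_ge zero_le_power2)
    qed
    then have "\<bar>G x u X\<bar> \<le> sqrt (G x u u) * sqrt P"
      unfolding uu by (metis real_sqrt_abs real_sqrt_le_iff real_sqrt_mult)
    moreover have "f u w = sgn s * G x u X / sqrt (G x u u)"
      using s X by (simp add: f_def w bg real_sqrt_mult sgn_if)
    moreover have "\<bar>sgn s * G x u X\<bar> = \<bar>G x u X\<bar>" using s by (simp add: abs_mult abs_sgn_eq)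
    ultimately show ?thesis using pos[OF uw(2)]
      by (smt (verit, best) mult.commute pos_divide_le_eq real_sqrt_gt_0_iff)
  qed
  \<comment> \<open>The best vector is the projection of \<open>X\<close>. If that is zero, the line
    is orthogonal to the plane and \<open>e1\<close> already attains the cosine 0.\<close>
  obtain u where u: "u \<in> \<sigma>" "u \<noteq> 0" "f u X = sqrt P"
  proof (cases "P = 0")
    case True
    then have "G x X e1 = 0" by (simp add: P_def sum_power2_eq_zero_iff)
    then have "f e1 X = sqrt P" using True symg[of e1 X] by (simp add: f_def)
    then show ?thesis using that e10 by blast
  next
    case False
    define u where "u = G x X e1 *\<^sub>R e1 + G x X e2 *\<^sub>R e2"
    have uu: "G x u u = P" by (simp add: u_def bg e sym P_def power2_eq_square)
    have "G x u X = P" by (simp add: u_def bg symg[of e1 X] symg[of e2 X] P_def power2_eq_square)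
    then have "f u X = sqrt P" using P0 X by (simp add: f_def uu real_div_sqrt)
    moreover have "u \<noteq> 0" using uu False by (auto simp: bg)
    moreover have "u \<in> \<sigma>" unfolding u_def by (intro subspace_add subspace_scale sub e10)
    ultimately show ?thesis using that by blast
  qed
  have P1: "sqrt P \<le> 1" using f1[OF u(2) X0] unfolding u(3) by linarith
  then show "P \<le> 1" by simp
  show "plane_line_angle G x \<sigma> (span {X}) = arccos (sqrt P)"
    unfolding plane_line_angle_def f_def[symmetric]
  proof (rule cInf_eq_minimum)
    show "arccos (sqrt P) \<in> {arccos (f u w) |u w. u \<in> \<sigma> \<and> u \<noteq> 0 \<and> w \<in> span {X} \<and> w \<noteq> 0}"
      using u X0 span_base[of X "{X}"] by force
    show "arccos (sqrt P) \<le> a" if "a \<in> {arccos (f u w) |u w. u \<in> \<sigma> \<and> u \<noteq> 0 \<and> w \<in> span {X} \<and> w \<noteq> 0}" for a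
      using that le f1 P1 by (force intro!: arccos_le_arccos)
  qed
qed

text \<open>Equal angles give equal projections of \<open>X\<close>, since \<open>arccos\<close> is
  injective on the cosines. The alternative \<open>l * r = 0\<close>, where the angle drops out of
  the curvature, serves to exclude \<open>r = 0\<close> at a non-isotropic point.\<close>

lemma sec_curvature_eq_of_angle_eq:
  fixes G :: "'e::euclidean_space local_metric"
  assumes g: "inner_form (G x)"
    and R: "\<And>u v. G x (riemann G x u v v) u = c * disc (G x) u v + disc h u v"
    and q: "quasi_umbilical (G x) h l r X"
    and \<sigma>: "two_plane \<sigma>1" "two_plane \<sigma>2"
    and eq: "l * r = 0 \<or> plane_line_angle G x \<sigma>1 (span {X}) = plane_line_angle G x \<sigma>2 (span {X})"
  shows "sec_curvature G x \<sigma>1 = sec_curvature G x \<sigma>2"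
proof -
  have X: "G x X X = 1" using q by (simp add: quasi_umbilical_def)
  obtain a b where ab: "span {a, b} = \<sigma>1" "G x a a = 1" "G x b b = 1" "G x a b = 0"
    using ex_orthonormal_pair[OF g \<sigma>(1)] .
  obtain a' b' where ab': "span {a', b'} = \<sigma>2" "G x a' a' = 1" "G x b' b' = 1" "G x a' b' = 0"
    using ex_orthonormal_pair[OF g \<sigma>(2)] .
  note P = plane_line_angle_orthonormal[where G = G and x = x, OF g X ab] and P' = plane_line_angle_orthonormal[where G = G and x = x, OF g X ab']
  have "l * r = 0 \<or> sqrt ((G x X a)\<^sup>2 + (G x X b)\<^sup>2) = sqrt ((G x X a')\<^sup>2 + (G x X b')\<^sup>2)"
    using eq P P' by (smt (verit) arccos_eq_iff real_sqrt_ge_zero real_sqrt_le_1_iff zero_le_power2)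
  then show ?thesis
    unfolding sec_curvature_orthonormal[where G = G and x = x, OF g R q ab] sec_curvature_orthonormal[where G = G and x = x, OF g R q ab'] by auto
qed

section \<open>Smoothness of the distinguished direction\<close>

lemma open_nonzero_smooth:
  fixes f :: "'e::euclidean_space \<Rightarrow> 'f::real_normed_vector"
  assumes "open S" "smooth_on f S"
  shows "open {x \<in> S. f x \<noteq> 0}"
proof -
  have "open (S \<inter> f -` (- {0}))"
    by (rule continuous_open_preimage[OF smooth_on_continuous[OF assms(2)] assms(1)]) auto
  moreover have "S \<inter> f -` (- {0}) = {x \<in> S. f x \<noteq> 0}" by auto
  ultimately show ?thesis by simp
qed

text \<open>The eigenvalue of multiplicity \<open>n - 1\<close> is the quotient of two smooth functions: the
  \<open>2 \<times> 2\<close> minors of \<open>H - l G\<close> vanish, and on the vectors \<open>a\<close>, \<open>b\<close>, \<open>c\<close> chosen below the minor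
  of \<open>G\<close> is zero, so that the equation for \<open>l\<close> becomes linear.\<close>

lemma smooth_quasi_umbilical_direction:
  fixes G H :: "'e::euclidean_space \<Rightarrow> 'e \<Rightarrow> 'e \<Rightarrow> real"
  assumes S: "open S" "p \<in> S" and dim: "DIM('e) \<ge> 3"
    and G: "\<And>u v. smooth_on (\<lambda>x. G x u v) S" "\<And>x. x \<in> S \<Longrightarrow> inner_form (G x)"
    and H: "\<And>u v. smooth_on (\<lambda>x. H x u v) S" "\<And>x. x \<in> S \<Longrightarrow> bilinear (H x)"
    and q: "\<And>x. x \<in> S \<Longrightarrow> \<exists>l r Y. quasi_umbilical (G x) (H x) l r Y"
    and qp: "quasi_umbilical (G p) (H p) lp rp Xp" "rp \<noteq> 0"
  obtains N X where "open N" "p \<in> N" "N \<subseteq> S" "smooth_on X N" "\<And>x. x \<in> N \<Longrightarrow> X x \<noteq> 0"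
    "\<And>x l r Y. x \<in> N \<Longrightarrow> quasi_umbilical (G x) (H x) l r Y \<Longrightarrow> \<exists>s. s \<noteq> 0 \<and> X x = s *\<^sub>R Y"
proof -
  have bG: "bilinear (G x)" if "x \<in> S" for x using inner_formD(1)[OF G(2)[OF that]] .
  note lG = bilinear_simps[OF bG] and lH = bilinear_simps[OF H(2)]
  have symG: "G x u v = G x v u" if "x \<in> S" for x u v using inner_formD(2)[OF G(2)[OF that]] .
  have Xp: "G p Xp Xp = 1" "H p u v = lp * G p u v + rp * (G p Xp u * G p Xp v)" for u v
    using qp(1) by (auto simp: quasi_umbilical_def)
  have "card {Xp} < DIM('e)" using dim by simp
  then obtain w where "G p w w = 1" "\<And>y. y \<in> {Xp} \<Longrightarrow> G p y w = 0"
    using ex_orthogonal_unit[OF G(2)[OF S(2)], of "{Xp}"] by (metis finite.emptyI finite.insertI)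
  then have w: "G p w w = 1" "G p Xp w = 0" by auto
  have "card {Xp, w} < DIM('e)" using dim by (auto simp: card_insert_if)
  then obtain c where "G p c c = 1" "\<And>y. y \<in> {Xp, w} \<Longrightarrow> G p y c = 0"
    using ex_orthogonal_unit[OF G(2)[OF S(2)], of "{Xp, w}"] by (metis finite.emptyI finite.insertI)
  then have c: "G p c c = 1" "G p Xp c = 0" "G p w c = 0" by auto
  \<comment> \<open>Both have product 1 with \<open>Xp\<close>, while \<open>a\<close>,
    \<open>b0\<close>, \<open>c\<close> are mutually orthogonal at \<open>p\<close>: there the mixed
    minor of \<open>G\<close> vanishes, but the rank-one part of \<open>H\<close> is seen.\<close>
  define a b0 where "a = Xp + w" and "b0 = Xp - w"
  have Gp: "G p a a = 2" "G p a c = 0" "G p b0 c = 0" "G p a b0 = 0" "G p Xp a = 1" "G p Xp b0 = 1"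
    using Xp(1) w c symG[OF S(2), of w Xp] by (simp_all add: a_def b0_def lG S(2))
  define \<Delta> where "\<Delta> x = G x a a * G x c c - G x a c * G x a c" for x
  define S1 where "S1 = {x \<in> S. \<Delta> x \<noteq> 0}"
  have sm: "smooth_on (\<lambda>x. f x * g x) U" "smooth_on (\<lambda>x. f x + g x) U" "smooth_on (\<lambda>x. f x - g x) U"
    if "open U" "smooth_on f U" "smooth_on g U" for f g :: "'e \<Rightarrow> real" and U
    using that by (auto intro: smooth_on_mult smooth_on_add smooth_on_diff)
  have s\<Delta>: "smooth_on \<Delta> S" unfolding \<Delta>_def by (intro sm S G)
  have S1: "open S1" "p \<in> S1" "S1 \<subseteq> S"
    using open_nonzero_smooth[OF S(1) s\<Delta>] S(2) c(1) Gp by (auto simp: S1_def \<Delta>_def)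
  have G1: "smooth_on (\<lambda>x. G x u v) S1" and H1: "smooth_on (\<lambda>x. H x u v) S1" for u v
    using smooth_on_subset G(1) H(1) S1(3) by blast+
  \<comment> \<open>The multiple of \<open>a\<close> to be added to \<open>b0\<close> so that the
    minor of \<open>G\<close> with rows \<open>a\<close>, \<open>c\<close> and columns
    \<open>b\<close>, \<open>c\<close> stays zero near \<open>p\<close>; \<open>\<Delta>\<close> is
    the coefficient of this multiple in the minor.\<close>
  define \<tau> where "\<tau> x = (G x a c * G x b0 c - G x a b0 * G x c c) / \<Delta> x" for x
  have s\<tau>: "smooth_on \<tau> S1"
    unfolding \<tau>_def
    by (rule smooth_on_divide[OF S1(1) _ sm(3)[OF S1(1) sm(1)[OF S1(1) G1 G1] sm(1)[OF S1(1) G1 G1]]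
          smooth_on_subset[OF s\<Delta> S1(3)]]) (simp add: S1_def)
  define b where "b x = b0 + \<tau> x *\<^sub>R a" for x
  have sb: "smooth_on b S1" unfolding b_def
    by (rule smooth_on_add[OF S1(1) smooth_on_const smooth_on_scaleR[OF S1(1) s\<tau> smooth_on_const]])
  have bp: "b p = b0" using Gp by (simp add: b_def \<tau>_def)
  have minor0: "G x a (b x) * G x c c - G x a c * G x c (b x) = 0" if "x \<in> S1" for x
  proof -
    have x: "x \<in> S" "\<Delta> x \<noteq> 0" using that by (auto simp: S1_def)
    have "\<tau> x * \<Delta> x = G x a c * G x b0 c - G x a b0 * G x c c" using x(2) by (simp add: \<tau>_def)
    then show ?thesis
      using symG[OF x(1), of c a] symG[OF x(1), of c b0]
      by (simp add: b_def lG[OF x(1)] \<Delta>_def algebra_simps)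
  qed
  define HH where "HH x = H x a (b x) * H x c c - H x a c * H x c (b x)" for x
  \<comment> \<open>The vanishing minor of \<open>H - l G\<close> expands to
    \<open>HH - l HG\<close> plus \<open>l^2\<close> times the minor of \<open>G\<close>, which is
    zero by the choice of \<open>b\<close>. Hence \<open>l = HH / HG\<close>.\<close>
  define HG where "HG x = H x a (b x) * G x c c + H x c c * G x a (b x) - (H x a c * G x c (b x) + H x c (b x) * G x a c)" for x
  have sGb: "smooth_on (\<lambda>x. G x u (b x)) S1" for u
    by (rule smooth_on_bilinear_apply[OF S1(1) G1 _ smooth_on_const sb]) (use bG S1(3) in auto)
  have sHb: "smooth_on (\<lambda>x. H x u (b x)) S1" for u
    by (rule smooth_on_bilinear_apply[OF S1(1) H1 _ smooth_on_const sb]) (use H(2) S1(3) in auto)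
  have sHH: "smooth_on HH S1" unfolding HH_def by (intro sm S1 sHb H1)
  have sHG: "smooth_on HG S1" unfolding HG_def by (intro sm S1 sHb H1 sGb G1)
  define S2 where "S2 = {x \<in> S1. HG x \<noteq> 0}"
  have "HG p = rp"
    using Gp c Xp symG[OF S(2), of c b0] by (simp add: HG_def bp)
  then have S2: "open S2" "p \<in> S2" "S2 \<subseteq> S1"
    using open_nonzero_smooth[OF S1(1) sHG] S1(2) qp(2) by (auto simp: S2_def)
  define l where "l x = HH x / HG x" for x
  have sl: "smooth_on l S2"
    unfolding l_def
    by (rule smooth_on_divide[OF S2(1) _ smooth_on_subset[OF sHH S2(3)] smooth_on_subset[OF sHG S2(3)]])
      (simp add: S2_def)
  have leq: "l' = l x" "r \<noteq> 0" if x: "x \<in> S2" and qx: "quasi_umbilical (G x) (H x) l' r Y" for x l' r Y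
  proof -
    have xs: "x \<in> S1" "HG x \<noteq> 0" using x by (auto simp: S2_def)
    have h: "H x u v = l' * G x u v + r * (G x Y u * G x Y v)" for u v
      using qx by (simp add: quasi_umbilical_def)
    have m: "G x a (b x) * G x c c = G x a c * G x c (b x)" using minor0[OF xs(1)] by simp
    have "HH x = l' * HG x"
      using m unfolding HH_def HG_def h by algebra
    then show "l' = l x" using xs(2) by (simp add: l_def)
    show "r \<noteq> 0"
    proof
      assume "r = 0"
      then have "HG x = 0" using m unfolding HG_def h by algebra
      then show False using xs(2) by simp
    qed
  qed
  \<comment> \<open>The row of \<open>a\<close> in the rank-one form \<open>H - l G\<close>. It is
    \<open>r * G x Y a\<close> times the one-form \<open>G x Y\<close>, so its metric dual is a
    multiple of \<open>Y\<close>.\<close>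
  define \<alpha> where "\<alpha> x v = H x a v - l x * G x a v" for x v
  have S2S: "S2 \<subseteq> S" using S2(3) S1(3) by auto
  have G2: "smooth_on (\<lambda>x. G x u v) S2" and H2: "smooth_on (\<lambda>x. H x u v) S2" for u v
    using smooth_on_subset G(1) H(1) S2S by blast+
  have s\<alpha>: "smooth_on (\<lambda>x. \<alpha> x v) S2" for v
    unfolding \<alpha>_def by (intro sm S2 sl G2 H2)
  have l\<alpha>: "linear (\<alpha> x)" if "x \<in> S2" for x
    using that S2S by (auto intro!: linearI simp: \<alpha>_def lG lH subset_iff algebra_simps)
  have G2': "inner_form (G x)" if "x \<in> S2" for x using that S2S G(2) by auto
  obtain X where X: "smooth_on X S2" "\<And>x z. x \<in> S2 \<Longrightarrow> G x (X x) z = \<alpha> x z"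
    using smooth_raise[OF S2(1) G2 G2' s\<alpha> l\<alpha>] by blast
  have Xeq: "X x = (r * G x Y a) *\<^sub>R Y" if "x \<in> S2" "quasi_umbilical (G x) (H x) l' r Y" for x l' r Y
  proof (rule inner_form_eqI[OF G2'[OF that(1)]])
    fix z
    have xS: "x \<in> S" using that S2S by auto
    have "H x a z = l' * G x a z + r * (G x Y a * G x Y z)" using that(2) by (simp add: quasi_umbilical_def)
    then show "G x (X x) z = G x ((r * G x Y a) *\<^sub>R Y) z"
      using leq(1)[OF that] X(2)[OF that(1)] by (simp add: \<alpha>_def lG[OF xS])
  qed
  define N where "N = {x \<in> S2. X x \<noteq> 0}"
  have Xp0: "Xp \<noteq> 0" using Xp(1) by (auto simp: lG S(2))
  have N: "open N" "p \<in> N" "N \<subseteq> S2"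
    using open_nonzero_smooth[OF S2(1) X(1)] S2(2) Xeq[OF S2(2) qp(1)] Gp(5) qp(2) Xp0
    by (auto simp: N_def)
  show ?thesis
  proof (rule that[OF N(1,2) _ smooth_on_subset[OF X(1) N(3)]])
    show "N \<subseteq> S" using N S2S by auto
    show "X x \<noteq> 0" if "x \<in> N" for x using that by (simp add: N_def)
    show "\<exists>s. s \<noteq> 0 \<and> X x = s *\<^sub>R Y"
      if "x \<in> N" "quasi_umbilical (G x) (H x) l r Y" for x l r Y
      using Xeq[OF _ that(2)] that(1) by (auto simp: N_def)
  qed
qed

section \<open>Lifting to the light cone\<close>

text \<open>A Lorentzian form in two null coordinates, normalised so that the vectors
  \<open>(y, 1, y \<bullet> y)\<close> are null and two of them have as product minus half of their
  squared Euclidean distance.\<close>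

definition lc :: "'h::real_inner \<times> real \<times> real \<Rightarrow> 'h \<times> real \<times> real \<Rightarrow> real" where
  "lc x y = fst x \<bullet> fst y - (fst (snd x) * snd (snd y) + snd (snd x) * fst (snd y)) / 2"

lemma lc_Pair: "lc (y, a, b) (y', a', b') = y \<bullet> y' - (a * b' + b * a') / 2"
  by (simp add: lc_def)

lemma lc_bilinear: "bilinear lc"
  unfolding bilinear_def
  by (auto intro!: linearI simp: lc_def inner_add_left inner_add_right algebra_simps add_divide_distrib)

lemma lc_sym: "lc x y = lc y x"
  by (simp add: lc_def inner_commute algebra_simps)

lemmas lc_simps = bilinear_simps[OF lc_bilinear]

abbreviation lc_lift :: "'h::real_inner \<Rightarrow> 'h \<times> real \<times> real" where
  "lc_lift y \<equiv> (y, 1, y \<bullet> y)"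

lemma smooth_on_Pair:
  assumes "open S" "smooth_on f S" "smooth_on g S"
  shows "smooth_on (\<lambda>x. (f x, g x)) S"
proof -
  have "smooth_on (\<lambda>x. (f x, 0) + (0, g x)) S"
    by (rule smooth_on_add[OF assms(1) smooth_on_bounded_linear[OF _ assms(1,2)] smooth_on_bounded_linear[OF _ assms(1,3)]])
      (auto intro: bounded_linear_Pair bounded_linear_ident bounded_linear_zero)
  then show ?thesis by simp
qed

text \<open>The metric \<open>\<phi> |d\<Phi>|\<^sup>2\<close> is induced by the map \<open>sqrt \<phi> (\<Phi>, 1, |\<Phi>|\<^sup>2)\<close> into the light cone.\<close>

locale lightcone_immersion =
  fixes S :: "'e::euclidean_space set" and \<Phi> :: "'e \<Rightarrow> 'h::euclidean_space"
    and \<phi> :: "'e \<Rightarrow> real" and G :: "'e local_metric"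
  assumes S: "open S" and \<Phi>: "smooth_on \<Phi> S" and \<phi>: "smooth_on \<phi> S" "\<And>x. x \<in> S \<Longrightarrow> \<phi> x > 0"
    and conf: "\<And>x u v. x \<in> S \<Longrightarrow> G x u v = \<phi> x * (dird u \<Phi> x \<bullet> dird v \<Phi> x)"
    and pos: "\<And>x u. x \<in> S \<Longrightarrow> u \<noteq> 0 \<Longrightarrow> G x u u > 0"
begin

definition F :: "'e \<Rightarrow> 'h \<times> real \<times> real" where
  "F x = sqrt (\<phi> x) *\<^sub>R lc_lift (\<Phi> x)"

lemma smooth_sqrt: "smooth_on (\<lambda>x. sqrt (\<phi> x)) S"
  by (rule smooth_on_sqrt[OF S \<phi>(2,1)])

lemma F_smooth: "smooth_on F S"
proof -
  have "smooth_on (\<lambda>x. sqrt (\<phi> x) *\<^sub>R lc_lift (\<Phi> x)) S"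
    by (rule smooth_on_scaleR[OF S smooth_sqrt smooth_on_Pair[OF S \<Phi> smooth_on_Pair[OF S smooth_on_const
              smooth_on_inner[OF S \<Phi> \<Phi>]]]])
  then show ?thesis by (simp add: F_def[abs_def])
qed

lemma dird_F:
  assumes x: "x \<in> S"
  shows "dird v F x = sqrt (\<phi> x) *\<^sub>R (dird v \<Phi> x, 0, 2 * (\<Phi> x \<bullet> dird v \<Phi> x)) + dird v (\<lambda>x. sqrt (\<phi> x)) x *\<^sub>R lc_lift (\<Phi> x)"
proof -
  note d\<Phi> = smooth_on_has_derivative[OF \<Phi> x] and ds = smooth_on_has_derivative[OF smooth_sqrt x]
  have "(F has_derivative (\<lambda>v. sqrt (\<phi> x) *\<^sub>R (dird v \<Phi> x, 0, \<Phi> x \<bullet> dird v \<Phi> x + dird v \<Phi> x \<bullet> \<Phi> x)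
      + dird v (\<lambda>x. sqrt (\<phi> x)) x *\<^sub>R lc_lift (\<Phi> x))) (at x)"
    unfolding F_def[abs_def]
    by (intro has_derivative_scaleR has_derivative_Pair has_derivative_const has_derivative_inner d\<Phi> ds)
  from dird_eq[OF this] show ?thesis by (simp add: inner_commute)
qed

lemma lc_lift_null: "lc (lc_lift y) (lc_lift y) = 0"
  by (simp add: lc_Pair)

lemma lc_lift_tangent: "lc (lc_lift y) (t, 0, 2 * (y \<bullet> t)) = 0"
  by (simp add: lc_Pair)

lemma lc_F_F: "lc (F x) (F x) = 0"
  by (simp add: F_def lc_simps lc_lift_null del: scaleR_Pair)

lemma lc_F_dird: "x \<in> S \<Longrightarrow> lc (F x) (dird v F x) = 0"
  by (simp add: dird_F F_def lc_simps lc_lift_null lc_lift_tangent del: scaleR_Pair)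

lemma sqrt_\<phi>: "x \<in> S \<Longrightarrow> sqrt (\<phi> x) > 0" "x \<in> S \<Longrightarrow> sqrt (\<phi> x) * sqrt (\<phi> x) = \<phi> x"
  using \<phi>(2)[of x] by auto

text \<open>The derivative of \<open>sqrt \<phi>\<close> contributes only multiples of the null
  vector \<open>lc_lift (\<Phi> x)\<close>, which is orthogonal to itself and to the derivatives of
  the lift. The factor thus rescales the metric without further terms.\<close>

lemma lc_dird_dird: "x \<in> S \<Longrightarrow> G x u v = lc (dird u F x) (dird v F x)"
proof -
  assume x: "x \<in> S"
  have "lc (dird u F x) (dird v F x) = (sqrt (\<phi> x) * sqrt (\<phi> x)) * lc (dird u \<Phi> x, 0, 2 * (\<Phi> x \<bullet> dird u \<Phi> x)) (dird v \<Phi> x, 0, 2 * (\<Phi> x \<bullet> dird v \<Phi> x))"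
    using lc_sym[of "(dird u \<Phi> x, 0, 2 * (\<Phi> x \<bullet> dird u \<Phi> x))"]
    by (simp add: dird_F[OF x] lc_simps lc_lift_null lc_lift_tangent del: scaleR_Pair)
  then show ?thesis using \<phi>(2)[OF x] by (simp add: conf[OF x] lc_Pair)
qed

sublocale flat_immersion S F lc G
  by unfold_locales (use S F_smooth lc_bilinear lc_sym lc_dird_dird pos in auto)

text \<open>Differentiate the orthogonality of \<open>F\<close> and \<open>dird v F\<close>: the
  position vector is itself a normal field, whose second fundamental form is minus the
  metric.\<close>

lemma lc_F_II:
  assumes x: "x \<in> S"
  shows "lc (F x) (II x u v) = - G x u v"
proof -
  have "dird u (\<lambda>x. lc (F x) (dird v F x)) x = dird u (\<lambda>x. 0) x"
    by (rule dird_cong[OF S x smooth_B[OF F_smooth smooth_on_dird[OF F_smooth]] lc_F_dird])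
  then have "lc (F x) (dird u (dird v F) x) + lc (dird u F x) (dird v F x) = 0"
    using dird_bilinear[OF bbB F_smooth smooth_on_dird[OF F_smooth] x] by simp
  then show ?thesis using x by (simp add: II_def lc_simps lc_F_dird lc_dird_dird)
qed

lemma inj_dird: "x \<in> S \<Longrightarrow> inj (\<lambda>v. dird v \<Phi> x)"
proof -
  assume x: "x \<in> S"
  have lin: "linear (\<lambda>v. dird v \<Phi> x)" using smooth_on_linear[OF \<Phi> x] .
  have "u = 0" if "dird u \<Phi> x = 0" for u
    using pos[OF x, of u] conf[OF x, of u u] that by (cases "u = 0") auto
  then show ?thesis using linear_injective_0[OF lin] by blast
qed

text \<open>A vector normal to both the position and the tangent space is a multiple of the lift
  plus a term from a Euclidean normal of \<open>\<Phi>\<close>; its last coordinate is determined by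
  the other two.\<close>

lemma normal_tangent:
  assumes x: "x \<in> S" and w: "lc (y, a, b) (F x) = 0" "lc (y, a, b) (dird z F x) = 0"
  shows "(y - a *\<^sub>R \<Phi> x) \<bullet> dird z \<Phi> x = 0" "b = 2 * (y \<bullet> \<Phi> x) - a * (\<Phi> x \<bullet> \<Phi> x)"
proof -
  have 1: "lc (y, a, b) (lc_lift (\<Phi> x)) = 0"
    using w(1) sqrt_\<phi>(1)[OF x] by (simp add: F_def lc_simps del: scaleR_Pair)
  then have "lc (y, a, b) (dird z \<Phi> x, 0, 2 * (\<Phi> x \<bullet> dird z \<Phi> x)) = 0"
    using w(2) sqrt_\<phi>(1)[OF x] by (simp add: dird_F[OF x] lc_simps del: scaleR_Pair)
  then show "(y - a *\<^sub>R \<Phi> x) \<bullet> dird z \<Phi> x = 0" by (simp add: lc_Pair inner_diff_left)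
  show "b = 2 * (y \<bullet> \<Phi> x) - a * (\<Phi> x \<bullet> \<Phi> x)" using 1 by (simp add: lc_Pair)
qed

end

text \<open>In codimension zero the normal bundle is a Lorentzian plane containing \<open>F\<close>, so that all
  values of \<open>II\<close> on unit vectors are congruent modulo \<open>F\<close>.\<close>

lemma (in lightcone_immersion) conformally_flat_curvature:
  assumes dim: "DIM('h) = DIM('e)" and x: "x \<in> S"
    and unit: "G x u v = 0" "G x u w = 0" "G x u z = 0" "G x v w = 0" "G x v z = 0" "G x w z = 0"
    "G x u u = 1" "G x v v = 1" "G x w w = 1" "G x z z = 1"
  shows "G x (riemann G x u v v) u + G x (riemann G x w z z) w =
    G x (riemann G x u w w) u + G x (riemann G x v z z) v"
proof -
  have lin: "linear (\<lambda>v. dird v \<Phi> x)" using smooth_on_linear[OF \<Phi> x] .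
  have "dim (range (\<lambda>v. dird v \<Phi> x)) = DIM('h)"
    using dim_image_eq[OF lin, of UNIV] inj_dird[OF x] dim by simp
  then have "span (range (\<lambda>v. dird v \<Phi> x)) = UNIV"
    by (simp add: dim_eq_full)
  then have surj: "range (\<lambda>v. dird v \<Phi> x) = UNIV"
    using linear_subspace_image[OF lin subspace_UNIV] by (simp add: span_eq_iff[THEN iffD2])
  \<comment> \<open>The differential of \<open>\<Phi>\<close> is onto, so
    \<open>y - a *\<^sub>R \<Phi> x\<close> is orthogonal to itself and only the multiple of the
    lift survives.\<close>
  have mult: "\<exists>c. n = c *\<^sub>R F x" if n: "lc n (F x) = 0" "\<And>z. lc n (dird z F x) = 0" for n
  proof -
    obtain y a b where nn: "n = (y, a, b)" by (metis prod_cases3)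
    note nt = normal_tangent[OF x n[unfolded nn]]
    obtain t where "dird t \<Phi> x = y - a *\<^sub>R \<Phi> x" using surj by (metis surjD)
    then have "y - a *\<^sub>R \<Phi> x = 0" using nt(1)[of t] by simp
    then have y: "y = a *\<^sub>R \<Phi> x" by simp
    then have "n = (a / sqrt (\<phi> x)) *\<^sub>R F x"
      using nn nt(2) sqrt_\<phi>(1)[OF x] by (simp add: F_def)
    then show ?thesis by blast
  qed
  define \<eta> where "\<eta> = II x u u"
  have off: "lc (II x a b) (II x a b) = 0" if "G x a b = 0" for a b
  proof -
    have "\<exists>c. II x a b = c *\<^sub>R F x"
      by (rule mult) (use lc_F_II[OF x, of a b] that lc_sym[of "F x" "II x a b"] II_normal[OF x] in auto)
    then show ?thesis by (auto simp: lc_simps lc_F_F)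
  qed
  have diag: "\<exists>c. II x a a = \<eta> + c *\<^sub>R F x" if "G x a a = 1" for a
  proof -
    have "lc (F x) (II x a a - \<eta>) = 0"
      using lc_F_II[OF x, of a a] lc_F_II[OF x, of u u] that unit by (simp add: \<eta>_def lc_simps)
    then have "lc (II x a a - \<eta>) (F x) = 0" using lc_sym by metis
    then have "\<exists>c. II x a a - \<eta> = c *\<^sub>R F x"
      by (rule mult) (simp add: \<eta>_def lc_simps II_normal[OF x])
    then show ?thesis by (metis add.commute diff_add_cancel)
  qed
  obtain cu cv cw cz where c: "II x u u = \<eta> + cu *\<^sub>R F x" "II x v v = \<eta> + cv *\<^sub>R F x"
    "II x w w = \<eta> + cw *\<^sub>R F x" "II x z z = \<eta> + cz *\<^sub>R F x"
    using diag unit by meson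
  have F\<eta>: "lc (F x) \<eta> = -1" "lc \<eta> (F x) = -1"
    using lc_F_II[OF x, of u u] unit lc_sym[of \<eta>] by (simp_all add: \<eta>_def)
  \<comment> \<open>The curvature is a constant minus one number for each of the two vectors, so
    either side of the claim contains each of the four numbers exactly once.\<close>
  have K: "G x (riemann G x a b b) a = lc \<eta> \<eta> - ca - cb"
    if "G x a b = 0" "II x a a = \<eta> + ca *\<^sub>R F x" "II x b b = \<eta> + cb *\<^sub>R F x" for a b ca cb
    using off[OF that(1)] II_sym[OF x, of b a]
    by (simp add: gauss_equation[OF x] that(2,3) lc_simps F\<eta> lc_F_F)
  show ?thesis
    using K[OF unit(1) c(1,2)] K[OF unit(6) c(3,4)] K[OF unit(2) c(1,3)] K[OF unit(5) c(2,4)] by simp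
qed

text \<open>In the light cone the hyperbolic space is the slice \<open>lc _ q = 1\<close>, where \<open>lc q q = \<kappa>\<close>.\<close>

locale hyperbolic_hypersurface =
  lightcone_immersion S \<Phi> "\<lambda>x. 1 / (1 - \<kappa> * (norm (\<Phi> x))\<^sup>2 / 4)\<^sup>2" G
  for S :: "'e::euclidean_space set" and \<Phi> :: "'e \<Rightarrow> 'h::euclidean_space" and \<kappa> G +
  assumes ball: "\<And>x. x \<in> S \<Longrightarrow> \<kappa> * (norm (\<Phi> x))\<^sup>2 < 4" and codim: "DIM('h) = DIM('e) + 1"
begin

text \<open>Its product with \<open>lc_lift y\<close> is \<open>1 - \<kappa> |y|^2 / 4\<close>, the
  number by which the lift is divided in \<open>F\<close>; this is what places \<open>F\<close> in
  the slice. For \<open>\<kappa> = 0\<close> the vector is null.\<close>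

definition q :: "'h \<times> real \<times> real" where
  "q = (0, \<kappa> / 2, - 2)"

text \<open>The second fundamental form in the hyperbolic space. \<open>II\<close> also has
  components in the plane of \<open>F\<close> and \<open>q\<close>, which is normal to that space;
  the coefficients that remove them are forced by \<open>lc_F_II\<close>, \<open>lc_II_q\<close>,
  \<open>lc_F_q\<close>, \<open>lc_F_F\<close> and \<open>lc_q_q\<close>.\<close>

definition N :: "'e \<Rightarrow> 'e \<Rightarrow> 'e \<Rightarrow> 'h \<times> real \<times> real" where
  "N x u v = II x u v - (\<kappa> * G x u v) *\<^sub>R F x + G x u v *\<^sub>R q"

lemma D_pos: "x \<in> S \<Longrightarrow> 1 - \<kappa> * (\<Phi> x \<bullet> \<Phi> x) / 4 > 0"
  using ball[of x] by (simp add: power2_norm_eq_inner)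

lemma lc_F_q: "x \<in> S \<Longrightarrow> lc (F x) q = 1"
proof -
  assume x: "x \<in> S"
  define D where "D = 1 - \<kappa> * (norm (\<Phi> x))\<^sup>2 / 4"
  have D: "D > 0" using ball[OF x] by (simp add: D_def)
  have "F x = sqrt (1 / D\<^sup>2) *\<^sub>R lc_lift (\<Phi> x)" unfolding F_def D_def ..
  also have "sqrt (1 / D\<^sup>2) = 1 / D" using D by (simp add: real_sqrt_divide)
  finally have F: "F x = (1 / D) *\<^sub>R lc_lift (\<Phi> x)" .
  have "lc (lc_lift (\<Phi> x)) q = D" by (simp add: q_def lc_Pair D_def power2_norm_eq_inner field_simps)
  then show ?thesis using D unfolding F by (simp add: lc_simps del: scaleR_Pair)
qed

lemma lc_q_q: "lc q q = \<kappa>"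
  by (simp add: q_def lc_Pair)

lemma lc_dird_q: "x \<in> S \<Longrightarrow> lc (dird v F x) q = 0"
proof -
  assume x: "x \<in> S"
  have "dird v (\<lambda>x. lc (F x) q) x = dird v (\<lambda>x. 1) x"
    by (rule dird_cong[OF S x smooth_B[OF F_smooth smooth_on_const] lc_F_q])
  then show ?thesis
    using dird_bilinear[OF bbB F_smooth smooth_on_const x] by (simp add: lc_simps)
qed

lemma lc_II_q: "x \<in> S \<Longrightarrow> lc (II x u v) q = 0"
proof -
  assume x: "x \<in> S"
  have "dird u (\<lambda>x. lc (dird v F x) q) x = dird u (\<lambda>x. 0) x"
    by (rule dird_cong[OF S x smooth_B[OF smooth_on_dird[OF F_smooth] smooth_on_const] lc_dird_q])
  then have "lc (dird u (dird v F) x) q = 0"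
    using dird_bilinear[OF bbB smooth_on_dird[OF F_smooth] smooth_on_const x] by (simp add: lc_simps)
  then show ?thesis using x by (simp add: II_def lc_simps lc_dird_q)
qed

lemma N_normal:
  assumes x: "x \<in> S"
  shows "lc (N x u v) (F x) = 0" "lc (N x u v) q = 0" "lc (N x u v) (dird z F x) = 0"
  using lc_F_II[OF x, of u v] lc_F_F[of x] lc_F_q[OF x] lc_q_q lc_II_q[OF x, of u v] lc_F_dird[OF x, of z]
    lc_dird_q[OF x, of z] II_normal[OF x, of u v z] lc_sym[of q "F x"] lc_sym[of q "dird z F x"]
    lc_sym[of "II x u v" "F x"]
  by (simp_all add: N_def lc_simps)

lemma normal_line:
  assumes x: "x \<in> S"
  obtains \<omega> where "lc \<omega> \<omega> = 1"
    "\<And>n. lc n (F x) = 0 \<Longrightarrow> lc n q = 0 \<Longrightarrow> (\<And>z. lc n (dird z F x) = 0) \<Longrightarrow> \<exists>c. n = c *\<^sub>R \<omega>"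
proof -
  define V where "V = range (\<lambda>v. dird v \<Phi> x)"
  have lin: "linear (\<lambda>v. dird v \<Phi> x)" using smooth_on_linear[OF \<Phi> x] .
  have dimV: "dim V = DIM('e)"
    unfolding V_def using dim_image_eq[OF lin, of UNIV] inj_dird[OF x] by simp
  have sV: "subspace V" unfolding V_def using linear_subspace_image[OF lin subspace_UNIV] .
  define P where "P = {y. \<forall>t\<in>V. orthogonal t y}"
  have "dim {y \<in> UNIV. \<forall>t\<in>V. orthogonal t y} + dim V = dim (UNIV::'h set)"
    by (rule dim_subspace_orthogonal_to_vectors) (use sV in auto)
  then have dimP: "dim P = 1" using dimV codim by (simp add: P_def)
  obtain Bs where Bs: "Bs \<subseteq> P" "independent Bs" "P \<subseteq> span Bs" "card Bs = 1"
    using basis_exists[of P] dimP by metis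
  then obtain b where b: "Bs = {b}" by (auto simp: card_1_singleton_iff)
  have b0: "b \<noteq> 0" using Bs(2) b by (simp add: dependent_zero)
  define \<nu> where "\<nu> = (1 / norm b) *\<^sub>R b"
  have \<nu>: "\<nu> \<bullet> \<nu> = 1" using b0 by (simp add: \<nu>_def dot_square_norm power2_eq_square)
  have P\<nu>: "\<exists>c. y = c *\<^sub>R \<nu>" if yP: "y \<in> P" for y
  proof -
    have "y \<in> span {b}" using Bs(3) b yP by auto
    then obtain k where "y = k *\<^sub>R b" by (auto simp: span_singleton)
    then have "y = (k * norm b) *\<^sub>R \<nu>" using b0 by (simp add: \<nu>_def)
    then show ?thesis by blast
  qed
  define y where "y = \<Phi> x"
  define D where "D = 1 - \<kappa> * (y \<bullet> y) / 4"
  have D: "D > 0" using D_pos[OF x] by (simp add: D_def y_def)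
  \<comment> \<open>By \<open>normal_tangent\<close> a normal vector is given by its multiple of
    \<open>\<nu>\<close> and its middle coordinate; this value of the latter makes it orthogonal to
    \<open>q\<close>.\<close>
  define \<alpha> where "\<alpha> = \<kappa> * (\<nu> \<bullet> y) / (2 * D)"
  define \<omega> where "\<omega> = (\<nu> + \<alpha> *\<^sub>R y, \<alpha>, \<alpha> * (y \<bullet> y) + 2 * (\<nu> \<bullet> y))"
  have "lc \<omega> \<omega> = 1"
    using \<nu> by (simp add: \<omega>_def lc_Pair inner_add_left inner_add_right inner_commute[of y \<nu>] algebra_simps)
  moreover have "\<exists>c. n = c *\<^sub>R \<omega>"
    if n: "lc n (F x) = 0" "lc n q = 0" "\<And>z. lc n (dird z F x) = 0" for n
  proof -
    obtain n0 a b where nn: "n = (n0, a, b)" by (metis prod_cases3)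
    note nt = normal_tangent[OF x n(1,3)[unfolded nn]]
    have "n0 - a *\<^sub>R y \<in> P"
      using nt(1) by (auto simp: P_def V_def orthogonal_def y_def inner_commute)
    then obtain c where c: "n0 - a *\<^sub>R y = c *\<^sub>R \<nu>" using P\<nu> by blast
    then have n0: "n0 = a *\<^sub>R y + c *\<^sub>R \<nu>" by (simp add: algebra_simps)
    have b: "b = a * (y \<bullet> y) + 2 * c * (\<nu> \<bullet> y)"
      using nt(2) by (simp add: n0 y_def inner_add_left algebra_simps)
    have "a = b * \<kappa> / 4" using n(2) by (simp add: nn q_def lc_Pair)
    then have "a * D = c * \<kappa> * (\<nu> \<bullet> y) / 2" by (simp add: b D_def algebra_simps)
    then have a: "a = c * \<alpha>" using D by (simp add: \<alpha>_def field_simps)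
    have "n = c *\<^sub>R \<omega>"
      by (simp add: nn n0 b a \<omega>_def algebra_simps)
    then show ?thesis by blast
  qed
  ultimately show ?thesis using that by blast
qed

lemma N_bilinear: "x \<in> S \<Longrightarrow> bilinear (N x)"
  unfolding bilinear_def N_def
  by (auto intro!: linearI simp: bilinear_simps[OF II_bilinear] bilinear_simps[OF bilinear_G] algebra_simps)

lemma N_sym: "x \<in> S \<Longrightarrow> N x u v = N x v u"
  using II_sym inner_formD(2)[OF inner_form_G] by (simp add: N_def)

lemma N_smooth: "smooth_on (\<lambda>x. N x u v) S"
  unfolding N_def
  by (rule smooth_on_add[OF S smooth_on_diff[OF S II_smooth smooth_on_scaleR[OF S
            smooth_on_mult[OF S smooth_on_const smooth_G] F_smooth]]
        smooth_on_scaleR[OF S smooth_G smooth_on_const]])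

text \<open>The scalar form is taken at a single point: a unit normal is determined only up to sign,
  and nothing is claimed about the dependence of \<open>\<omega>\<close> and \<open>h\<close> on
  \<open>x\<close>.\<close>

lemma ex_shape:
  assumes x: "x \<in> S"
  obtains \<omega> h where "lc \<omega> \<omega> = 1" "\<And>u v. N x u v = h u v *\<^sub>R \<omega>" "bilinear h" "\<And>u v. h u v = h v u"
proof -
  obtain \<omega> where \<omega>: "lc \<omega> \<omega> = 1" "\<And>n. lc n (F x) = 0 \<Longrightarrow> lc n q = 0 \<Longrightarrow> (\<And>z. lc n (dird z F x) = 0) \<Longrightarrow> \<exists>c. n = c *\<^sub>R \<omega>"
    using normal_line[OF x] by blast
  define h where "h u v = lc (N x u v) \<omega>" for u v
  have "N x u v = h u v *\<^sub>R \<omega>" for u v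
  proof -
    obtain c where "N x u v = c *\<^sub>R \<omega>" using \<omega>(2)[OF N_normal[OF x]] by blast
    then show ?thesis using \<omega>(1) by (simp add: h_def lc_simps)
  qed
  moreover have "bilinear h"
    unfolding bilinear_def h_def
    by (auto intro!: linearI simp: bilinear_simps[OF N_bilinear[OF x]] lc_simps)
  moreover have "h u v = h v u" for u v by (simp add: h_def N_sym[OF x, of u v])
  ultimately show ?thesis using that \<omega>(1) by blast
qed

lemma curvature_shape:
  assumes x: "x \<in> S" and \<omega>: "lc \<omega> \<omega> = 1" "\<And>u v. N x u v = h u v *\<^sub>R \<omega>"
  shows "G x (riemann G x u v v) u = - \<kappa> * disc (G x) u v + disc h u v"
proof -
  have II: "II x u v = N x u v + (\<kappa> * G x u v) *\<^sub>R F x - G x u v *\<^sub>R q" for u v by (simp add: N_def)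
  \<comment> \<open>The cross terms of \<open>F\<close> and \<open>q\<close> contribute
    \<open>- 2 \<kappa>\<close> and \<open>lc q q\<close> returns one \<open>\<kappa>\<close>; the
    result is the ambient curvature \<open>- \<kappa>\<close>.\<close>
  have "lc (II x u v) (II x u' v') = lc (N x u v) (N x u' v') - \<kappa> * (G x u v * G x u' v')" for u v u' v'
    using N_normal[OF x, of u v] N_normal[OF x, of u' v'] lc_F_F[of x] lc_F_q[OF x] lc_q_q lc_sym[of q "F x"]
      lc_sym[of _ "N x u' v'"]
    by (simp add: II lc_simps algebra_simps)
  moreover have "lc (N x u v) (N x u' v') = h u v * h u' v'" for u v u' v'
    using \<omega>(1) by (simp only: \<omega>(2) lc_simps) simp
  ultimately have II2: "lc (II x u v) (II x u' v') = h u v * h u' v' - \<kappa> * (G x u v * G x u' v')" for u v u' v'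
    by simp
  have G: "G x v u = G x u v" using inner_formD(2)[OF inner_form_G[OF x]] .
  have "h v u *\<^sub>R \<omega> = h u v *\<^sub>R \<omega>"
    using N_sym[OF x, of u v] by (simp only: \<omega>(2))
  moreover have "\<omega> \<noteq> 0" using \<omega>(1) by (auto simp: lc_simps)
  ultimately have h: "h v u = h u v" by simp
  show ?thesis
    unfolding gauss_equation[OF x] II2 G h disc_def by (simp add: power2_eq_square algebra_simps)
qed

end

text \<open>The conformal factor is a function of \<open>\<Phi>\<close>, so composing with
  \<open>T\<close> commutes with the lift and \<open>II_coordinate_change\<close> applies.\<close>

lemma N_coordinate_change:
  fixes T :: "'d::euclidean_space \<Rightarrow> 'e::euclidean_space"
  assumes A: "hyperbolic_hypersurface S \<Phi> \<kappa> G" and C: "hyperbolic_hypersurface U (\<lambda>y. \<Phi> (T y)) \<kappa> G'"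
    and T: "smooth_on T U" "T ` U \<subseteq> S" and x: "x \<in> U" and surj: "surj (\<lambda>v. dird v T x)"
    and G': "\<And>u v. G' x u v = G (T x) (dird u T x) (dird v T x)"
  shows "hyperbolic_hypersurface.N (\<lambda>y. \<Phi> (T y)) \<kappa> G' x u v =
    hyperbolic_hypersurface.N \<Phi> \<kappa> G (T x) (dird u T x) (dird v T x)"
proof -
  interpret A: hyperbolic_hypersurface S \<Phi> \<kappa> G by fact
  interpret C: hyperbolic_hypersurface U "\<lambda>y. \<Phi> (T y)" \<kappa> G' by fact
  have F: "C.F = (\<lambda>y. A.F (T y))" by (simp add: fun_eq_iff A.F_def C.F_def)
  have "C.II x u v = A.II (T x) (dird u T x) (dird v T x)"
    using II_coordinate_change[OF A.flat_immersion_axioms C.flat_immersion_axioms[unfolded F] T x surj]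
    by (simp add: F)
  then show ?thesis by (simp add: A.N_def C.N_def A.q_def C.q_def F G')
qed

text \<open>The smooth left inverse of the differential is the least squares one:
  \<open>V v x\<close> solves the normal equations for the Gram form \<open>g\<close>, which is
  positive by injectivity, and \<open>smooth_raise\<close> gives smoothness.\<close>

lemma smooth_on_inverse_function:
  fixes P :: "'e::euclidean_space \<Rightarrow> 'm::euclidean_space"
  assumes S: "open S" and T: "open T" and P: "smooth_on P S" and Q: "continuous_on T Q" "Q ` T \<subseteq> S"
    and PQ: "\<And>y. y \<in> T \<Longrightarrow> P (Q y) = y"
    and inj: "\<And>x u. x \<in> S \<Longrightarrow> dird u P x = 0 \<Longrightarrow> u = 0"
  shows "smooth_on Q T"
proof -
  define g where "g x u z = dird u P x \<bullet> dird z P x" for x u z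
  note lP = smooth_on_linear[OF P]
  have g: "inner_form (g x)" if "x \<in> S" for x
    unfolding inner_form_def bilinear_def
    using inj[OF that] by (auto intro!: linearI
        simp: g_def linear_add[OF lP[OF that]] linear_scale[OF lP[OF that]] inner_add_left inner_add_right inner_commute)
  have sg: "smooth_on (\<lambda>x. g x u v) S" for u v
    unfolding g_def by (rule smooth_on_inner[OF S smooth_on_dird[OF P] smooth_on_dird[OF P]])
  have "\<exists>X. smooth_on X S \<and> (\<forall>x\<in>S. \<forall>z. g x (X x) z = v \<bullet> dird z P x)" for v
  proof -
    have 1: "smooth_on (\<lambda>x. v \<bullet> dird z P x) S" for z
      by (rule smooth_on_inner[OF S smooth_on_const smooth_on_dird[OF P]])
    have 2: "linear (\<lambda>z. v \<bullet> dird z P x)" if "x \<in> S" for x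
      by (auto intro!: linearI simp: linear_add[OF lP[OF that]] linear_scale[OF lP[OF that]] inner_add_right)
    show ?thesis
    proof (rule smooth_raise[where G = g and \<alpha> = "\<lambda>x z. v \<bullet> dird z P x", OF S sg g 1 2])
      fix X assume "smooth_on X S" "\<And>x z. x \<in> S \<Longrightarrow> g x (X x) z = v \<bullet> dird z P x"
      then show ?thesis by auto
    qed
  qed
  then obtain V where V: "\<And>v. smooth_on (V v) S" "\<And>v x z. x \<in> S \<Longrightarrow> g x (V v x) z = v \<bullet> dird z P x"
    by metis
  show ?thesis
  proof (rule Ck_on_inverse_function[OF S T P Q PQ V(1)])
    fix x assume x: "x \<in> S"
    note b = bilinear_simps[OF inner_formD(1)[OF g[OF x]]]
    show "linear (\<lambda>v. V v x)"
      by (rule linearI) (rule inner_form_eqI[OF g[OF x]], simp add: b V(2)[OF x] inner_add_left)+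
    show "V (dird u P x) x = u" for u
      by (rule inner_form_eqI[OF g[OF x]]) (simp only: V(2)[OF x], simp add: g_def)
  qed
qed

section \<open>Charts\<close>

abbreviation cinv :: "('a, 'e) chart \<Rightarrow> 'e \<Rightarrow> 'a" where
  "cinv c \<equiv> inv_into (cdom c) (cmap c)"

lemma transition_eq: "transition c d x = cmap d (cinv c x)"
  by (simp add: coord_rep_def)

lemma is_chartD:
  assumes "is_chart c"
  shows "open (cdom c)" "open (cmap c ` cdom c)" "continuous_on (cdom c) (cmap c)"
    "continuous_on (cmap c ` cdom c) (cinv c)" "q \<in> cdom c \<Longrightarrow> cinv c (cmap c q) = q"
  using assms by (auto simp: is_chart_def homeomorphism_def)

lemma chart_image_open:
  assumes "is_chart c" "open V"
  shows "open (cmap c ` (cdom c \<inter> V))"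
proof -
  have "open (cinv c -` V \<inter> cmap c ` cdom c)"
    using is_chartD(2,4)[OF assms(1)] assms(2) continuous_on_open_vimage by blast
  moreover have "cinv c -` V \<inter> cmap c ` cdom c = cmap c ` (cdom c \<inter> V)"
    using is_chartD(5)[OF assms(1)] by auto
  ultimately show ?thesis by simp
qed

lemma riemannian_manifoldD:
  assumes "riemannian_manifold M"
  shows "c \<in> atlas M \<Longrightarrow> is_chart c"
    "c \<in> atlas M \<Longrightarrow> d \<in> atlas M \<Longrightarrow> smooth_on (transition c d) (cmap c ` (cdom c \<inter> cdom d))"
    "c \<in> atlas M \<Longrightarrow> x \<in> cmap c ` cdom c \<Longrightarrow> inner_form (metric M c x)"
    "c \<in> atlas M \<Longrightarrow> d \<in> atlas M \<Longrightarrow> p \<in> cdom c \<Longrightarrow> p \<in> cdom d \<Longrightarrow>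
      metric M d (cmap d p) (dird u (transition c d) (cmap c p)) (dird v (transition c d) (cmap c p))
      = metric M c (cmap c p) u v"
proof -
  show "c \<in> atlas M \<Longrightarrow> is_chart c"
    and "c \<in> atlas M \<Longrightarrow> d \<in> atlas M \<Longrightarrow> smooth_on (transition c d) (cmap c ` (cdom c \<inter> cdom d))"
    using assms by (auto simp: riemannian_manifold_def compatible_def)
  show "inner_form (metric M c x)" if "c \<in> atlas M" "x \<in> cmap c ` cdom c"
    using assms that unfolding riemannian_manifold_def inner_form_def by blast
  show "metric M d (cmap d p) (dird u (transition c d) (cmap c p)) (dird v (transition c d) (cmap c p))
      = metric M c (cmap c p) u v" if "c \<in> atlas M" "d \<in> atlas M" "p \<in> cdom c" "p \<in> cdom d"
    using assms that unfolding riemannian_manifold_def charts_at_def by blast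
qed

lemma open_points: "riemannian_manifold M \<Longrightarrow> open (points M)"
  unfolding points_def using riemannian_manifoldD(1) is_chartD(1) by blast

lemma transition_chain:
  assumes M: "riemannian_manifold M" and c: "c \<in> atlas M" "d \<in> atlas M" "d' \<in> atlas M"
    and q: "q \<in> cdom c" "q \<in> cdom d" "q \<in> cdom d'"
  shows "dird v (transition c d') (cmap c q) =
    dird (dird v (transition c d) (cmap c q)) (transition d d') (cmap d q)"
proof -
  note ch = riemannian_manifoldD(1)[OF M] and sm = riemannian_manifoldD(2)[OF M]
  define W where "W = cmap c ` (cdom c \<inter> (cdom d \<inter> cdom d'))"
  have W: "open W" "cmap c q \<in> W"
    unfolding W_def using c q by (auto intro!: chart_image_open ch open_Int is_chartD(1))
  have sub: "transition c d ` W \<subseteq> cmap d ` (cdom d \<inter> cdom d')"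
    using is_chartD(5)[OF ch[OF c(1)]] by (auto simp: W_def transition_eq)
  have op: "open (cmap d ` (cdom d \<inter> cdom d'))"
    using chart_image_open[OF ch[OF c(2)]] is_chartD(1)[OF ch] c by blast
  have s1: "smooth_on (transition c d) W" and s2: "smooth_on (transition c d') W"
    by (rule smooth_on_subset[OF sm[OF c(1,2)]], force simp: W_def)
      (rule smooth_on_subset[OF sm[OF c(1,3)]], force simp: W_def)
  have "dird v (transition c d') (cmap c q) = dird v (\<lambda>x. transition d d' (transition c d x)) (cmap c q)"
    by (rule dird_cong[OF W s2])
      (use is_chartD(5)[OF ch[OF c(1)]] is_chartD(5)[OF ch[OF c(2)]] in \<open>auto simp: W_def transition_eq\<close>)
  also have "\<dots> = dird (dird v (transition c d) (cmap c q)) (transition d d') (transition c d (cmap c q))"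
    by (rule dird_eq[OF has_derivative_smooth_compose[OF op sm[OF c(2,3)] s1 sub W(2)]])
  finally show ?thesis using is_chartD(5)[OF ch[OF c(1)] q(1)] by (simp add: transition_eq)
qed

lemma transition_self:
  assumes M: "riemannian_manifold M" and c: "c \<in> atlas M" and q: "q \<in> cdom c"
  shows "dird v (transition c c) (cmap c q) = v"
proof -
  note ch = riemannian_manifoldD(1)[OF M c]
  have "dird v (\<lambda>x. x) (cmap c q) = dird v (transition c c) (cmap c q)"
    by (rule dird_cong[OF is_chartD(2)[OF ch] _ smooth_on_ident[OF is_chartD(2)[OF ch]]])
      (use q is_chartD(5)[OF ch] in \<open>auto simp: transition_eq\<close>)
  then show ?thesis by simp
qed

lemma transition_inverse:
  assumes M: "riemannian_manifold M" and c: "c \<in> atlas M" "d \<in> atlas M"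
    and q: "q \<in> cdom c" "q \<in> cdom d"
  shows "dird (dird v (transition c d) (cmap c q)) (transition d c) (cmap d q) = v"
  using transition_chain[OF M c(1,2,1) q(1,2,1)] transition_self[OF M c(1) q(1)] by metis

section \<open>Restriction and change of the representing map\<close>

lemma lightcone_immersion_subset:
  assumes "lightcone_immersion S \<Phi> \<phi> G" "open U" "U \<subseteq> S"
  shows "lightcone_immersion U \<Phi> \<phi> G"
  using assms by (auto simp: lightcone_immersion_def intro: smooth_on_subset)

lemma hyperbolic_hypersurface_subset:
  assumes "hyperbolic_hypersurface S \<Phi> \<kappa> G" "open U" "U \<subseteq> S"
  shows "hyperbolic_hypersurface U \<Phi> \<kappa> G"
  using assms lightcone_immersion_subset[OF _ assms(2,3)]
  unfolding hyperbolic_hypersurface_def hyperbolic_hypersurface_axioms_def by blast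

lemma hyperbolic_hypersurface_cong:
  fixes G :: "'e::euclidean_space local_metric" and \<Phi> \<Phi>' :: "'e \<Rightarrow> 'h::euclidean_space"
  assumes A: "hyperbolic_hypersurface S \<Phi> \<kappa> G" and eq: "\<And>x. x \<in> S \<Longrightarrow> \<Phi> x = \<Phi>' x"
  shows "hyperbolic_hypersurface S \<Phi>' \<kappa> G"
proof -
  interpret A: hyperbolic_hypersurface S \<Phi> \<kappa> G by fact
  have d: "dird u \<Phi>' x = dird u \<Phi> x" if "x \<in> S" for u x
    using dird_cong[OF A.S that A.\<Phi> eq] by simp
  show ?thesis
  proof (unfold_locales)
    show "smooth_on \<Phi>' S" by (rule smooth_on_cong[OF A.\<Phi> A.S eq])
    show "smooth_on (\<lambda>x. 1 / (1 - \<kappa> * (norm (\<Phi>' x))\<^sup>2 / 4)\<^sup>2) S"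
      by (rule smooth_on_cong[OF A.\<phi>(1) A.S]) (simp add: eq)
  qed (use A.S A.\<phi>(2) A.conf A.pos A.ball A.codim eq d in auto)
qed

section \<open>Local lifts of an isometric immersion of the covering\<close>

lemma isometric_immersion_smooth:
  assumes "isometric_immersion M N F" "c \<in> atlas M" "d \<in> atlas N"
  shows "smooth_on (coord_rep c d F) (cmap c ` (cdom c \<inter> F -` cdom d))"
  using assms by (auto simp: isometric_immersion_def smooth_map_def)

lemma isometric_immersion_metric:
  assumes "isometric_immersion M N F" "c \<in> atlas M" "d \<in> atlas N" "p \<in> cdom c" "F p \<in> cdom d"
  shows "metric N d (cmap d (F p)) (dird u (coord_rep c d F) (cmap c p)) (dird v (coord_rep c d F) (cmap c p))
    = metric M c (cmap c p) u v"
  using assms by (auto simp: isometric_immersion_def charts_at_def points_def)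

text \<open>\<open>\<Psi>\<close> is \<open>f\<close> after a local section of the covering. A
  single map on \<open>U\<close> serves all charts, so that second fundamental forms can be
  compared. The section is at first only continuous; in charts it is smooth as an inverse of
  \<open>\<pi>\<close>, whose differential is injective because \<open>\<pi>\<close> preserves the
  metric.\<close>

lemma ex_local_hypersurface:
  fixes M :: "('a::{t2_space, second_countable_topology}, 'e::euclidean_space) riem"
    and M' :: "('b::{t2_space, second_countable_topology}, 'e) riem"
    and f :: "'b \<Rightarrow> 'h::euclidean_space"
  assumes M: "riemannian_manifold M" and cov: "riemannian_universal_covering M' \<pi> M"
    and f: "isometric_immersion M' (hyperbolic_space \<kappa>) f"
    and dim: "DIM('h) = DIM('e) + 1" and p: "p \<in> points M"
  obtains U \<Psi> where "open U" "p \<in> U"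
    "\<And>d. d \<in> atlas M \<Longrightarrow>
      hyperbolic_hypersurface (cmap d ` (cdom d \<inter> U)) (\<lambda>x. \<Psi> (cinv d x) :: 'h) \<kappa> (metric M d)"
proof -
  have M': "riemannian_manifold M'" and cs: "covering_space (points M') \<pi> (points M)"
    and iso: "isometric_immersion M' M \<pi>" using cov by (auto simp: riemannian_universal_covering_def)
  note ch = riemannian_manifoldD(1)[OF M] and ch' = riemannian_manifoldD(1)[OF M']
  obtain U' U g where "openin (top_of_set (points M')) U'" "p \<in> U" "openin (top_of_set (points M)) U"
    and hom: "homeomorphism U' U \<pi> g"
    using covering_space_local_homeomorphism_alt[OF cs p] by metis
  then have U': "open U'" "U' \<subseteq> points M'" and U: "open U" "p \<in> U"
    using open_points[OF M] open_points[OF M'] by (auto simp: openin_open_eq)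
  have g: "continuous_on U g" "g ` U \<subseteq> U'" and \<pi>g: "r \<in> U \<Longrightarrow> \<pi> (g r) = r" for r
    using hom by (auto simp: homeomorphism_def)
  define hb where "hb = \<lparr>cdom = {x::'h. \<kappa> * (norm x)\<^sup>2 < 4}, cmap = (\<lambda>x. x)\<rparr>"
  have hb: "hb \<in> atlas (hyperbolic_space \<kappa>)" by (simp add: hb_def hyperbolic_space_def)
  have fb: "f r \<in> cdom hb" if "r \<in> points M'" for r
    using f that by (auto simp: isometric_immersion_def smooth_map_def hb_def hyperbolic_space_def points_def)
  show ?thesis
  proof (rule that[OF U, of "\<lambda>r. f (g r)"])
    fix d assume d: "d \<in> atlas M"
    define S where "S = cmap d ` (cdom d \<inter> U)"
    define \<Phi> where "\<Phi> = (\<lambda>x. f (g (cinv d x)))"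
    have S: "open S" unfolding S_def by (rule chart_image_open[OF ch[OF d] U(1)])
    have r: "cinv d y \<in> cdom d" "cinv d y \<in> U" "cmap d (cinv d y) = y" "g (cinv d y) \<in> U'" if "y \<in> S" for y
      using that is_chartD(5)[OF ch[OF d]] g by (auto simp: S_def)
    have loc: "\<exists>N. open N \<and> y0 \<in> N \<and> smooth_on \<Phi> N \<and>
        (\<forall>u v. metric M d y0 u v = (dird u \<Phi> y0 \<bullet> dird v \<Phi> y0) / (1 - \<kappa> * (norm (\<Phi> y0))\<^sup>2 / 4)\<^sup>2)"
      if y0: "y0 \<in> S" for y0
    proof -
      have "g (cinv d y0) \<in> points M'" using r[OF y0] U'(2) by auto
      then obtain m where m: "m \<in> atlas M'" "g (cinv d y0) \<in> cdom m" by (auto simp: points_def)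
      define N where "N = cmap d ` (cdom d \<inter> (g -` cdom m \<inter> U))"
      have gm: "open (g -` cdom m \<inter> U)"
        using g(1) U(1) is_chartD(1)[OF ch'[OF m(1)]] continuous_on_open_vimage by blast
      have N: "open N" unfolding N_def by (rule chart_image_open[OF ch[OF d] gm])
      have yN: "y0 \<in> N" using r[OF y0] m(2) unfolding N_def by (auto intro!: image_eqI[of _ _ "cinv d y0"])
      have NS: "N \<subseteq> S" by (auto simp: N_def S_def)
      have gN: "g (cinv d y) \<in> cdom m" if "y \<in> N" for y
        using that is_chartD(5)[OF ch[OF d]] by (auto simp: N_def)
      define P where "P = coord_rep m d \<pi>"
      define f0 where "f0 = coord_rep m hb f"
      define S' where "S' = cmap m ` (cdom m \<inter> U' \<inter> \<pi> -` cdom d)"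
      define Q where "Q y = cmap m (g (cinv d y))" for y
      have \<pi>c: "continuous_on U' \<pi>" using hom by (simp add: homeomorphism_def)
      have "open (\<pi> -` cdom d \<inter> U')"
        using \<pi>c U'(1) is_chartD(1)[OF ch[OF d]] continuous_on_open_vimage by blast
      then have S': "open S'"
        using chart_image_open[OF ch'[OF m(1)], of "\<pi> -` cdom d \<inter> U'"] by (simp add: S'_def Int_assoc Int_commute[of U'])
      have P: "smooth_on P S'"
        unfolding P_def by (rule smooth_on_subset[OF isometric_immersion_smooth[OF iso m(1) d]]) (auto simp: S'_def)
      have f0: "smooth_on f0 S'"
        unfolding f0_def by (rule smooth_on_subset[OF isometric_immersion_smooth[OF f m(1) hb]])
          (use fb U'(2) in \<open>auto simp: S'_def\<close>)
      have "continuous_on N (cinv d)"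
        by (rule continuous_on_subset[OF is_chartD(4)[OF ch[OF d]]]) (auto simp: N_def)
      then have "continuous_on N (\<lambda>y. g (cinv d y))"
        using r(2) NS by (intro continuous_on_compose2[OF g(1)]) auto
      then have Qc: "continuous_on N Q"
        unfolding Q_def using gN by (intro continuous_on_compose2[OF is_chartD(3)[OF ch'[OF m(1)]]]) auto
      have minv: "cinv m (Q y) = g (cinv d y)" if "y \<in> N" for y
        using is_chartD(5)[OF ch'[OF m(1)] gN[OF that]] by (simp add: Q_def)
      have QN: "Q ` N \<subseteq> S'"
      proof (rule image_subsetI)
        fix y assume y: "y \<in> N"
        then have "y \<in> S" using NS by auto
        then show "Q y \<in> S'"
          using gN[OF y] r[of y] \<pi>g[of "cinv d y"] unfolding S'_def Q_def by (intro imageI) auto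
      qed
      have PQ: "P (Q y) = y" if "y \<in> N" for y
      proof -
        have "y \<in> S" using that NS by auto
        then show ?thesis using minv[OF that] r[of y] \<pi>g by (simp add: P_def coord_rep_def)
      qed
      have f0Q: "f0 (Q y) = \<Phi> y" if "y \<in> N" for y
        using minv[OF that] by (simp add: f0_def coord_rep_def \<Phi>_def hb_def)
      have metP: "metric M d (P x) (dird u P x) (dird v P x) = metric M' m x u v" if "x \<in> S'" for x u v
        using that isometric_immersion_metric[OF iso m(1) d] is_chartD(5)[OF ch'[OF m(1)]]
        by (auto simp: S'_def P_def coord_rep_def)
      have metf: "(dird u f0 x \<bullet> dird v f0 x) / (1 - \<kappa> * (norm (f0 x))\<^sup>2 / 4)\<^sup>2 = metric M' m x u v"
        if xS: "x \<in> S'" for x u v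
      proof -
        obtain r where r: "x = cmap m r" "r \<in> cdom m" "r \<in> U'" using xS by (auto simp: S'_def)
        have "f0 x = f r" using is_chartD(5)[OF ch'[OF m(1)] r(2)] r(1) by (simp add: f0_def coord_rep_def hb_def)
        then show ?thesis
          using isometric_immersion_metric[OF f m(1) hb r(2) fb] r U'(2)
          by (auto simp: f0_def hyperbolic_space_def hb_def)
      qed
      have inj: "u = 0" if x: "x \<in> S'" and u: "dird u P x = 0" for x u
      proof (rule ccontr)
        assume "u \<noteq> 0"
        moreover have "x \<in> cmap m ` cdom m" "P x \<in> cmap d ` cdom d"
          using x is_chartD(5)[OF ch'[OF m(1)]] by (auto simp: S'_def P_def coord_rep_def)
        ultimately have "metric M' m x u u > 0" "metric M d (P x) 0 0 = 0"
          using riemannian_manifoldD(3)[OF M' m(1)] riemannian_manifoldD(3)[OF M d] inner_formD(3)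
            bilinear_simps(7)[OF inner_formD(1)] by blast+
        then show False using metP[OF x, of u u] u by simp
      qed
      have Qs: "smooth_on Q N" by (rule smooth_on_inverse_function[OF S' N P Qc QN PQ inj])
      have \<Phi>s: "smooth_on \<Phi> N"
        by (rule smooth_on_cong[OF smooth_on_compose[OF N S' QN f0 Qs] N f0Q])
      have d\<Phi>: "dird u \<Phi> y0 = dird (dird u Q y0) f0 (Q y0)" for u
        using dird_cong[OF N yN smooth_on_compose[OF N S' QN f0 Qs] f0Q]
          dird_eq[OF has_derivative_smooth_compose[OF S' f0 Qs QN yN]] by metis
      have dPQ: "dird (dird u Q y0) P (Q y0) = u" for u
        using dird_cong[OF N yN smooth_on_compose[OF N S' QN P Qs] PQ, of u]
          dird_eq[OF has_derivative_smooth_compose[OF S' P Qs QN yN], of u] by simp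
      have Qy: "Q y0 \<in> S'" using QN yN by auto
      \<comment> \<open>Transport \<open>u\<close> and \<open>v\<close> to the covering by the
        derivative of \<open>Q\<close>; there the metric is the pullback both under
        \<open>\<pi>\<close> and under \<open>f\<close>.\<close>
      have "metric M d y0 u v = (dird u \<Phi> y0 \<bullet> dird v \<Phi> y0) / (1 - \<kappa> * (norm (\<Phi> y0))\<^sup>2 / 4)\<^sup>2" for u v
        using metP[OF Qy, of "dird u Q y0" "dird v Q y0"] metf[OF Qy, of "dird u Q y0" "dird v Q y0"]
        by (simp add: dPQ PQ[OF yN] f0Q[OF yN] d\<Phi>)
      then show ?thesis using N yN \<Phi>s by blast
    qed
    have \<Phi>: "smooth_on \<Phi> S" by (rule smooth_on_local) (use loc in blast)
    have ball: "\<kappa> * (norm (\<Phi> x))\<^sup>2 < 4" if "x \<in> S" for x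
      using fb[of "g (cinv d x)"] r(4)[OF that] U'(2) by (auto simp: \<Phi>_def hb_def)
    have nz: "(1 - \<kappa> * (norm (\<Phi> x))\<^sup>2 / 4)\<^sup>2 > 0" if "x \<in> S" for x
      using ball[OF that] by simp
    have "smooth_on (\<lambda>x. 1 - \<kappa> * (\<Phi> x \<bullet> \<Phi> x) * (1 / 4)) S"
      by (rule smooth_on_diff[OF S smooth_on_const smooth_on_mult[OF S smooth_on_mult[OF S smooth_on_const
              smooth_on_inner[OF S \<Phi> \<Phi>]] smooth_on_const]])
    then have s0: "smooth_on (\<lambda>x. 1 - \<kappa> * (norm (\<Phi> x))\<^sup>2 / 4) S" by (simp add: power2_norm_eq_inner)
    have s2: "smooth_on (\<lambda>x. (1 - \<kappa> * (norm (\<Phi> x))\<^sup>2 / 4)\<^sup>2) S"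
      using smooth_on_mult[OF S s0 s0] by (simp add: power2_eq_square)
    have s1: "smooth_on (\<lambda>x. 1 / (1 - \<kappa> * (norm (\<Phi> x))\<^sup>2 / 4)\<^sup>2) S"
    proof (rule smooth_on_divide[OF S _ smooth_on_const s2])
      show "(1 - \<kappa> * (norm (\<Phi> x))\<^sup>2 / 4)\<^sup>2 \<noteq> 0" if "x \<in> S" for x using nz[OF that] by linarith
    qed
    have met: "metric M d x u v = 1 / (1 - \<kappa> * (norm (\<Phi> x))\<^sup>2 / 4)\<^sup>2 * (dird u \<Phi> x \<bullet> dird v \<Phi> x)"
      if "x \<in> S" for x u v using loc[OF that] by auto
    have "hyperbolic_hypersurface S \<Phi> \<kappa> (metric M d)"
    proof (unfold_locales)
      show "metric M d x u u > 0" if "x \<in> S" "u \<noteq> 0" for x u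
        using riemannian_manifoldD(3)[OF M d, of x] inner_formD(3) that by (auto simp: S_def)
    qed (use S \<Phi> s1 nz met ball dim in simp_all)
    then show "hyperbolic_hypersurface (cmap d ` (cdom d \<inter> U)) (\<lambda>x. f (g (cinv d x))) \<kappa> (metric M d)"
      by (simp add: S_def \<Phi>_def)
  qed
qed

text \<open>The flattening chart \<open>e\<close> need not belong to the atlas; it enters as the map
  \<open>transition c e\<close> between spaces of equal dimension, whose light cone lift has
  codimension zero data.\<close>

lemma conformally_flat_immersion:
  fixes M :: "('a::{t2_space, second_countable_topology}, 'e::euclidean_space) riem"
  assumes M: "riemannian_manifold M" and cf: "conformally_flat M" and p: "p \<in> points M"
  obtains e l where "open (cdom e)" "p \<in> cdom e"
    "\<And>c. c \<in> atlas M \<Longrightarrow>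
      lightcone_immersion (cmap c ` (cdom c \<inter> cdom e)) (transition c e :: 'e \<Rightarrow> 'e) (\<lambda>x. l (transition c e x)) (metric M c)"
proof -
  obtain e l where e: "is_chart e" "p \<in> cdom e" "\<And>c. c \<in> atlas M \<Longrightarrow> compatible c e"
    "smooth_on l (cmap e ` cdom e)" "\<And>y. y \<in> cmap e ` cdom e \<Longrightarrow> l y > 0"
    and met: "\<And>q c u v. q \<in> cdom e \<Longrightarrow> c \<in> charts_at M q \<Longrightarrow> metric M c (cmap c q) u v =
             l (cmap e q) * (dird u (transition c e) (cmap c q) \<bullet> dird v (transition c e) (cmap c q))"
    using cf[unfolded conformally_flat_def, rule_format, OF p] by metis
  note oe = is_chartD(1)[OF e(1)]
  show ?thesis
  proof (rule that[OF oe e(2)])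
    fix c assume c: "c \<in> atlas M"
    note ch = riemannian_manifoldD(1)[OF M c]
    have S: "open (cmap c ` (cdom c \<inter> cdom e))" by (rule chart_image_open[OF ch oe])
    have t: "smooth_on (transition c e) (cmap c ` (cdom c \<inter> cdom e))"
      using e(3)[OF c] by (simp add: compatible_def)
    have im: "transition c e ` (cmap c ` (cdom c \<inter> cdom e)) \<subseteq> cmap e ` cdom e"
      using is_chartD(5)[OF ch] by (auto simp: transition_eq)
    show "lightcone_immersion (cmap c ` (cdom c \<inter> cdom e)) (transition c e) (\<lambda>x. l (transition c e x)) (metric M c)"
    proof
      show "smooth_on (\<lambda>x. l (transition c e x)) (cmap c ` (cdom c \<inter> cdom e))"
        by (rule smooth_on_compose[OF S is_chartD(2)[OF e(1)] im e(4) t])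
      show "l (transition c e x) > 0" if "x \<in> cmap c ` (cdom c \<inter> cdom e)" for x
        using im that e(5) by blast
      show "metric M c x u v = l (transition c e x) * (dird u (transition c e) x \<bullet> dird v (transition c e) x)"
        if "x \<in> cmap c ` (cdom c \<inter> cdom e)" for x u v
        using that met c is_chartD(5)[OF ch] by (auto simp: charts_at_def transition_eq[of c e])
      show "metric M c x u u > 0" if "x \<in> cmap c ` (cdom c \<inter> cdom e)" "u \<noteq> 0" for x u
        using riemannian_manifoldD(3)[OF M c, of x] inner_formD(3) that by auto
    qed (fact S t)+
  qed
qed

section \<open>Conformally flat hypersurfaces\<close>

text \<open>Two lifts of one metric: the first expresses curvature by \<open>h\<close>, the second
  gives the identity for four orthonormal vectors. The constant \<open>- \<kappa>\<close> occurs
  twice on either side and cancels, leaving Cartan's condition on \<open>h\<close>.\<close>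

lemma hypersurface_quasi_umbilical:
  fixes G :: "'e::euclidean_space local_metric" and \<Phi> :: "'e \<Rightarrow> 'h::euclidean_space"
    and \<Psi> :: "'e \<Rightarrow> 'k::euclidean_space"
  assumes A: "hyperbolic_hypersurface S \<Phi> \<kappa> G" and C: "lightcone_immersion S \<Psi> \<psi> G"
    and \<Psi>: "DIM('e) \<ge> 4" "DIM('k) = DIM('e)" and x: "x \<in> S"
  obtains \<omega> h l r Y where "lc \<omega> \<omega> = 1" "\<And>u v. hyperbolic_hypersurface.N \<Phi> \<kappa> G x u v = h u v *\<^sub>R \<omega>"
    "quasi_umbilical (G x) h l r Y"
proof -
  interpret A: hyperbolic_hypersurface S \<Phi> \<kappa> G by fact
  interpret C: lightcone_immersion S \<Psi> \<psi> G by fact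
  note g = A.inner_form_G[OF x]
  obtain \<omega> h where h: "lc \<omega> \<omega> = 1" "\<And>u v. A.N x u v = h u v *\<^sub>R \<omega>" "bilinear h" "\<And>u v. h u v = h v u"
    using A.ex_shape[OF x] by blast
  obtain l r Y where "quasi_umbilical (G x) h l r Y"
  proof (rule ex_quasi_umbilical[OF g h(3,4) \<Psi>(1)])
    fix u v w z
    assume u: "G x u u = 1" "G x v v = 1" "G x w w = 1" "G x z z = 1"
      "G x u v = 0" "G x u w = 0" "G x u z = 0" "G x v w = 0" "G x v z = 0" "G x w z = 0"
    have d: "disc (G x) a b = 1" if "G x a a = 1" "G x b b = 1" "G x a b = 0" for a b
      using that by (simp add: disc_def)
    have K: "G x (riemann G x a b b) a = disc h a b - \<kappa>" if "G x a a = 1" "G x b b = 1" "G x a b = 0" for a b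
      using A.curvature_shape[OF x h(1,2), of a b] d[OF that] by simp
    show "disc h u v + disc h w z = disc h u w + disc h v z"
      using C.conformally_flat_curvature[OF \<Psi>(2) x u(5-10) u(1-4)]
      by (simp add: K u)
  qed
  then show ?thesis using that h by blast
qed

lemma quasi_umbilical_scale:
  "quasi_umbilical g h l r Y \<Longrightarrow> (\<And>u v. h' u v = k * h u v) \<Longrightarrow> quasi_umbilical g h' (k * l) (k * r) Y"
  by (simp add: quasi_umbilical_def algebra_simps)

lemma span_singleton_scale:
  fixes v :: "'e::real_vector"
  assumes "s \<noteq> 0"
  shows "span {s *\<^sub>R v} = span {v}"
proof (intro subset_antisym span_minimal subspace_span)
  show "{s *\<^sub>R v} \<subseteq> span {v}" by (simp add: span_scale span_base)
  have "(1 / s) *\<^sub>R (s *\<^sub>R v) \<in> span {s *\<^sub>R v}" by (intro span_scale span_base) simp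
  then show "{v} \<subseteq> span {s *\<^sub>R v}" using assms by simp
qed

theorem proposition2p12:
  fixes M :: "('a::{t2_space, second_countable_topology}, 'e::euclidean_space) riem"
    and M' :: "('b::{t2_space, second_countable_topology}, 'e) riem"
    and \<pi> :: "'b \<Rightarrow> 'a"
    and y0 :: 'b
    and \<kappa> :: real
    and f :: "'b \<Rightarrow> 'h::euclidean_space"
    and \<rho> :: "(real \<Rightarrow> 'a) set \<Rightarrow> 'h \<Rightarrow> 'h"
  assumes "DIM('e) \<ge> 4" and "DIM('h) = DIM('e) + 1"
    and "riemannian_manifold M" and "conformally_flat M"
    and "\<kappa> \<ge> 0"
    and "riemannian_universal_covering M' \<pi> M" and "y0 \<in> points M'"
    and "isometric_immersion M' (hyperbolic_space \<kappa>) f"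
    and "\<rho> \<in> hom (fundamental_group (points M) (\<pi> y0)) (isometry_group (hyperbolic_space \<kappa>))"
    and "\<And>\<Gamma> x. \<Gamma> \<in> carrier (fundamental_group (points M) (\<pi> y0)) \<Longrightarrow> x \<in> points M' \<Longrightarrow>
           f (deck_action (points M') \<pi> y0 \<Gamma> x) = \<rho> \<Gamma> (f x)"
  shows "one_QC M"
  unfolding one_QC_def
proof (intro ballI impI)
  fix p assume p: "p \<in> points M" and "\<not> isotropic_point M p"
  note M = assms(3)
  note ch = riemannian_manifoldD(1)[OF M] and sm = riemannian_manifoldD(2)[OF M]
  note met = riemannian_manifoldD(4)[OF M]
  obtain c \<sigma> \<sigma>' where c: "c \<in> atlas M" "p \<in> cdom c" and \<sigma>: "two_plane \<sigma>" "two_plane \<sigma>'"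
    "sec_curvature (metric M c) (cmap c p) \<sigma> \<noteq> sec_curvature (metric M c) (cmap c p) \<sigma>'"
    using \<open>\<not> isotropic_point M p\<close> by (auto simp: isotropic_point_def charts_at_def)
  obtain V \<Psi> where V: "open V" "p \<in> V" and hyp: "\<And>d. d \<in> atlas M \<Longrightarrow>
      hyperbolic_hypersurface (cmap d ` (cdom d \<inter> V)) (\<lambda>x. \<Psi> (cinv d x) :: 'h) \<kappa> (metric M d)"
    using ex_local_hypersurface[OF M assms(6,8,2) p] by blast
  obtain e l where e: "open (cdom e)" "p \<in> cdom e" and flat: "\<And>c. c \<in> atlas M \<Longrightarrow>
      lightcone_immersion (cmap c ` (cdom c \<inter> cdom e)) (transition c e :: 'e \<Rightarrow> 'e) (\<lambda>x. l (transition c e x)) (metric M c)"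
    using conformally_flat_immersion[OF M assms(4) p] by blast
  define S where "S = cmap c ` (cdom c \<inter> (V \<inter> cdom e))"
  define \<Phi> where "\<Phi> = (\<lambda>x. \<Psi> (cinv c x))"
  define G where "G = metric M c"
  note cc = is_chartD(5)[OF ch[OF c(1)]]
  have S: "open S" "cmap c p \<in> S"
    unfolding S_def using chart_image_open[OF ch[OF c(1)], of "V \<inter> cdom e"] V e c(2) by auto
  have A: "hyperbolic_hypersurface S \<Phi> \<kappa> G" unfolding \<Phi>_def G_def
    by (rule hyperbolic_hypersurface_subset[OF hyp[OF c(1)] S(1)]) (auto simp: S_def)
  have C: "lightcone_immersion S (transition c e :: 'e \<Rightarrow> 'e) (\<lambda>x. l (transition c e x)) G" unfolding G_def
    by (rule lightcone_immersion_subset[OF flat[OF c(1)] S(1)]) (auto simp: S_def)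
  interpret A: hyperbolic_hypersurface S \<Phi> \<kappa> G by (rule A)
  note g = A.inner_form_G
  have shape: "\<exists>\<omega> h l r Y. lc \<omega> \<omega> = 1 \<and> (\<forall>u v. A.N x u v = h u v *\<^sub>R \<omega>) \<and> quasi_umbilical (G x) h l r Y"
    if "x \<in> S" for x
    using hypersurface_quasi_umbilical[OF A C assms(1) refl that] by metis
  define x0 where "x0 = cmap c p"
  have x0: "x0 \<in> S" using S by (simp add: x0_def)
  obtain \<omega>0 h0 l0 r0 Y0 where p0: "lc \<omega>0 \<omega>0 = 1" "\<And>u v. A.N x0 u v = h0 u v *\<^sub>R \<omega>0" "quasi_umbilical (G x0) h0 l0 r0 Y0"
    using shape[OF x0] by blast
  \<comment> \<open>With \<open>r0 = 0\<close> the curvature at \<open>x0\<close> would be the same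
    on all planes, against the choice of \<open>\<sigma>\<close> and
    \<open>\<sigma>'\<close>.\<close>
  have r0: "r0 \<noteq> 0"
  proof
    assume "r0 = 0"
    then have "sec_curvature G x0 \<sigma> = sec_curvature G x0 \<sigma>'"
      by (intro sec_curvature_eq_of_angle_eq[OF g[OF x0] A.curvature_shape[OF x0 p0(1,2)] p0(3) \<sigma>(1,2)]) simp
    then show False using \<sigma>(3) by (simp add: G_def x0_def)
  qed
  \<comment> \<open>On \<open>Y0\<close> and on a unit vector orthogonal to it, \<open>h0\<close>
    takes the values \<open>l0 + r0\<close> and \<open>l0\<close>, which cannot both vanish.\<close>
  have "\<exists>u0. h0 u0 u0 \<noteq> 0"
  proof (rule ccontr)
    assume zero: "\<nexists>u0. h0 u0 u0 \<noteq> 0"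
    have "card {Y0} < DIM('e)" using assms(1) by simp
    then obtain w where w: "G x0 w w = 1" "\<And>y. y \<in> {Y0} \<Longrightarrow> G x0 y w = 0"
      using ex_orthogonal_unit[OF g[OF x0], of "{Y0}"] by (metis finite.emptyI finite.insertI)
    then have "h0 w w = l0" "h0 Y0 Y0 = l0 + r0"
      using p0(3) by (simp_all add: quasi_umbilical_def)
    then show False using zero r0 by auto
  qed
  then obtain u0 where u0: "h0 u0 u0 \<noteq> 0" by blast
  \<comment> \<open>Quadratic in \<open>N\<close>, hence independent of the sign of the normal and
    smooth. It equals \<open>h u0 u0\<close> times \<open>h\<close>, and this factor does not change
    the vector \<open>Y\<close>.\<close>
  define H where "H x u v = lc (A.N x u v) (A.N x u0 u0)" for x u v
  have H_scale: "H x u v = h u0 u0 * h u v" if "lc \<omega> \<omega> = 1" "\<And>u v. A.N x u v = h u v *\<^sub>R \<omega>" for x u v \<omega> h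
    using that(1) by (simp add: H_def that(2) lc_simps)
  have sH: "smooth_on (\<lambda>x. H x u v) S" for u v
    unfolding H_def by (rule A.smooth_B[OF A.N_smooth A.N_smooth])
  have bH: "bilinear (H x)" if "x \<in> S" for x
    unfolding bilinear_def H_def by (auto intro!: linearI simp: bilinear_simps[OF A.N_bilinear[OF that]] lc_simps)
  have qH: "\<exists>l r Y. quasi_umbilical (G x) (H x) l r Y" if xS: "x \<in> S" for x
  proof -
    obtain \<omega> h l r Y where *: "lc \<omega> \<omega> = 1" "\<And>u v. A.N x u v = h u v *\<^sub>R \<omega>" "quasi_umbilical (G x) h l r Y"
      using shape[OF xS] by blast
    show ?thesis using quasi_umbilical_scale[OF *(3) H_scale[OF *(1,2)]] by blast
  qed
  have q0: "quasi_umbilical (G x0) (H x0) (h0 u0 u0 * l0) (h0 u0 u0 * r0) Y0"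
    by (rule quasi_umbilical_scale[OF p0(3) H_scale[OF p0(1,2)]])
  have dim3: "DIM('e) \<ge> 3" using assms(1) by simp
  have nz: "h0 u0 u0 * r0 \<noteq> 0" using u0 r0 by simp
  have "\<exists>N X. open N \<and> x0 \<in> N \<and> N \<subseteq> S \<and> smooth_on X N \<and> (\<forall>x\<in>N. X x \<noteq> 0) \<and>
      (\<forall>x\<in>N. \<forall>l r Y. quasi_umbilical (G x) (H x) l r Y \<longrightarrow> (\<exists>s. s \<noteq> 0 \<and> X x = s *\<^sub>R Y))"
  proof (rule smooth_quasi_umbilical_direction[OF S(1) x0 dim3 A.smooth_G g sH bH qH q0 nz])
    fix N X assume "open N" "x0 \<in> N" "N \<subseteq> S" "smooth_on X N" "\<And>x. x \<in> N \<Longrightarrow> X x \<noteq> 0"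
      "\<And>x l r Y. x \<in> N \<Longrightarrow> quasi_umbilical (G x) (H x) l r Y \<Longrightarrow> \<exists>s. s \<noteq> 0 \<and> X x = s *\<^sub>R Y"
    then show ?thesis by (intro exI[of _ N] exI[of _ X]) simp
  qed
  then obtain N X where N: "open N" "x0 \<in> N" "N \<subseteq> S" and X: "smooth_on X N" "\<And>x. x \<in> N \<Longrightarrow> X x \<noteq> 0"
    and XY: "\<And>x l r Y. x \<in> N \<Longrightarrow> quasi_umbilical (G x) (H x) l r Y \<Longrightarrow> \<exists>s. s \<noteq> 0 \<and> X x = s *\<^sub>R Y"
    by auto

  \<comment> \<open>The neighbourhood and its line field\<close>
  define U where "U = cmap c -` N \<inter> (cdom c \<inter> (V \<inter> cdom e))"
  have oU: "open U"
  proof -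
    have "continuous_on (cdom c \<inter> (V \<inter> cdom e)) (cmap c)"
      by (rule continuous_on_subset[OF is_chartD(3)[OF ch[OF c(1)]]]) simp
    moreover have "open (cdom c \<inter> (V \<inter> cdom e))"
      by (intro open_Int V(1) e(1) is_chartD(1) ch c)
    ultimately show ?thesis
      unfolding U_def using N(1) by (simp add: continuous_on_open_vimage)
  qed
  have pU: "p \<in> U" using N(2) c(2) V(2) e(2) by (simp add: U_def x0_def)
  have UD: "q \<in> cdom c" "q \<in> V" "cmap c q \<in> N" "cmap c q \<in> S" if "q \<in> U" for q
    using that N(3) by (auto simp: U_def)
  define \<xi> where "\<xi> d x = (\<lambda>v. dird v (transition c d) (cmap c (cinv d x))) ` span {X (cmap c (cinv d x))}"
    for d :: "('a, 'e) chart" and x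
  have lin: "linear (\<lambda>v. dird v (transition d d') (cmap d q))"
    if "d \<in> atlas M" "d' \<in> atlas M" "q \<in> cdom d" "q \<in> cdom d'" for d d' q
    using smooth_on_linear[OF sm[OF that(1,2)]] that by auto
  have \<xi>_span: "\<xi> d (cmap d q) = span {dird (X (cmap c q)) (transition c d) (cmap c q)}"
    if "d \<in> atlas M" "q \<in> cdom d" "q \<in> U" for d q
    using linear_span_image[OF lin[OF c(1) that(1) UD(1)[OF that(3)] that(2)], of "{X (cmap c q)}"]
      is_chartD(5)[OF ch[OF that(1)] that(2)] by (simp add: \<xi>_def)
  have field: "line_field_on M U \<xi>"
    unfolding line_field_on_def
  proof (intro conjI ballI)
    fix q d assume q: "q \<in> U" and "d \<in> charts_at M q"
    then have d: "d \<in> atlas M" "q \<in> cdom d" by (auto simp: charts_at_def)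
    note dd = is_chartD(5)[OF ch[OF d(1)]]
    define W where "W = cmap d ` (cdom d \<inter> U)"
    define X' where "X' x = dird (X (transition d c x)) (transition c d) (transition d c x)" for x
    have W: "open W" "cmap d q \<in> W"
      unfolding W_def using chart_image_open[OF ch[OF d(1)] oU] d q by auto
    have X'q: "X' (cmap d r) = dird (X (cmap c r)) (transition c d) (cmap c r)" if "r \<in> cdom d" for r
      using dd[OF that] by (simp add: X'_def transition_eq[of d c])
    have tW: "smooth_on (transition d c) W"
      by (rule smooth_on_subset[OF sm[OF d(1) c(1)]]) (use UD in \<open>auto simp: W_def\<close>)
    have imW: "transition d c ` W \<subseteq> N" "transition d c ` W \<subseteq> cmap c ` (cdom c \<inter> cdom d)"
      using dd UD by (auto simp: W_def transition_eq)
    have oc: "open (cmap c ` (cdom c \<inter> cdom d))"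
      by (rule chart_image_open[OF ch[OF c(1)] is_chartD(1)[OF ch[OF d(1)]]])
    have "smooth_on X' W" unfolding X'_def
      by (rule smooth_on_dird_apply[OF W(1) oc sm[OF c(1) d(1)] tW imW(2) smooth_on_compose[OF W(1) N(1) imW(1) X(1) tW]])
    moreover have "X' x \<noteq> 0 \<and> \<xi> d x = span {X' x}" if xW: "x \<in> W" for x
    proof -
      obtain r where r: "x = cmap d r" "r \<in> cdom d" "r \<in> U" using xW by (auto simp: W_def)
      have "X' x \<noteq> 0"
      proof
        assume "X' x = 0"
        then have "X (cmap c r) = 0"
          using transition_inverse[OF M c(1) d(1) UD(1)[OF r(3)] r(2), of "X (cmap c r)"] X'q[OF r(2)] r(1)
            linear_0[OF lin[OF d(1) c(1) r(2) UD(1)[OF r(3)]]] by simp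
        then show False using X(2) UD(3)[OF r(3)] by blast
      qed
      then show ?thesis using \<xi>_span[OF d(1) r(2,3)] X'q[OF r(2)] r(1) by simp
    qed
    moreover have "W \<subseteq> cmap d ` (cdom d \<inter> U)" by (simp add: W_def)
    ultimately show "\<exists>N X. open N \<and> cmap d q \<in> N \<and> N \<subseteq> cmap d ` (cdom d \<inter> U) \<and> smooth_on X N \<and>
        (\<forall>x\<in>N. X x \<noteq> 0 \<and> \<xi> d x = span {X x})"
      using W by (intro exI[of _ W] exI[of _ X']) blast
  next
    fix q d d' assume q: "q \<in> U" and "d \<in> charts_at M q" "d' \<in> charts_at M q"
    then have d: "d \<in> atlas M" "q \<in> cdom d" and d': "d' \<in> atlas M" "q \<in> cdom d'" by (auto simp: charts_at_def)
    show "\<xi> d' (cmap d' q) = frechet_derivative (transition d d') (at (cmap d q)) ` \<xi> d (cmap d q)"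
      unfolding \<xi>_span[OF d q] \<xi>_span[OF d' q] transition_chain[OF M c(1) d(1) d'(1) UD(1)[OF q] d(2) d'(2)]
      using linear_span_image[OF lin[OF d(1) d'(1) d(2) d'(2)], of "{dird (X (cmap c q)) (transition c d) (cmap c q)}"]
      by simp
  qed
  \<comment> \<open>Every chart \<open>d\<close> has to be treated. The hypersurface is set up again
    in \<open>d\<close> and only its second fundamental form is carried over from \<open>c\<close>;
    the Gauss equation in \<open>d\<close> then holds with the same \<open>l\<close> and
    \<open>r\<close> and with the image of \<open>Y\<close>.\<close>
  have curv: "sec_curvature (metric M d) (cmap d q) \<sigma>1 = sec_curvature (metric M d) (cmap d q) \<sigma>2"
    if q: "q \<in> U" and d: "d \<in> atlas M" "q \<in> cdom d" and \<sigma>: "two_plane \<sigma>1" "two_plane \<sigma>2"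
      and ang: "plane_line_angle (metric M d) (cmap d q) \<sigma>1 (\<xi> d (cmap d q)) =
        plane_line_angle (metric M d) (cmap d q) \<sigma>2 (\<xi> d (cmap d q))" for q d \<sigma>1 \<sigma>2
  proof -
    note dd = is_chartD(5)[OF ch[OF d(1)]]
    define W where "W = cmap d ` (cdom d \<inter> U)"
    define T where "T = transition d c"
    have W: "open W" "cmap d q \<in> W"
      unfolding W_def using chart_image_open[OF ch[OF d(1)] oU] d q by auto
    have Tq: "T (cmap d r) = cmap c r" if "r \<in> cdom d" for r
      using dd[OF that] by (simp add: T_def transition_eq)
    have sT: "smooth_on T W" unfolding T_def
      by (rule smooth_on_subset[OF sm[OF d(1) c(1)]]) (use UD in \<open>auto simp: W_def\<close>)
    have TW: "T ` W \<subseteq> S" using Tq UD by (auto simp: W_def)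
    have D: "hyperbolic_hypersurface W (\<lambda>y. \<Phi> (T y)) \<kappa> (metric M d)"
    proof (rule hyperbolic_hypersurface_cong)
      show "hyperbolic_hypersurface W (\<lambda>x. \<Psi> (cinv d x)) \<kappa> (metric M d)"
        by (rule hyperbolic_hypersurface_subset[OF hyp[OF d(1)] W(1)]) (use UD in \<open>auto simp: W_def\<close>)
      show "\<Psi> (cinv d x) = \<Phi> (T x)" if "x \<in> W" for x
        using that cc UD dd by (auto simp: W_def \<Phi>_def T_def transition_eq)
    qed
    interpret D: hyperbolic_hypersurface W "\<lambda>y. \<Phi> (T y)" \<kappa> "metric M d" by (rule D)
    define L where "L v = dird v T (cmap d q)" for v
    define L' where "L' v = dird v (transition c d) (cmap c q)" for v
    have qc: "q \<in> cdom c" by (rule UD(1)[OF q])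
    have LL': "L (L' v) = v" for v
      unfolding L_def L'_def T_def by (rule transition_inverse[OF M c(1) d(1) qc d(2)])
    have surj: "surj (\<lambda>v. dird v T (cmap d q))" using LL' unfolding L_def by (metis surjI)
    have GL: "metric M d (cmap d q) u v = G (cmap c q) (L u) (L v)" for u v
      using met[OF d(1) c(1) d(2) qc] by (simp add: G_def L_def T_def)
    obtain \<omega> h l r Y where sh: "lc \<omega> \<omega> = 1" "\<And>u v. A.N (cmap c q) u v = h u v *\<^sub>R \<omega>"
      "quasi_umbilical (G (cmap c q)) h l r Y"
      using shape[OF UD(4)[OF q]] by blast
    have ND: "D.N (cmap d q) u v = h (L u) (L v) *\<^sub>R \<omega>" for u v
      using N_coordinate_change[OF A D sT TW W(2) surj, of u v] GL sh(2) by (simp add: Tq[OF d(2)] L_def)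
    have qD: "quasi_umbilical (metric M d (cmap d q)) (\<lambda>u v. h (L u) (L v)) l r (L' Y)"
      using sh(3) by (simp add: quasi_umbilical_def GL LL')
    obtain s where s: "s \<noteq> 0" "X (cmap c q) = s *\<^sub>R Y"
      using XY[OF UD(3)[OF q] quasi_umbilical_scale[OF sh(3) H_scale[OF sh(1,2)]]] by blast
    have "\<xi> d (cmap d q) = span {s *\<^sub>R L' Y}"
      using \<xi>_span[OF d q] s(2) linear_scale[OF lin[OF c(1) d(1) qc d(2)]] by (simp add: L'_def)
    also have "\<dots> = span {L' Y}"
      by (rule span_singleton_scale[OF s(1)])
    finally have \<xi>: "\<xi> d (cmap d q) = span {L' Y}" .
    show ?thesis
      by (rule sec_curvature_eq_of_angle_eq[OF D.inner_form_G[OF W(2)] D.curvature_shape[OF W(2) sh(1) ND] qD \<sigma>])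
        (use ang \<xi> in simp)
  qed
  \<comment> \<open>Planes with equal angles have equal curvature whatever the angle is, so any
    constant strictly between 0 and \<open>pi / 2\<close> can serve as
    \<open>\<theta>\<close>.\<close>
  have "globally_1QC_on M U"
    unfolding globally_1QC_on_def
    using field curv by (intro exI[of _ \<xi>] exI[of _ "\<lambda>_. pi / 4"]) (auto simp: charts_at_def)
  then have "locally_1QC_on M U" using oU by (auto simp: locally_1QC_on_def)
  moreover have "U \<subseteq> points M" using c(1) UD(1) by (auto simp: points_def)
  ultimately show "\<exists>U. open U \<and> p \<in> U \<and> U \<subseteq> points M \<and> locally_1QC_on M U"
    using oU pU by blast
qed

end
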